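(* Let $V$ be a finite-dimensional real vector space with $\dim\mathbb{P}(V)\geq 2$. For $i=0,1$, let $\Gamma_i$ be a nontrivial discrete subgroup of $\mathrm{PGL}(V)$ preserving a properly convex open subset $\Omega_i$ of $\mathbb{P}(V)$. Set $\Delta:=\Gamma_0\cap\Gamma_1$ and $\Gamma:=\Gamma_0*_\Delta\Gamma_1$. Suppose that for each $i\in\{0,1\}$ and each $\gamma\in\Gamma_i\smallsetminus\Delta$, the triple of properly convex open sets $(\Omega_{1-i},\ \Omega_i,\ \gamma\cdot\Omega_{1-i})$ is in occultation position, and that there is at least one such triple for some $i$ (i.e. $\Gamma_0\neq\Gamma_1$). Then the representation $\rho:\Gamma\to\mathrm{PGL}(V)$ induced by the inclusions $\Gamma_0,\Gamma_1\hookrightarrow\mathrm{PGL}(V)$ is discrete and faithful, and the $\rho(\Gamma)$-invariant open set $$\Omega:=\bigcup_{\gamma\in\Gamma}\rho(\gamma)\cdot\langle\!\langle\Omega_0\cup\Omega_1\rangle\!\rangle$$ is well defined and properly convex.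
   Context: An open subset of $\mathbb{P}(V)$ is properly convex if it is contained, convex and bounded in some affine chart. For a connected subset $X$ of $\mathbb{P}(V)$ contained in an affine chart, $\langle\!\langle X\rangle\!\rangle$ is its convex hull in that chart (independent of the choice of affine chart containing $X$). For a properly convex open set $\Omega$, its dual is $\Omega^*:=\{H\in\mathbb{P}(V^* ): H\cap\overline{\Omega}=\varnothing\}$, where elements of $\mathbb{P}(V^* )$ are viewed as projective hyperplanes of $\mathbb{P}(V)$. A triple $(A,B,C)$ of properly convex open sets is in occultation position if: $A\not\subset B$ and $C\not\subset B$; $A\cap B\neq\varnothing$, $B\cap C\neq\varnothing$, but $A\cap C=\varnothing$; and $\overline{B^*}\subset A^*\cup C^*$. A representation is discrete and faithful if it is injective with discrete image. *)

theory Defs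
  imports "HOL-Analysis.Analysis" "HOL-Algebra.Coset"
begin

section \<open>The projective space of a real normed vector space\<close>

definition proportional :: "'a::real_vector \<Rightarrow> 'a \<Rightarrow> bool" where
  "proportional x y \<longleftrightarrow> x \<noteq> 0 \<and> y \<noteq> 0 \<and> (\<exists>c. c \<noteq> 0 \<and> y = c *\<^sub>R x)"

lemma ex_nonzero: "\<exists>x::'a::{real_normed_vector,perfect_space}. x \<noteq> 0"
  by (metis (full_types) UNIV_not_singleton UNIV_eq_I singletonI)

text \<open>The class \<open>perfect_space\<close> only serves to exclude the zero space, for which the
  projective space is empty.  The constructor \<open>pclass\<close> sends a nonzero vector to
  the line that it spans (its value at \<open>0\<close> is meaningless); \<open>prep\<close> picks some nonzero
  vector on a line.\<close>

quotient_type (overloaded) 'a proj_space =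
  "'a::{real_normed_vector,perfect_space}" / partial: proportional
  morphisms prep pclass
proof (rule part_equivpI)
  show "\<exists>x::'a. proportional x x"
    using ex_nonzero by (auto simp: proportional_def intro!: exI[of _ "1::real"])
  show "symp (proportional :: 'a \<Rightarrow> 'a \<Rightarrow> bool)"
  proof (rule sympI)
    fix x y :: 'a
    assume "proportional x y"
    then obtain c where "x \<noteq> 0" "y \<noteq> 0" "c \<noteq> 0" "y = c *\<^sub>R x"
      by (auto simp: proportional_def)
    then have "inverse c \<noteq> 0" "x = inverse c *\<^sub>R y" by simp_all
    then show "proportional y x"
      using \<open>x \<noteq> 0\<close> \<open>y \<noteq> 0\<close> unfolding proportional_def by blast
  qed
  show "transp (proportional :: 'a \<Rightarrow> 'a \<Rightarrow> bool)"
  proof (rule transpI)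
    fix x y z :: 'a
    assume "proportional x y" "proportional y z"
    then obtain c d where "x \<noteq> 0" "z \<noteq> 0" "c \<noteq> 0" "d \<noteq> 0" "z = (d * c) *\<^sub>R x"
      by (auto simp: proportional_def)
    then show "proportional x z"
      unfolding proportional_def by (metis mult_eq_0_iff)
  qed
qed

lemma pclass_eq_iff:
  "x \<noteq> 0 \<Longrightarrow> y \<noteq> 0 \<Longrightarrow> pclass x = pclass y \<longleftrightarrow> (\<exists>c. c \<noteq> 0 \<and> y = c *\<^sub>R x)"
proof -
  assume x: "x \<noteq> 0" and y: "y \<noteq> 0"
  then have "proportional x x" "proportional y y"
    by (auto simp: proportional_def intro!: exI[of _ "1::real"])
  then show ?thesis
    using Quotient3_rel[OF Quotient3_proj_space, of x y] x y by (simp add: proportional_def)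
qed

lemma pclass_prep [simp]: "pclass (prep p) = p"
  by (rule Quotient3_abs_rep[OF Quotient3_proj_space])

lemma prep_nonzero [simp]: "prep p \<noteq> 0"
  using Quotient3_rep_reflp[OF Quotient3_proj_space, of p] by (simp add: proportional_def)

lemma prep_pclass:
  assumes "x \<noteq> 0"
  obtains c where "c \<noteq> 0" "prep (pclass x) = c *\<^sub>R x"
  using pclass_eq_iff[OF assms prep_nonzero[of "pclass x"]] by auto

text \<open>The quotient topology.\<close>

instantiation proj_space :: ("{real_normed_vector,perfect_space}") topological_space
begin

definition open_proj_space :: "'a proj_space set \<Rightarrow> bool" where
  "open_proj_space U \<longleftrightarrow> open {x. x \<noteq> 0 \<and> pclass x \<in> U}"

instance
proof
  have "{x::'a. x \<noteq> 0} = - {0}" by auto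
  then show "open (UNIV :: 'a proj_space set)"
    using open_Compl[OF closed_singleton[of "0::'a"]] by (simp add: open_proj_space_def)
next
  fix S T :: "'a proj_space set"
  assume "open S" "open T"
  then have "open ({x. x \<noteq> 0 \<and> pclass x \<in> S} \<inter> {x. x \<noteq> 0 \<and> pclass x \<in> T})"
    unfolding open_proj_space_def by (rule open_Int)
  also have "{x. x \<noteq> 0 \<and> pclass x \<in> S} \<inter> {x. x \<noteq> 0 \<and> pclass x \<in> T} =
      {x. x \<noteq> 0 \<and> pclass x \<in> S \<inter> T}" by auto
  finally show "open (S \<inter> T)" unfolding open_proj_space_def .
next
  fix K :: "'a proj_space set set"
  assume "\<forall>S\<in>K. open S"
  then have "open (\<Union>S\<in>K. {x. x \<noteq> 0 \<and> pclass x \<in> S})"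
    by (intro open_UN) (auto simp: open_proj_space_def)
  also have "(\<Union>S\<in>K. {x. x \<noteq> 0 \<and> pclass x \<in> S}) = {x. x \<noteq> 0 \<and> pclass x \<in> \<Union>K}"
    by auto
  finally show "open (\<Union>K)" unfolding open_proj_space_def .
qed

end

text \<open>This makes \<open>('a \<Rightarrow>\<^sub>L real) proj_space\<close> (the dual projective space) and
  \<open>('a \<Rightarrow>\<^sub>L 'a) proj_space\<close> available.\<close>

instance blinfun :: (euclidean_space, euclidean_space) perfect_space
proof
  fix F :: "'a \<Rightarrow>\<^sub>L 'b"
  obtain a :: 'a and b :: 'b where a: "a \<in> Basis" and b: "b \<in> Basis"
    by (meson SOME_Basis)
  define G :: "'a \<Rightarrow>\<^sub>L 'b" where "G = Blinfun (\<lambda>x. (x \<bullet> a) *\<^sub>R b)"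
  have "bounded_linear (\<lambda>x. (x \<bullet> a) *\<^sub>R b)"
    by (intro bounded_linear_scaleR_left[THEN bounded_linear_compose] bounded_linear_inner_left)
  then have "blinfun_apply G a = b"
    using a by (simp add: G_def bounded_linear_Blinfun_apply)
  then have "G \<noteq> 0" using b nonzero_Basis by fastforce
  show "\<not> open {F}"
  proof
    assume "open {F}"
    then obtain e where e: "e > 0" "\<And>H. dist H F < e \<Longrightarrow> H = F"
      unfolding open_dist by auto
    have "dist (F + (e / (2 * norm G)) *\<^sub>R G) F < e"
      using \<open>G \<noteq> 0\<close> e(1) by (simp add: dist_norm)
    then have "F + (e / (2 * norm G)) *\<^sub>R G = F" by (rule e(2))
    then show False using \<open>G \<noteq> 0\<close> e(1) by simp
  qed
qed

section \<open>The projective linear group\<close>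

text \<open>The class of an automorphism \<open>g\<close> modulo scalars is the point \<open>pclass g\<close> of the projective
  space of \<open>End V\<close>.  Thus the carrier of \<open>PGL\<close> is an open subset of \<open>('a \<Rightarrow>\<^sub>L 'a) proj_space\<close>,
  and the induced topology is the quotient topology of \<open>GL V\<close>.\<close>

definition PGL :: "('a::euclidean_space \<Rightarrow>\<^sub>L 'a) proj_space monoid" where
  "PGL = \<lparr> carrier = pclass ` {g. bij (blinfun_apply g)},
           mult = (\<lambda>S T. pclass (prep S o\<^sub>L prep T)),
           one = pclass id_blinfun \<rparr>"

definition pgl_act :: "('a::euclidean_space \<Rightarrow>\<^sub>L 'a) proj_space \<Rightarrow> 'a proj_space \<Rightarrow> 'a proj_space"
  where "pgl_act S p = pclass (blinfun_apply (prep S) (prep p))"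

lemma bij_blinfun_nonzero:
  fixes g :: "'a::euclidean_space \<Rightarrow>\<^sub>L 'a"
  assumes "bij (blinfun_apply g)"
  shows "g \<noteq> 0" and "x \<noteq> 0 \<Longrightarrow> blinfun_apply g x \<noteq> 0"
proof -
  show *: "blinfun_apply g x \<noteq> 0" if "x \<noteq> 0" for x
    using assms that by (metis bij_def blinfun.zero_right injD)
  obtain x :: 'a where "x \<noteq> 0" using ex_nonzero by blast
  then show "g \<noteq> 0" using * by force
qed

lemma PGL_mult:
  fixes g h :: "'a::euclidean_space \<Rightarrow>\<^sub>L 'a"
  assumes g: "bij (blinfun_apply g)" and h: "bij (blinfun_apply h)"
  shows "pclass g \<otimes>\<^bsub>PGL\<^esub> pclass h = pclass (g o\<^sub>L h)"
proof -
  obtain c where c: "c \<noteq> 0" "prep (pclass g) = c *\<^sub>R g"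
    using prep_pclass bij_blinfun_nonzero(1)[OF g] by blast
  obtain d where d: "d \<noteq> 0" "prep (pclass h) = d *\<^sub>R h"
    using prep_pclass bij_blinfun_nonzero(1)[OF h] by blast
  have eq: "(c *\<^sub>R g) o\<^sub>L (d *\<^sub>R h) = (c * d) *\<^sub>R (g o\<^sub>L h)"
    by (rule blinfun_eqI) (simp add: blinfun.scaleR_left blinfun.scaleR_right)
  have "bij (blinfun_apply (g o\<^sub>L h))"
    using bij_comp[OF h g] by (simp add: blinfun_compose.rep_eq)
  then have "g o\<^sub>L h \<noteq> 0" by (rule bij_blinfun_nonzero)
  then have "pclass (g o\<^sub>L h) = pclass ((c * d) *\<^sub>R (g o\<^sub>L h))"
    using c d by (subst pclass_eq_iff) (auto intro!: exI[of _ "c * d"])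
  then show ?thesis using c d by (simp add: PGL_def eq)
qed

lemma pgl_act_pclass:
  fixes g :: "'a::euclidean_space \<Rightarrow>\<^sub>L 'a"
  assumes g: "bij (blinfun_apply g)" and x: "x \<noteq> 0"
  shows "pgl_act (pclass g) (pclass x) = pclass (blinfun_apply g x)"
proof -
  obtain c where c: "c \<noteq> 0" "prep (pclass g) = c *\<^sub>R g"
    using prep_pclass bij_blinfun_nonzero(1)[OF g] by blast
  obtain d where d: "d \<noteq> 0" "prep (pclass x) = d *\<^sub>R x"
    using prep_pclass x by blast
  have "pclass (blinfun_apply g x) = pclass ((c * d) *\<^sub>R blinfun_apply g x)"
    using c d bij_blinfun_nonzero(2)[OF g x]
    by (subst pclass_eq_iff) (auto intro!: exI[of _ "c * d"])
  then show ?thesis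
    using c d by (simp add: pgl_act_def blinfun.scaleR_left blinfun.scaleR_right mult.commute)
qed

lemma bij_blinfun_compose:
  fixes g h :: "'a::euclidean_space \<Rightarrow>\<^sub>L 'a"
  assumes "bij (blinfun_apply g)" "bij (blinfun_apply h)"
  shows "bij (blinfun_apply (g o\<^sub>L h))"
  using bij_comp[OF assms(2,1)] by (simp add: blinfun_compose.rep_eq)

lemma PGL_cases:
  assumes "S \<in> carrier PGL"
  obtains g where "S = pclass g" "bij (blinfun_apply g)"
  using assms unfolding PGL_def by auto

lemma PGL_carrier: "bij (blinfun_apply g) \<Longrightarrow> pclass g \<in> carrier PGL"
  unfolding PGL_def by simp

lemma PGL_one: "\<one>\<^bsub>PGL\<^esub> = pclass id_blinfun"
  unfolding PGL_def by simp

lemma bij_id_blinfun: "bij (blinfun_apply id_blinfun)"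
  by (simp add: id_blinfun.rep_eq bij_id[unfolded id_def])

lemma group_PGL: "group (PGL :: ('a::euclidean_space \<Rightarrow>\<^sub>L 'a) proj_space monoid)"
proof (rule groupI)
  let ?P = "PGL :: ('a \<Rightarrow>\<^sub>L 'a) proj_space monoid"
  show "\<one>\<^bsub>?P\<^esub> \<in> carrier ?P"
    unfolding PGL_one by (rule PGL_carrier) (rule bij_id_blinfun)
  fix S T assume S: "S \<in> carrier ?P" and T: "T \<in> carrier ?P"
  obtain f where f: "S = pclass f" "bij (blinfun_apply f)" using S by (rule PGL_cases)
  obtain g where g: "T = pclass g" "bij (blinfun_apply g)" using T by (rule PGL_cases)
  show "S \<otimes>\<^bsub>?P\<^esub> T \<in> carrier ?P"
    unfolding f(1) g(1) PGL_mult[OF f(2) g(2)]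
    by (rule PGL_carrier) (rule bij_blinfun_compose[OF f(2) g(2)])
  fix U assume U: "U \<in> carrier ?P"
  obtain h where h: "U = pclass h" "bij (blinfun_apply h)" using U by (rule PGL_cases)
  have "(f o\<^sub>L g) o\<^sub>L h = f o\<^sub>L (g o\<^sub>L h)" by (rule blinfun_eqI) simp
  then show "S \<otimes>\<^bsub>?P\<^esub> T \<otimes>\<^bsub>?P\<^esub> U = S \<otimes>\<^bsub>?P\<^esub> (T \<otimes>\<^bsub>?P\<^esub> U)"
    by (simp only: f(1) g(1) h(1) PGL_mult f(2) g(2) h(2) bij_blinfun_compose)
next
  let ?P = "PGL :: ('a \<Rightarrow>\<^sub>L 'a) proj_space monoid"
  fix S assume S: "S \<in> carrier ?P"
  obtain g where g: "S = pclass g" "bij (blinfun_apply g)" using S by (rule PGL_cases)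
  have "id_blinfun o\<^sub>L g = g" by (rule blinfun_eqI) simp
  then show "\<one>\<^bsub>?P\<^esub> \<otimes>\<^bsub>?P\<^esub> S = S"
    by (simp only: PGL_one g(1) PGL_mult[OF bij_id_blinfun g(2)])
  have "linear (inv_into UNIV (blinfun_apply g))"
    using g(2) by (intro inj_linear_imp_inv_linear bounded_linear.linear
        blinfun.bounded_linear_right bij_is_inj)
  then have bl: "bounded_linear (inv_into UNIV (blinfun_apply g))"
    by (simp add: linear_conv_bounded_linear)
  define h where "h = Blinfun (inv_into UNIV (blinfun_apply g))"
  have h: "blinfun_apply h = inv_into UNIV (blinfun_apply g)"
    using bl by (simp add: h_def bounded_linear_Blinfun_apply)
  have bh: "bij (blinfun_apply h)" unfolding h using g(2) by (rule bij_imp_bij_inv)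
  have "h o\<^sub>L g = id_blinfun"
    using g(2) by (intro blinfun_eqI) (simp add: h bij_is_inj)
  then have "pclass h \<otimes>\<^bsub>?P\<^esub> S = \<one>\<^bsub>?P\<^esub>"
    by (simp only: PGL_one g(1) PGL_mult[OF bh g(2)])
  then show "\<exists>T\<in>carrier ?P. T \<otimes>\<^bsub>?P\<^esub> S = \<one>\<^bsub>?P\<^esub>"
    using PGL_carrier[OF bh] by (rule bexI)
qed

section \<open>Convexity and duality in projective space\<close>

text \<open>A hyperplane is an element of the dual projective space; the affine chart attached to \<open>H\<close> is
  the complement of \<open>H\<close>, identified with the affine hyperplane \<open>{x. f x = 1}\<close> for a linear form
  \<open>f\<close> representing \<open>H\<close>.  Another choice of \<open>f\<close> only rescales this affine hyperplane.\<close>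

definition hyperplane :: "('a::euclidean_space \<Rightarrow>\<^sub>L real) proj_space \<Rightarrow> 'a proj_space set" where
  "hyperplane H = pclass ` {x. x \<noteq> 0 \<and> blinfun_apply (prep H) x = 0}"

lemma pclass_mem_hyperplane:
  fixes f :: "'a::euclidean_space \<Rightarrow>\<^sub>L real"
  assumes "f \<noteq> 0" and x: "x \<noteq> 0"
  shows "pclass x \<in> hyperplane (pclass f) \<longleftrightarrow> blinfun_apply f x = 0"
proof -
  obtain c where c: "c \<noteq> 0" "prep (pclass f) = c *\<^sub>R f"
    using prep_pclass assms(1) by blast
  have "blinfun_apply f x = 0" if y: "y \<noteq> 0" "blinfun_apply f y = 0" "pclass x = pclass y" for y
  proof -
    obtain d where "d \<noteq> 0" "y = d *\<^sub>R x"
      using y(3) pclass_eq_iff[OF x y(1)] by auto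
    then show ?thesis using y by (simp add: blinfun.scaleR_right)
  qed
  then have "(\<exists>y. y \<noteq> 0 \<and> blinfun_apply f y = 0 \<and> pclass x = pclass y) \<longleftrightarrow> blinfun_apply f x = 0"
    using x by blast
  moreover have "pclass x \<in> hyperplane (pclass f) \<longleftrightarrow>
      (\<exists>y. y \<noteq> 0 \<and> blinfun_apply f y = 0 \<and> pclass x = pclass y)"
    using c(1) unfolding hyperplane_def c(2) image_iff
    by (simp add: blinfun.scaleR_left Bex_def conj_assoc)
  ultimately show ?thesis by simp
qed

definition affine_chart :: "('a::euclidean_space \<Rightarrow>\<^sub>L real) proj_space \<Rightarrow> 'a proj_space set" where
  "affine_chart H = - hyperplane H"

definition chart_set ::
  "('a::euclidean_space \<Rightarrow>\<^sub>L real) proj_space \<Rightarrow> 'a proj_space set \<Rightarrow> 'a set" where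
  "chart_set H X = {x. blinfun_apply (prep H) x = 1 \<and> pclass x \<in> X}"

definition properly_convex :: "'a::euclidean_space proj_space set \<Rightarrow> bool" where
  "properly_convex X \<longleftrightarrow> open X \<and>
     (\<exists>H. X \<subseteq> affine_chart H \<and> convex (chart_set H X) \<and> bounded (chart_set H X))"

definition chart_hull ::
  "('a::euclidean_space \<Rightarrow>\<^sub>L real) proj_space \<Rightarrow> 'a proj_space set \<Rightarrow> 'a proj_space set" where
  "chart_hull H X = pclass ` (convex hull (chart_set H X))"

text \<open>The hull is well defined if \<open>X\<close> is connected, is contained in an affine chart, and the
  hull of \<open>X\<close> is the same in every affine chart containing \<open>X\<close>.\<close>

definition proj_hull_defined :: "'a::euclidean_space proj_space set \<Rightarrow> bool" where
  "proj_hull_defined X \<longleftrightarrow> connected X \<and>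
     (\<exists>!Y. \<exists>H. X \<subseteq> affine_chart H \<and> Y = chart_hull H X)"

definition proj_hull :: "'a::euclidean_space proj_space set \<Rightarrow> 'a proj_space set" where
  "proj_hull X = (THE Y. \<exists>H. X \<subseteq> affine_chart H \<and> Y = chart_hull H X)"

definition dual_set ::
  "'a::euclidean_space proj_space set \<Rightarrow> ('a \<Rightarrow>\<^sub>L real) proj_space set" where
  "dual_set X = {H. hyperplane H \<inter> closure X = {}}"

definition occultation_position ::
  "'a::euclidean_space proj_space set \<Rightarrow> 'a proj_space set \<Rightarrow> 'a proj_space set \<Rightarrow> bool" where
  "occultation_position A B C \<longleftrightarrow>
     \<not> A \<subseteq> B \<and> \<not> C \<subseteq> B \<and>
     A \<inter> B \<noteq> {} \<and> B \<inter> C \<noteq> {} \<and> A \<inter> C = {} \<and>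
     closure (dual_set B) \<subseteq> dual_set A \<union> dual_set C"

section \<open>Amalgamated free products\<close>

text \<open>The amalgamated free product of \<open>A\<close> and \<open>B\<close> along \<open>i : C \<rightarrow> A\<close> and \<open>j : C \<rightarrow> B\<close>, given by
  generators and relations: words in the disjoint union of the carriers, modulo the congruence
  generated by the multiplication tables of \<open>A\<close> and \<open>B\<close> and by \<open>i c = j c\<close> for \<open>c\<close> in \<open>C\<close>.\<close>

definition amalgam_words :: "('a, 'm) monoid_scheme \<Rightarrow> ('b, 'n) monoid_scheme \<Rightarrow> ('a + 'b) list set"
  where "amalgam_words A B = lists (carrier A <+> carrier B)"

inductive amalgam_rel :: "('a, 'm) monoid_scheme \<Rightarrow> ('b, 'n) monoid_scheme \<Rightarrow>
    ('c, 'k) monoid_scheme \<Rightarrow> ('c \<Rightarrow> 'a) \<Rightarrow> ('c \<Rightarrow> 'b) \<Rightarrow> ('a + 'b) list \<Rightarrow> ('a + 'b) list \<Rightarrow> bool"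
  for A B C i j where
  refl: "w \<in> amalgam_words A B \<Longrightarrow> amalgam_rel A B C i j w w"
| sym: "amalgam_rel A B C i j v w \<Longrightarrow> amalgam_rel A B C i j w v"
| trans: "amalgam_rel A B C i j u v \<Longrightarrow> amalgam_rel A B C i j v w \<Longrightarrow> amalgam_rel A B C i j u w"
| append: "amalgam_rel A B C i j v v' \<Longrightarrow> amalgam_rel A B C i j w w' \<Longrightarrow>
    amalgam_rel A B C i j (v @ w) (v' @ w')"
| one_left: "amalgam_rel A B C i j [Inl \<one>\<^bsub>A\<^esub>] []"
| one_right: "amalgam_rel A B C i j [Inr \<one>\<^bsub>B\<^esub>] []"
| mult_left: "a \<in> carrier A \<Longrightarrow> a' \<in> carrier A \<Longrightarrow>
    amalgam_rel A B C i j [Inl a, Inl a'] [Inl (a \<otimes>\<^bsub>A\<^esub> a')]"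
| mult_right: "b \<in> carrier B \<Longrightarrow> b' \<in> carrier B \<Longrightarrow>
    amalgam_rel A B C i j [Inr b, Inr b'] [Inr (b \<otimes>\<^bsub>B\<^esub> b')]"
| glue: "c \<in> carrier C \<Longrightarrow> amalgam_rel A B C i j [Inl (i c)] [Inr (j c)]"

definition amalgam_class :: "('a, 'm) monoid_scheme \<Rightarrow> ('b, 'n) monoid_scheme \<Rightarrow>
    ('c, 'k) monoid_scheme \<Rightarrow> ('c \<Rightarrow> 'a) \<Rightarrow> ('c \<Rightarrow> 'b) \<Rightarrow> ('a + 'b) list \<Rightarrow> ('a + 'b) list set" where
  "amalgam_class A B C i j w = {v. amalgam_rel A B C i j w v}"

definition amalgam :: "('a, 'm) monoid_scheme \<Rightarrow> ('b, 'n) monoid_scheme \<Rightarrow>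
    ('c, 'k) monoid_scheme \<Rightarrow> ('c \<Rightarrow> 'a) \<Rightarrow> ('c \<Rightarrow> 'b) \<Rightarrow> ('a + 'b) list set monoid" where
  "amalgam A B C i j =
    \<lparr> carrier = amalgam_class A B C i j ` amalgam_words A B,
      mult = (\<lambda>X Y. amalgam_class A B C i j ((SOME v. v \<in> X) @ (SOME w. w \<in> Y))),
      one = amalgam_class A B C i j [] \<rparr>"

text \<open>For homomorphisms \<open>\<phi>\<close> on \<open>A\<close> and \<open>\<psi>\<close> on \<open>B\<close> that agree on \<open>C\<close>, \<open>amalgam_lift G \<phi> \<psi>\<close> is the
  homomorphism that they induce on the amalgam: it multiplies out any representing word (see
  \<open>amalgam_lift_hom\<close>, \<open>amalgam_lift_left\<close>, \<open>amalgam_lift_right\<close> below).\<close>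

definition word_value :: "('g, 'm) monoid_scheme \<Rightarrow> ('a \<Rightarrow> 'g) \<Rightarrow> ('b \<Rightarrow> 'g) \<Rightarrow> ('a + 'b) list \<Rightarrow> 'g"
  where "word_value G \<phi> \<psi> w = foldr (\<lambda>s x. case_sum \<phi> \<psi> s \<otimes>\<^bsub>G\<^esub> x) w \<one>\<^bsub>G\<^esub>"

definition amalgam_lift ::
  "('g, 'm) monoid_scheme \<Rightarrow> ('a \<Rightarrow> 'g) \<Rightarrow> ('b \<Rightarrow> 'g) \<Rightarrow> ('a + 'b) list set \<Rightarrow> 'g" where
  "amalgam_lift G \<phi> \<psi> X = word_value G \<phi> \<psi> (SOME w. w \<in> X)"

definition discrete_faithful ::
  "('g, 'm) monoid_scheme \<Rightarrow> ('g \<Rightarrow> 'h::topological_space) \<Rightarrow> bool" where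
  "discrete_faithful G \<rho> \<longleftrightarrow> inj_on \<rho> (carrier G) \<and> discrete (\<rho> ` carrier G)"

locale amalgam_data =
  A: group A + B: group B
  for A :: "('a, 'm) monoid_scheme" (structure) and B :: "('b, 'n) monoid_scheme" (structure) +
  fixes C :: "('c, 'k) monoid_scheme" and i :: "'c \<Rightarrow> 'a" and j :: "'c \<Rightarrow> 'b"
  assumes i_closed: "c \<in> carrier C \<Longrightarrow> i c \<in> carrier A"
    and j_closed: "c \<in> carrier C \<Longrightarrow> j c \<in> carrier B"
begin

abbreviation W where "W \<equiv> amalgam_words A B"
abbreviation R where "R \<equiv> amalgam_rel A B C i j"
abbreviation K where "K \<equiv> amalgam_class A B C i j"
abbreviation P where "P \<equiv> amalgam A B C i j"

lemma words_simps [simp]: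
  "[] \<in> W" "Inl a # w \<in> W \<longleftrightarrow> a \<in> carrier A \<and> w \<in> W"
  "Inr b # w \<in> W \<longleftrightarrow> b \<in> carrier B \<and> w \<in> W" "v @ w \<in> W \<longleftrightarrow> v \<in> W \<and> w \<in> W"
  by (auto simp: amalgam_words_def)

lemma rel_words: "R v w \<Longrightarrow> v \<in> W \<and> w \<in> W"
  by (induction rule: amalgam_rel.induct) (auto simp: i_closed j_closed)

lemma class_eqI: "R v w \<Longrightarrow> K v = K w"
  unfolding amalgam_class_def using amalgam_rel.sym amalgam_rel.trans by blast

lemma rel_some: "w \<in> W \<Longrightarrow> R w (SOME v. v \<in> K w)"
  unfolding amalgam_class_def mem_Collect_eq by (rule someI) (rule amalgam_rel.refl)

lemma mult_class: "v \<in> W \<Longrightarrow> w \<in> W \<Longrightarrow> K v \<otimes>\<^bsub>P\<^esub> K w = K (v @ w)"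
  using class_eqI[OF amalgam_rel.append[OF rel_some rel_some], of v w] by (simp add: amalgam_def)

lemma one_class: "\<one>\<^bsub>P\<^esub> = K []"
  by (simp add: amalgam_def)

lemma carrier_amalgam: "carrier P = K ` W"
  by (simp add: amalgam_def)

lemma inverse_word: "w \<in> W \<Longrightarrow> \<exists>v\<in>W. R (v @ w) []"
proof (induction w)
  case Nil
  then show ?case by (auto intro!: bexI[of _ "[]"] amalgam_rel.refl)
next
  case (Cons s w)
  have sw: "s \<in> carrier A <+> carrier B" "w \<in> W"
    using Cons.prems by (auto simp: amalgam_words_def)
  then obtain v where v: "v \<in> W" "R (v @ w) []" using Cons.IH by blast
  obtain t where t: "[t] \<in> W" "R [t, s] []"
  proof (cases s)
    case (Inl a)
    then have a: "a \<in> carrier A" using sw by auto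
    have "R [Inl (inv\<^bsub>A\<^esub> a), Inl a] [Inl \<one>\<^bsub>A\<^esub>]"
      using amalgam_rel.mult_left[OF A.inv_closed[OF a] a, where B=B and C=C and i=i and j=j] a by simp
    then have "R [Inl (inv\<^bsub>A\<^esub> a), Inl a] []"
      by (rule amalgam_rel.trans) (rule amalgam_rel.one_left)
    then show ?thesis using Inl a by (intro that[of "Inl (inv\<^bsub>A\<^esub> a)"]) simp_all
  next
    case (Inr b)
    then have b: "b \<in> carrier B" using sw by auto
    have "R [Inr (inv\<^bsub>B\<^esub> b), Inr b] [Inr \<one>\<^bsub>B\<^esub>]"
      using amalgam_rel.mult_right[OF B.inv_closed[OF b] b, where A=A and C=C and i=i and j=j] b by simp
    then have "R [Inr (inv\<^bsub>B\<^esub> b), Inr b] []"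
      by (rule amalgam_rel.trans) (rule amalgam_rel.one_right)
    then show ?thesis using Inr b by (intro that[of "Inr (inv\<^bsub>B\<^esub> b)"]) simp_all
  qed
  have "R (v @ [t, s]) (v @ [])"
    by (intro amalgam_rel.append amalgam_rel.refl v t)
  from amalgam_rel.append[OF this amalgam_rel.refl[OF sw(2)]]
  have "R ((v @ [t]) @ s # w) (v @ w)" by simp
  then have "R ((v @ [t]) @ s # w) []" using v(2) by (rule amalgam_rel.trans)
  then show ?case using v t by (intro bexI[of _ "v @ [t]"]) simp_all
qed

lemma group_amalgam: "group P"
proof (rule groupI)
  show "\<one>\<^bsub>P\<^esub> \<in> carrier P" by (simp add: one_class carrier_amalgam)
  show "X \<otimes>\<^bsub>P\<^esub> Y \<in> carrier P" if "X \<in> carrier P" "Y \<in> carrier P" for X Y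
    using that by (auto simp: carrier_amalgam mult_class)
  show "X \<otimes>\<^bsub>P\<^esub> Y \<otimes>\<^bsub>P\<^esub> Z = X \<otimes>\<^bsub>P\<^esub> (Y \<otimes>\<^bsub>P\<^esub> Z)"
    if "X \<in> carrier P" "Y \<in> carrier P" "Z \<in> carrier P" for X Y Z
    using that by (auto simp: carrier_amalgam mult_class)
  show "\<one>\<^bsub>P\<^esub> \<otimes>\<^bsub>P\<^esub> X = X" if "X \<in> carrier P" for X
    using that by (auto simp: carrier_amalgam mult_class one_class)
  show "\<exists>Y\<in>carrier P. Y \<otimes>\<^bsub>P\<^esub> X = \<one>\<^bsub>P\<^esub>" if X: "X \<in> carrier P" for X
  proof -
    obtain w where w: "w \<in> W" "X = K w" using X by (auto simp: carrier_amalgam)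
    then obtain v where v: "v \<in> W" "R (v @ w) []" using inverse_word by blast
    have "K v \<in> carrier P" using v(1) by (simp add: carrier_amalgam)
    moreover have "K v \<otimes>\<^bsub>P\<^esub> X = \<one>\<^bsub>P\<^esub>"
      using class_eqI[OF v(2)] v(1) w by (simp only: mult_class one_class)
    ultimately show ?thesis by blast
  qed
qed

context
  fixes G :: "('g, 'l) monoid_scheme" and \<phi> \<psi>
  assumes G: "group G" and \<phi>: "\<phi> \<in> hom A G" and \<psi>: "\<psi> \<in> hom B G"
    and agree: "\<And>c. c \<in> carrier C \<Longrightarrow> \<phi> (i c) = \<psi> (j c)"
begin

interpretation G: group G by (rule G)

lemma word_value_closed: "w \<in> W \<Longrightarrow> word_value G \<phi> \<psi> w \<in> carrier G"
  by (induction w)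
    (use \<phi> \<psi> in \<open>auto simp: word_value_def amalgam_words_def hom_def split: sum.split\<close>)

lemma word_value_append:
  "v \<in> W \<Longrightarrow> w \<in> W \<Longrightarrow>
    word_value G \<phi> \<psi> (v @ w) = word_value G \<phi> \<psi> v \<otimes>\<^bsub>G\<^esub> word_value G \<phi> \<psi> w"
proof (induction v)
  case Nil
  then show ?case using word_value_closed[of w] by (simp add: word_value_def)
next
  case (Cons s v)
  have v: "v \<in> W" and s: "case_sum \<phi> \<psi> s \<in> carrier G"
    using Cons.prems(1) \<phi> \<psi> by (auto simp: amalgam_words_def hom_def)
  have "word_value G \<phi> \<psi> (s # v @ w) = case_sum \<phi> \<psi> s \<otimes>\<^bsub>G\<^esub> word_value G \<phi> \<psi> (v @ w)"
    by (simp add: word_value_def)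
  also have "\<dots> = (case_sum \<phi> \<psi> s \<otimes>\<^bsub>G\<^esub> word_value G \<phi> \<psi> v) \<otimes>\<^bsub>G\<^esub> word_value G \<phi> \<psi> w"
    using Cons.IH[OF v Cons.prems(2)] s word_value_closed[OF v] word_value_closed[OF Cons.prems(2)]
    by (simp add: G.m_assoc)
  finally show ?case by (simp add: word_value_def)
qed

lemma word_value_letter:
  "a \<in> carrier A \<Longrightarrow> word_value G \<phi> \<psi> [Inl a] = \<phi> a"
  "b \<in> carrier B \<Longrightarrow> word_value G \<phi> \<psi> [Inr b] = \<psi> b"
  using \<phi> \<psi> by (auto simp: word_value_def hom_def Pi_iff)

lemma word_value_rel: "R v w \<Longrightarrow> word_value G \<phi> \<psi> v = word_value G \<phi> \<psi> w"
proof (induction rule: amalgam_rel.induct)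
  case (append v v' w w')
  then show ?case by (simp add: word_value_append rel_words)
next
  case one_left
  show ?case using hom_one[OF \<phi> A.is_group G] by (simp add: word_value_def)
next
  case one_right
  show ?case using hom_one[OF \<psi> B.is_group G] by (simp add: word_value_def)
next
  case (mult_left a a')
  then show ?case using \<phi> by (auto simp: word_value_def hom_def Pi_iff G.m_assoc)
next
  case (mult_right b b')
  then show ?case using \<psi> by (auto simp: word_value_def hom_def Pi_iff G.m_assoc)
next
  case (glue c)
  then show ?case by (simp add: word_value_letter i_closed j_closed agree)
next
  case (trans u v w)
  then show ?case by metis
qed (rule HOL.refl, rule HOL.sym)

lemma amalgam_lift_class: "w \<in> W \<Longrightarrow> amalgam_lift G \<phi> \<psi> (K w) = word_value G \<phi> \<psi> w"
  unfolding amalgam_lift_def by (rule word_value_rel[OF rel_some, symmetric])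

lemma amalgam_lift_hom: "amalgam_lift G \<phi> \<psi> \<in> hom P G"
proof (rule homI)
  fix X assume "X \<in> carrier P"
  then obtain v where v: "v \<in> W" "X = K v" by (auto simp: carrier_amalgam)
  then show "amalgam_lift G \<phi> \<psi> X \<in> carrier G"
    by (simp only: amalgam_lift_class word_value_closed)
  fix Y assume "Y \<in> carrier P"
  then obtain w where w: "w \<in> W" "Y = K w" by (auto simp: carrier_amalgam)
  have "v @ w \<in> W" using v w by simp
  then show "amalgam_lift G \<phi> \<psi> (X \<otimes>\<^bsub>P\<^esub> Y) =
      amalgam_lift G \<phi> \<psi> X \<otimes>\<^bsub>G\<^esub> amalgam_lift G \<phi> \<psi> Y"
    by (simp only: v w mult_class amalgam_lift_class word_value_append)
qed

lemma amalgam_lift_left: "a \<in> carrier A \<Longrightarrow> amalgam_lift G \<phi> \<psi> (K [Inl a]) = \<phi> a"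
  by (simp add: amalgam_lift_class word_value_letter)

lemma amalgam_lift_right: "b \<in> carrier B \<Longrightarrow> amalgam_lift G \<phi> \<psi> (K [Inr b]) = \<psi> b"
  by (simp add: amalgam_lift_class word_value_letter)

end

end

end

theory Submission
  imports Defs
begin

text \<open>
  The argument lives on the Bass-Serre tree of the amalgam.  To a vertex corresponds a translate of
  \<open>\<Omega>0\<close> or \<open>\<Omega>1\<close>, to an edge a translate of the hull of \<open>\<Omega>0 \<union> \<Omega>1\<close>, and the assumption says that a
  vertex set hides any two of its neighbours from each other: a hyperplane missing the vertex set
  also misses the closure of one of the neighbours.  All sets are lifted to open sharp convex cones,
  the signs being chosen such that neighbouring cones meet; hyperplanes become linear forms, dual
  convex sets become dual cones, and the hull of two sets becomes the sum of two cones.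

  The heart of the proof is that occultation propagates along paths in the tree
  (\<open>occulted_glue\<close>): if \<open>A, B, C\<close> and \<open>B, C, D\<close> are in occultation position, then so are
  the hull of \<open>A \<union> B\<close>, \<open>C\<close> and \<open>D\<close>.  Consider the forms that are nonnegative on \<open>B\<close> and \<open>C\<close>.  One
  that is positive neither on the closure of \<open>A\<close> nor on that of \<open>D\<close> must be positive on those of \<open>B\<close> and \<open>C\<close>.  So,
  inside the intersection of two half-spaces of forms, those nonnegative on \<open>B\<close> and \<open>C\<close> would be both
  open and closed.  As the dimension is at least three, this intersection minus the origin is
  connected and contains a line without the origin, which a cone of forms nonnegative on an open set
  cannot contain.

  Consequently a vertex set hides from each other any two paths that leave it through different neighbours
  (\<open>branch_occulted\<close>), and three properties of the union \<open>\<Omega>\<close> follow.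
  \<^item> \<^emph>\<open>Convexity.\<close>  A segment between sets hidden from each other by \<open>B\<close> meets \<open>B\<close>, so the hull of a path
    is the union of the hulls of its edges (\<open>occulted_sum_split\<close>, \<open>branch_subset_domain\<close>), and any
    two points of \<open>\<Omega>\<close> lie in the hull of a path.
  \<^item> \<^emph>\<open>Boundedness in a chart.\<close>  Among the forms that are nonnegative on a vertex cone, those that are
    negative somewhere on the different branches at this vertex make up disjoint open parts.  A
    connectedness argument shows that what remains, the forms that are nonnegative on \<open>\<Omega>\<close>, has interior
    points (\<open>interior_dual_cone_of_branches\<close>, \<open>interior_dual_domain_cone\<close>).
  \<^item> \<^emph>\<open>Discreteness and faithfulness.\<close>  A reduced word with at least two letters moves \<open>\<Omega>0 \<inter> \<Omega>1\<close> off
    itself (\<open>alternating_moves\<close>), because the image lies in a branch hidden from one end of the edge.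
    Elements near the identity therefore come from one of the two given discrete groups.
\<close>

section \<open>Open convex cones and their duals\<close>

definition dual_cone :: "'a::euclidean_space set \<Rightarrow> 'a set" where
  "dual_cone X = {y. \<forall>x\<in>X. 0 \<le> y \<bullet> x}"

text \<open>A \<open>proper_cone\<close> is one of the two lifts to the vector space of a nonempty properly convex open
  set; sharpness of the cone is expressed by an interior point of its dual cone.  The interior of
  the dual cone is a lift of the dual convex set: see \<open>interior_dual_cone_iff\<close>.  Linear forms are
  written as vectors, by means of the inner product.\<close>

definition proper_cone :: "'a::euclidean_space set \<Rightarrow> bool" where
  "proper_cone X \<longleftrightarrow> open X \<and> convex X \<and> X \<noteq> {} \<and> (\<forall>x\<in>X. \<forall>c>0. c *\<^sub>R x \<in> X) \<and>
     interior (dual_cone X) \<noteq> {}"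

lemma dual_coneI: "(\<And>x. x \<in> X \<Longrightarrow> 0 \<le> y \<bullet> x) \<Longrightarrow> y \<in> dual_cone X"
  by (simp add: dual_cone_def)

lemma dual_coneD: "y \<in> dual_cone X \<Longrightarrow> x \<in> X \<Longrightarrow> 0 \<le> y \<bullet> x"
  by (simp add: dual_cone_def)

lemma dual_cone_add: "y \<in> dual_cone X \<Longrightarrow> z \<in> dual_cone X \<Longrightarrow> y + z \<in> dual_cone X"
  by (simp add: dual_cone_def inner_add_left)

lemma dual_cone_scale: "y \<in> dual_cone X \<Longrightarrow> 0 \<le> c \<Longrightarrow> c *\<^sub>R y \<in> dual_cone X"
  by (simp add: dual_cone_def)

lemma convex_dual_cone: "convex (dual_cone X)"
  by (intro convexI dual_cone_add dual_cone_scale)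

lemma dual_cone_closure: "dual_cone (closure X) = dual_cone X"
proof
  show "dual_cone X \<subseteq> dual_cone (closure X)"
  proof
    fix y assume y: "y \<in> dual_cone X"
    have "closure X \<subseteq> {x. 0 \<le> y \<bullet> x}"
      by (rule closure_minimal) (use y in \<open>auto simp: dual_cone_def closed_halfspace_ge\<close>)
    then show "y \<in> dual_cone (closure X)" by (auto simp: dual_cone_def)
  qed
  show "dual_cone (closure X) \<subseteq> dual_cone X"
    using closure_subset by (auto simp: dual_cone_def)
qed

lemma closed_dual_cone: "closed (dual_cone X)"
proof -
  have "dual_cone X = (\<Inter>x\<in>X. {y. x \<bullet> y \<ge> 0})"
    by (auto simp: dual_cone_def inner_commute)
  then show ?thesis by (simp add: closed_INT closed_halfspace_ge)
qed

lemma dual_cone_pos: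
  assumes "open X" "y \<in> dual_cone X" "y \<noteq> 0" "x \<in> X"
  shows "0 < y \<bullet> x"
proof -
  obtain e where e: "e > 0" "cball x e \<subseteq> X"
    using assms(1,4) open_contains_cball by blast
  \<comment> \<open>Move \<open>x\<close> a little against \<open>y\<close>: this stays in \<open>X\<close> and strictly decreases the value of \<open>y\<close>.\<close>
  have "x - (e / norm y) *\<^sub>R y \<in> cball x e"
    using e(1) assms(3) by (simp add: dist_norm)
  then have "0 \<le> y \<bullet> (x - (e / norm y) *\<^sub>R y)"
    using e(2) assms(2) dual_coneD by blast
  moreover have "(e / norm y) * (y \<bullet> y) > 0"
    using e(1) assms(3) by simp
  ultimately show ?thesis by (simp add: inner_diff_right)
qed

lemma interior_dual_cone_bound:
  assumes "y \<in> interior (dual_cone X)"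
  obtains e where "e > 0" "\<And>x. x \<in> closure X \<Longrightarrow> e * norm x \<le> y \<bullet> x"
proof -
  obtain e where e: "e > 0" "cball y e \<subseteq> dual_cone X"
    using assms by (meson mem_interior_cball)
  have "e * norm x \<le> y \<bullet> x" if x: "x \<in> closure X" for x
  proof (cases "x = 0")
    case False
    have "y - (e / norm x) *\<^sub>R x \<in> cball y e"
      using e(1) False by (simp add: dist_norm)
    then have "0 \<le> (y - (e / norm x) *\<^sub>R x) \<bullet> x"
      using e(2) x dual_coneD dual_cone_closure by blast
    moreover have "(e / norm x) * (x \<bullet> x) = e * norm x"
      using False by (simp add: dot_square_norm power2_eq_square)
    ultimately show ?thesis by (simp add: inner_diff_left)
  qed simp
  then show ?thesis using that e(1) by blast
qed

lemma interior_dual_cone_pos: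
  assumes "y \<in> interior (dual_cone X)" "x \<in> closure X" "x \<noteq> 0"
  shows "0 < y \<bullet> x"
proof -
  obtain e where e: "e > 0" "e * norm x \<le> y \<bullet> x"
    using interior_dual_cone_bound[OF assms(1)] assms(2) by blast
  have "0 < e * norm x" using e(1) assms(3) by simp
  then show ?thesis using e(2) by linarith
qed

text \<open>A form that is positive on the closed cone minus the origin has a positive minimum on the compact
  set of its unit vectors, hence stays nonnegative on \<open>X\<close> under small perturbations.\<close>

lemma interior_dual_cone_iff:
  fixes X :: "'a::euclidean_space set"
  assumes cone: "\<And>x c. x \<in> X \<Longrightarrow> c > 0 \<Longrightarrow> c *\<^sub>R x \<in> X"
  shows "y \<in> interior (dual_cone X) \<longleftrightarrow> (\<forall>x\<in>closure X. x \<noteq> 0 \<longrightarrow> 0 < y \<bullet> x)"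
proof
  assume pos: "\<forall>x\<in>closure X. x \<noteq> 0 \<longrightarrow> 0 < y \<bullet> x"
  let ?S = "closure X \<inter> sphere 0 1"
  have comp: "compact ?S" by (simp add: closed_Int_compact)
  obtain m where m: "m > 0" "\<And>x. x \<in> ?S \<Longrightarrow> m \<le> y \<bullet> x"
  proof (cases "?S = {}")
    case True
    then show ?thesis using that[of 1] by auto
  next
    case False
    obtain x0 where x0: "x0 \<in> ?S" "\<And>x. x \<in> ?S \<Longrightarrow> y \<bullet> x0 \<le> y \<bullet> x"
      using continuous_attains_inf[OF comp False, of "\<lambda>x. y \<bullet> x"] continuous_on_inner[OF continuous_on_const continuous_on_id]
      by blast
    have "x0 \<noteq> 0" using x0(1) by auto
    then show ?thesis using that[of "y \<bullet> x0"] x0 pos by blast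
  qed
  have "ball y m \<subseteq> dual_cone X"
  proof
    fix z assume z: "z \<in> ball y m"
    show "z \<in> dual_cone X"
    proof (rule dual_coneI)
      fix x assume x: "x \<in> X"
      show "0 \<le> z \<bullet> x"
      proof (cases "x = 0")
        case False
        define u where "u = inverse (norm x) *\<^sub>R x"
        have u: "u \<in> ?S" "x = norm x *\<^sub>R u"
          using cone[OF x, of "inverse (norm x)"] False closure_subset by (auto simp: u_def)
        have "(y - z) \<bullet> u \<le> norm (y - z) * norm u" by (rule norm_cauchy_schwarz)
        also have "\<dots> \<le> m" using z u(1) by (simp add: dist_norm)
        finally have "0 \<le> z \<bullet> u" using m(2)[OF u(1)] by (simp add: inner_diff_left)
        then show ?thesis by (subst u(2)) simp
      qed simp
    qed
  qed
  then show "y \<in> interior (dual_cone X)"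
    using m(1) mem_interior by blast
qed (use interior_dual_cone_pos in blast)

lemma interior_dual_cone_add:
  assumes "p \<in> interior (dual_cone X)" "y \<in> dual_cone X"
  shows "y + p \<in> interior (dual_cone X)"
proof -
  have "(+) y ` interior (dual_cone X) \<subseteq> dual_cone X"
    using assms(2) dual_cone_add interior_subset by blast
  then have "(+) y ` interior (dual_cone X) \<subseteq> interior (dual_cone X)"
    by (intro interior_maximal open_translation open_interior)
  then show ?thesis using assms(1) by blast
qed

lemma interior_dual_cone_scale:
  assumes "p \<in> interior (dual_cone X)" "c > 0"
  shows "c *\<^sub>R p \<in> interior (dual_cone X)"
proof -
  have "(*\<^sub>R) c ` interior (dual_cone X) \<subseteq> dual_cone X"
    using assms(2) dual_cone_scale[of _ X c] interior_subset[of "dual_cone X"] by fastforce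
  then have "(*\<^sub>R) c ` interior (dual_cone X) \<subseteq> interior (dual_cone X)"
    using assms(2) by (intro interior_maximal open_scaling open_interior) auto
  then show ?thesis using assms(1) by blast
qed

lemma proper_coneD:
  assumes "proper_cone X"
  shows "open X" "convex X" "X \<noteq> {}" "x \<in> X \<Longrightarrow> c > 0 \<Longrightarrow> c *\<^sub>R x \<in> X"
    "interior (dual_cone X) \<noteq> {}"
  using assms by (auto simp: proper_cone_def)

lemma proper_cone_add:
  assumes X: "proper_cone X" and "x \<in> X" "y \<in> X"
  shows "x + y \<in> X"
proof -
  have "(1/2) *\<^sub>R x + (1/2) *\<^sub>R y \<in> X"
    using proper_coneD(2)[OF X] assms(2,3) by (intro convexD) auto
  then have "2 *\<^sub>R ((1/2) *\<^sub>R x + (1/2) *\<^sub>R y) \<in> X"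
    using proper_coneD(4)[OF X] by simp
  then show ?thesis by (simp add: scaleR_add_right)
qed

lemma obtain_interior_dual:
  assumes X: "proper_cone X"
  obtains p where "p \<in> interior (dual_cone X)" "p \<noteq> 0" "p \<in> dual_cone X"
proof -
  obtain p where p: "p \<in> interior (dual_cone X)" using proper_coneD(5)[OF X] by blast
  obtain x where x: "x \<in> X" using proper_coneD(3)[OF X] by blast
  have "X \<noteq> {0}" using proper_coneD(1)[OF X] not_open_singleton[of "0::'a"] by auto
  then obtain w where w: "w \<in> X" "w \<noteq> 0" using x by blast
  then have "0 < p \<bullet> w"
    using interior_dual_cone_pos[OF p] closure_subset by blast
  then have "p \<noteq> 0" by auto
  then show ?thesis using that p interior_subset by blast
qed

lemma zero_notin_proper_cone:
  assumes X: "proper_cone X"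
  shows "0 \<notin> X"
proof -
  obtain p where "p \<noteq> 0" "p \<in> dual_cone X" using obtain_interior_dual[OF X] by metis
  then show ?thesis using dual_cone_pos[OF proper_coneD(1)[OF X], of p 0] by auto
qed

lemma uminus_notin_proper_cone:
  assumes X: "proper_cone X" and "x \<in> X"
  shows "- x \<notin> X"
  using proper_cone_add[OF X, of x "- x"] zero_notin_proper_cone[OF X] assms(2) by auto

text \<open>A common positive form fixes the signs: cones with such a form that are disjoint remain disjoint
  in projective space.\<close>

lemma uminus_notin_common_dual:
  assumes A: "proper_cone A" and dual: "interior (dual_cone A) \<inter> interior (dual_cone B) \<noteq> {}"
    and x: "x \<in> A"
  shows "- x \<notin> B"
proof
  assume mx: "- x \<in> B"
  obtain y where y: "y \<in> interior (dual_cone A)" "y \<in> interior (dual_cone B)" using dual by blast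
  have "x \<noteq> 0" using zero_notin_proper_cone[OF A] x by auto
  then have "0 < y \<bullet> x" "0 < y \<bullet> (- x)"
    using interior_dual_cone_pos[OF y(1) subsetD[OF closure_subset x]]
      interior_dual_cone_pos[OF y(2) subsetD[OF closure_subset mx]] by auto
  then show False by simp
qed

lemma separate_from_cone:
  fixes B C :: "'a::euclidean_space set"
  assumes B: "proper_cone B" and C: "convex C" "C \<noteq> {}" "B \<inter> C = {}"
    and cone: "\<And>x c. x \<in> C \<Longrightarrow> c > 0 \<Longrightarrow> c *\<^sub>R x \<in> C"
  obtains y where "y \<noteq> 0" "y \<in> dual_cone B" "\<And>x. x \<in> C \<Longrightarrow> y \<bullet> x \<le> 0"
proof -
  obtain y b where y: "y \<noteq> 0" "\<forall>x\<in>C. y \<bullet> x \<le> b" "\<forall>x\<in>B. b \<le> y \<bullet> x"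
    using separating_hyperplane_sets[OF C(1) proper_coneD(2)[OF B] C(2) proper_coneD(3)[OF B]] C(3)
    by blast
  \<comment> \<open>By scaling, a linear form that is bounded on one side on a cone has a sign there.\<close>
  have bpos: "0 \<le> y \<bullet> x" if x: "x \<in> B" for x
  proof (rule ccontr)
    assume neg: "\<not> 0 \<le> y \<bullet> x"
    define c where "c = (\<bar>b\<bar> + 1) / - (y \<bullet> x)"
    have "c > 0" unfolding c_def using neg by (intro divide_pos_pos) auto
    then have "b \<le> c * (y \<bullet> x)" using y(3) proper_coneD(4)[OF B x, of c] by fastforce
    moreover have "c * (y \<bullet> x) = - (\<bar>b\<bar> + 1)" using neg by (simp add: c_def field_simps)
    ultimately show False by linarith
  qed
  have cneg: "y \<bullet> x \<le> 0" if x: "x \<in> C" for x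
  proof (rule ccontr)
    assume pos: "\<not> y \<bullet> x \<le> 0"
    define c where "c = (\<bar>b\<bar> + 1) / (y \<bullet> x)"
    have "c > 0" using pos by (simp add: c_def)
    then have "c * (y \<bullet> x) \<le> b" using y(2) cone[OF x, of c] by fastforce
    moreover have "c * (y \<bullet> x) = \<bar>b\<bar> + 1" using pos by (simp add: c_def field_simps)
    ultimately show False by linarith
  qed
  show ?thesis using that[OF y(1) dual_coneI] bpos cneg by blast
qed

lemma separate_point_from_cone:
  assumes B: "proper_cone B" and x: "x \<notin> B"
  obtains y where "y \<noteq> 0" "y \<in> dual_cone B" "y \<bullet> x \<le> 0"
proof -
  let ?C = "{c *\<^sub>R x | c. c > 0}"
  have eq: "?C = (\<lambda>c. c *\<^sub>R x) ` {0<..}" by auto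
  have "convex ?C" unfolding eq
    by (rule convex_linear_image) (auto intro: bounded_linear.linear bounded_linear_scaleR_left)
  moreover have "B \<inter> ?C = {}"
  proof -
    have "c *\<^sub>R x \<notin> B" if "c > 0" for c
      using proper_coneD(4)[OF B, of "c *\<^sub>R x" "inverse c"] that x by auto
    then show ?thesis by auto
  qed
  moreover have x: "x \<in> ?C" by (auto intro: exI[of _ "1::real"])
  moreover have "d *\<^sub>R z \<in> ?C" if "z \<in> ?C" "d > 0" for z d
    using that by (force intro: mult_pos_pos)
  ultimately show ?thesis
    using separate_from_cone[OF B, of ?C] that x by blast
qed

text \<open>The convex hull of the union of two open convex cones is their Minkowski sum: since the cones are
  open, the sum already contains both of them.  All hulls below are therefore written as sums.\<close>

lemma subset_cone_sum:
  assumes A: "proper_cone A" and B: "proper_cone B"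
  shows "A \<subseteq> A + B"
proof
  fix a assume a: "a \<in> A"
  obtain b where b: "b \<in> B" using proper_coneD(3)[OF B] by blast
  have b0: "b \<noteq> 0" using b zero_notin_proper_cone[OF B] by blast
  obtain e where e: "e > 0" "cball a e \<subseteq> A"
    using a proper_coneD(1)[OF A] open_contains_cball by blast
  have "a - (e / norm b) *\<^sub>R b \<in> cball a e" using e(1) b0 by (simp add: dist_norm)
  then have "a - (e / norm b) *\<^sub>R b \<in> A" using e(2) by blast
  moreover have "(e / norm b) *\<^sub>R b \<in> B" using proper_coneD(4)[OF B b] e(1) b0 by simp
  ultimately show "a \<in> A + B" using set_plus_intro by fastforce
qed

lemma subset_cone_sum': "proper_cone A \<Longrightarrow> proper_cone B \<Longrightarrow> B \<subseteq> A + B"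
  using subset_cone_sum[of B A] by (simp add: add.commute)

lemma dual_cone_sum:
  assumes A: "proper_cone A" and B: "proper_cone B"
  shows "dual_cone (A + B) = dual_cone A \<inter> dual_cone B"
proof
  show "dual_cone (A + B) \<subseteq> dual_cone A \<inter> dual_cone B"
    using subset_cone_sum[OF A B] subset_cone_sum'[OF A B] by (auto simp: dual_cone_def)
  show "dual_cone A \<inter> dual_cone B \<subseteq> dual_cone (A + B)"
    by (auto simp: dual_cone_def set_plus_def inner_add_right)
qed

lemma interior_dual_cone_sum:
  "proper_cone A \<Longrightarrow> proper_cone B \<Longrightarrow>
    interior (dual_cone (A + B)) = interior (dual_cone A) \<inter> interior (dual_cone B)"
  by (simp add: dual_cone_sum)

lemma proper_cone_sum:
  assumes A: "proper_cone A" and B: "proper_cone B"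
    and ne: "interior (dual_cone A) \<inter> interior (dual_cone B) \<noteq> {}"
  shows "proper_cone (A + B)"
  unfolding proper_cone_def
proof (intro conjI ballI allI impI)
  show "open (A + B)"
  proof -
    have "A + B = (\<Union>x\<in>A. \<Union>y\<in>B. {x + y})" by (auto simp: set_plus_def)
    then show ?thesis using open_sums[OF disjI1[OF proper_coneD(1)[OF A]], of B] by simp
  qed
  show "convex (A + B)"
    using A B by (intro convex_set_plus proper_coneD)
  show "A + B \<noteq> {}"
    using subset_cone_sum[OF A B] proper_coneD(3)[OF A] by blast
  show "interior (dual_cone (A + B)) \<noteq> {}"
    using ne by (simp add: interior_dual_cone_sum A B)
  fix x and c :: real assume x: "x \<in> A + B" "c > 0"
  then obtain a b where "x = a + b" "a \<in> A" "b \<in> B" by (auto elim: set_plus_elim)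
  then show "c *\<^sub>R x \<in> A + B"
    using proper_coneD(4)[OF A, of a c] proper_coneD(4)[OF B, of b c] x(2)
    by (auto simp: scaleR_add_right)
qed

lemma proper_cone_sum_self:
  assumes A: "proper_cone A"
  shows "A + A = A"
  using subset_cone_sum[OF A A] proper_cone_add[OF A] by (auto elim!: set_plus_elim)

section \<open>Occultation position of cones\<close>

text \<open>Occultation position for lifts whose signs are chosen such that neighbouring cones meet.  The
  elements of the closure of the dual of \<open>B\<close> are the hyperplanes given by \<open>dual_cone B\<close>.\<close>

definition occulted :: "'a::euclidean_space set \<Rightarrow> 'a set \<Rightarrow> 'a set \<Rightarrow> bool" where
  "occulted A B C \<longleftrightarrow> proper_cone A \<and> proper_cone B \<and> proper_cone C \<and>
     \<not> A \<subseteq> B \<and> \<not> C \<subseteq> B \<and> A \<inter> B \<noteq> {} \<and> B \<inter> C \<noteq> {} \<and> A \<inter> C = {} \<and>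
     (\<forall>y\<in>dual_cone B. y \<noteq> 0 \<longrightarrow> y \<in> interior (dual_cone A) \<or> y \<in> interior (dual_cone C))"

lemma occultedD:
  assumes "occulted A B C"
  shows "proper_cone A" "proper_cone B" "proper_cone C" "\<not> A \<subseteq> B" "\<not> C \<subseteq> B"
    "A \<inter> B \<noteq> {}" "B \<inter> C \<noteq> {}" "A \<inter> C = {}"
    "\<And>y. y \<in> dual_cone B \<Longrightarrow> y \<noteq> 0 \<Longrightarrow> y \<notin> interior (dual_cone A) \<Longrightarrow> y \<in> interior (dual_cone C)"
  using assms by (auto simp: occulted_def)

lemma occulted_commute: "occulted A B C \<Longrightarrow> occulted C B A"
  unfolding occulted_def by blast

lemma not_subset_cone_dual:
  assumes A: "proper_cone A" and B: "proper_cone B" and "\<not> A \<subseteq> B"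
  obtains y x where "y \<noteq> 0" "y \<in> dual_cone B" "x \<in> A" "y \<bullet> x < 0"
proof -
  obtain a where a: "a \<in> A" "a \<notin> B" using assms(3) by blast
  obtain y where y: "y \<noteq> 0" "y \<in> dual_cone B" "y \<bullet> a \<le> 0"
    using separate_point_from_cone[OF B a(2)] .
  have "y \<notin> dual_cone A"
    using dual_cone_pos[OF proper_coneD(1)[OF A] _ y(1) a(1)] y(3) by force
  then obtain x where "x \<in> A" "y \<bullet> x < 0"
    by (meson dual_coneI not_le)
  then show ?thesis using that y by blast
qed

text \<open>The noninclusions say that neither dual set alone covers the closed dual of \<open>B\<close>.  As this set
  is connected and the two covering sets are open, they overlap on it.\<close>

lemma occulted_common_dual:
  assumes occ: "occulted A B C"
  shows "interior (dual_cone A) \<inter> interior (dual_cone B) \<inter> interior (dual_cone C) \<noteq> {}"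
proof -
  note AC = occultedD(9)[OF occ] and CA = occultedD(9)[OF occulted_commute[OF occ]]
  have pB: "proper_cone B" by (rule occultedD[OF occ])
  obtain y xa where y: "y \<noteq> 0" "y \<in> dual_cone B" "xa \<in> A" "y \<bullet> xa < 0"
    using not_subset_cone_dual[OF occultedD(1,2,4)[OF occ]] .
  obtain z xc where z: "z \<noteq> 0" "z \<in> dual_cone B" "xc \<in> C" "z \<bullet> xc < 0"
    using not_subset_cone_dual[OF occultedD(3,2,5)[OF occ]] .
  have yC: "y \<in> interior (dual_cone C)"
    using AC y interior_subset[of "dual_cone A"] dual_coneD by fastforce
  have zA: "z \<in> interior (dual_cone A)"
    using CA z interior_subset[of "dual_cone C"] dual_coneD by fastforce
  let ?I = "closed_segment y z"
  have I: "w \<in> dual_cone B \<and> w \<noteq> 0" if "w \<in> ?I" for w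
  proof
    show "w \<in> dual_cone B"
      using that closed_segment_subset[OF y(2) z(2) convex_dual_cone] by blast
    obtain b where b: "b \<in> B" using proper_coneD(3)[OF pB] by blast
    have "0 < y \<bullet> b" "0 < z \<bullet> b"
      using dual_cone_pos[OF proper_coneD(1)[OF pB]] y z b by auto
    then have "?I \<subseteq> {w. b \<bullet> w > 0}"
      by (intro closed_segment_subset convex_halfspace_gt) (auto simp: inner_commute)
    then show "w \<noteq> 0" using that by auto
  qed
  have "?I \<subseteq> interior (dual_cone A) \<union> interior (dual_cone C)" using I AC by blast
  then have "interior (dual_cone A) \<inter> interior (dual_cone C) \<inter> ?I \<noteq> {}"
    using connectedD[OF connected_segment(1)[of y z] open_interior open_interior,
        of "dual_cone A" "dual_cone C"] yC zA by blast
  then obtain w where w: "w \<in> interior (dual_cone A) \<inter> interior (dual_cone C)" "w \<in> dual_cone B"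
    using I by blast
  \<comment> \<open>The common form \<open>w\<close> may lie on the boundary of the dual of \<open>B\<close>; push it inside.\<close>
  obtain p where p: "p \<in> interior (dual_cone B)" using proper_coneD(5)[OF pB] by blast
  have "(\<lambda>e::real. w + e *\<^sub>R p) \<midarrow>0\<rightarrow> w + 0 *\<^sub>R p" by (intro tendsto_intros)
  then have "\<forall>\<^sub>F e in at_right 0. w + e *\<^sub>R p \<in> interior (dual_cone A) \<inter> interior (dual_cone C)"
    using w(1) by (intro topological_tendstoD[OF filterlim_at_split[THEN iffD1, THEN conjunct2]])
      (auto intro: open_Int)
  then have "\<forall>\<^sub>F e in at_right 0. e > 0 \<and> w + e *\<^sub>R p \<in> interior (dual_cone A) \<inter> interior (dual_cone C)"
    by (auto intro: eventually_conj eventually_at_right_less)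
  then obtain e where "e > 0" "w + e *\<^sub>R p \<in> interior (dual_cone A) \<inter> interior (dual_cone C)"
    using eventually_happens'[OF trivial_limit_at_right_real] by blast
  moreover then have "w + e *\<^sub>R p \<in> interior (dual_cone B)"
    by (intro interior_dual_cone_add interior_dual_cone_scale p w)
  ultimately show ?thesis by blast
qed

lemma occulted_proper_sum:
  assumes "occulted A B C"
  shows "proper_cone (A + B)"
  using occulted_common_dual[OF assms] occultedD[OF assms] by (intro proper_cone_sum) auto

text \<open>In dimension at least three, two closed half-spaces bounded by hyperplanes through the origin
  intersect in a convex cone that is not contained in a line, so that it stays connected when the
  origin is removed; and this cone contains a whole line.\<close>

lemma
  fixes a d :: "'a::euclidean_space"
  assumes "DIM('a) \<ge> 3"
  shows connected_two_halfspaces: "connected ({z. a \<bullet> z \<le> 0 \<and> d \<bullet> z \<le> 0} - {0})"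
    and common_orthogonal: "\<exists>u. u \<noteq> 0 \<and> a \<bullet> u = 0 \<and> d \<bullet> u = 0"
proof -
  have dim2: "dim {v, w} < DIM('a)" for v w :: 'a
  proof -
    have "dim {v, w} \<le> card {v, w}" by (rule dim_le_card) (auto intro: span_base)
    also have "\<dots> \<le> 2" using card_insert_le_m1[of 2 "{w}" v] by simp
    finally show ?thesis using assms by simp
  qed
  obtain u where u: "u \<noteq> 0" "a \<bullet> u = 0" "d \<bullet> u = 0"
  proof (rule orthogonal_to_subspace_exists[OF dim2[of a d]])
    fix x assume "x \<noteq> 0" "\<And>y. y \<in> span {a, d} \<Longrightarrow> orthogonal x y"
    then show ?thesis using that[of x] span_base[of _ "{a,d}"]
      by (auto simp: orthogonal_def inner_commute)
  qed
  then show "\<exists>u. u \<noteq> 0 \<and> a \<bullet> u = 0 \<and> d \<bullet> u = 0" by blast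
  obtain w where w: "w \<noteq> 0" "a \<bullet> w = 0" "u \<bullet> w = 0"
  proof (rule orthogonal_to_subspace_exists[OF dim2[of a u]])
    fix x assume "x \<noteq> 0" "\<And>y. y \<in> span {a, u} \<Longrightarrow> orthogonal x y"
    then show ?thesis using that[of x] span_base[of _ "{a,u}"]
      by (auto simp: orthogonal_def inner_commute)
  qed
  obtain w' where w': "w' \<noteq> 0" "a \<bullet> w' = 0" "u \<bullet> w' = 0" "d \<bullet> w' \<le> 0"
  proof (cases "d \<bullet> w \<le> 0")
    case True then show ?thesis using that w by blast
  next
    case False then show ?thesis using that[of "- w"] w by simp
  qed
  let ?N = "{z. a \<bullet> z \<le> 0 \<and> d \<bullet> z \<le> 0}"
  have "?N = {z. a \<bullet> z \<le> 0} \<inter> {z. d \<bullet> z \<le> 0}" by auto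
  then have conv: "convex ?N"
    by (simp add: convex_Int convex_halfspace_le)
  have "\<not> collinear {0, u, w'}"
  proof
    assume "collinear {0, u, w'}"
    then obtain c where "w' = c *\<^sub>R u" using u w' by (auto simp: collinear_lemma)
    then show False using w' u by auto
  qed
  moreover have "{0, u, w'} \<subseteq> ?N" using u w' by auto
  ultimately have "\<not> collinear ?N" using collinear_subset by blast
  then show "connected (?N - {0})"
    by (intro connected_convex_diff_countable conv) auto
qed

lemma not_interior_dualE:
  assumes "proper_cone X" "y \<notin> interior (dual_cone X)"
  obtains x where "x \<in> closure X" "x \<noteq> 0" "x \<bullet> y \<le> 0"
  using assms interior_dual_cone_iff[of X y] proper_coneD(4)[of X]
  by (metis inner_commute not_le)

text \<open>The step where the dimension matters.  Suppose that \<open>y\<close> is a counterexample, and let \<open>a\<close> and \<open>d\<close>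
  be vectors of the closures of \<open>A\<close> and \<open>D\<close> on which \<open>y\<close> is not positive.  By the two coverings,
  a nonzero form that is nonpositive at \<open>a\<close> and \<open>d\<close> and nonnegative on \<open>B\<close> and \<open>C\<close> lies in the
  interiors of both dual cones.  By connectedness, every form that is nonpositive at \<open>a\<close> and \<open>d\<close> is
  then nonnegative on \<open>B\<close>; but these forms contain a line, and a form and its opposite cannot both
  be nonnegative on an open cone unless they vanish.\<close>

lemma occulted_dual_glue:
  fixes A B C D :: "'a::euclidean_space set"
  assumes dim: "DIM('a) \<ge> 3" and ABC: "occulted A B C" and BCD: "occulted B C D"
    and y: "y \<in> dual_cone B" "y \<in> dual_cone C" "y \<noteq> 0"
  shows "y \<in> interior (dual_cone A) \<or> y \<in> interior (dual_cone D)"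
proof (rule ccontr)
  assume neg: "\<not> ?thesis"
  note A = occultedD(1)[OF ABC] and B = occultedD(2)[OF ABC] and D = occultedD(3)[OF BCD]
  obtain a where a: "a \<in> closure A" "a \<noteq> 0" "a \<bullet> y \<le> 0"
    using not_interior_dualE[OF A] neg by blast
  obtain d where d: "d \<in> closure D" "d \<noteq> 0" "d \<bullet> y \<le> 0"
    using not_interior_dualE[OF D] neg by blast
  let ?N = "{z. a \<bullet> z \<le> 0 \<and> d \<bullet> z \<le> 0} - {0}"
  have notA: "z \<notin> interior (dual_cone A)" if "z \<in> ?N" for z
    using that interior_dual_cone_pos[OF _ a(1,2), of z] by (auto simp: inner_commute)
  have notD: "z \<notin> interior (dual_cone D)" if "z \<in> ?N" for z
    using that interior_dual_cone_pos[OF _ d(1,2), of z] by (auto simp: inner_commute)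
  have eq: "?N \<inter> (dual_cone B \<inter> dual_cone C) =
      ?N \<inter> (interior (dual_cone B) \<inter> interior (dual_cone C))"
  proof -
    have "z \<in> interior (dual_cone B) \<inter> interior (dual_cone C)"
      if "z \<in> ?N" "z \<in> dual_cone B" "z \<in> dual_cone C" for z
      using that occultedD(9)[OF ABC] occultedD(9)[OF occulted_commute[OF BCD]] notA notD by blast
    then show ?thesis using interior_subset[of "dual_cone B"] interior_subset[of "dual_cone C"] by blast
  qed
  \<comment> \<open>By \<open>eq\<close> the forms in \<open>?N\<close> that are nonnegative on \<open>B\<close> and \<open>C\<close> are an open and closed part.\<close>
  have "?N \<subseteq> dual_cone B"
  proof (rule ccontr)
    assume "\<not> ?N \<subseteq> dual_cone B"
    then have "- (dual_cone B \<inter> dual_cone C) \<inter> ?N \<noteq> {}" by blast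
    moreover have "(interior (dual_cone B) \<inter> interior (dual_cone C)) \<inter> ?N \<noteq> {}"
      using eq y a(3) d(3) by blast
    moreover have "(interior (dual_cone B) \<inter> interior (dual_cone C)) \<inter> - (dual_cone B \<inter> dual_cone C) \<inter> ?N = {}"
      using interior_subset[of "dual_cone B"] interior_subset[of "dual_cone C"] by blast
    moreover have "?N \<subseteq> (interior (dual_cone B) \<inter> interior (dual_cone C)) \<union> - (dual_cone B \<inter> dual_cone C)"
      using eq by blast
    moreover have "open (interior (dual_cone B) \<inter> interior (dual_cone C))"
      "open (- (dual_cone B \<inter> dual_cone C))"
      by (auto intro!: open_Int open_Compl closed_Int closed_dual_cone)
    ultimately show False
      using connectedD[OF connected_two_halfspaces[OF dim, of a d]] by blast
  qed
  moreover obtain u where u: "u \<noteq> 0" "a \<bullet> u = 0" "d \<bullet> u = 0"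
    using common_orthogonal[OF dim] by blast
  ultimately have "u \<in> dual_cone B" "- u \<in> dual_cone B" by auto
  moreover obtain b where "b \<in> B" using proper_coneD(3)[OF B] by blast
  ultimately have "0 < u \<bullet> b" "0 < (- u) \<bullet> b"
    using dual_cone_pos[OF proper_coneD(1)[OF B]] u(1) by (metis neg_equal_0_iff_equal)+
  then show False by simp
qed

text \<open>A chain of cones in which consecutive triples are in occultation position can be shortened by
  replacing its first two terms with their hull.  Iterating this reduces statements about arbitrarily
  long chains to statements about triples.\<close>

lemma occulted_glue:
  fixes A B C D :: "'a::euclidean_space set"
  assumes dim: "DIM('a) \<ge> 3" and ABC: "occulted A B C" and BCD: "occulted B C D"
  shows "occulted (A + B) C D"
proof -
  note A = occultedD(1)[OF ABC] and B = occultedD(2)[OF ABC] and C = occultedD(3)[OF ABC]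
    and D = occultedD(3)[OF BCD]
  have sub: "B \<subseteq> A + B" using A B by (rule subset_cone_sum')
  have cover: "y \<in> interior (dual_cone (A + B)) \<or> y \<in> interior (dual_cone D)"
    if y: "y \<in> dual_cone C" "y \<noteq> 0" for y
  proof (rule disjCI)
    assume n: "y \<notin> interior (dual_cone D)"
    then have b: "y \<in> interior (dual_cone B)"
      using occultedD(9)[OF occulted_commute[OF BCD]] y by blast
    then have "y \<in> interior (dual_cone A)"
      using occulted_dual_glue[OF dim ABC BCD _ y] n interior_subset by blast
    then show "y \<in> interior (dual_cone (A + B))"
      using b A B by (simp add: interior_dual_cone_sum)
  qed
  have "(A + B) \<inter> D = {}"
  proof (rule ccontr)
    assume "(A + B) \<inter> D \<noteq> {}"
    then obtain x where x: "x \<in> A + B" "x \<in> D" by blast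
    then have x0: "x \<noteq> 0" using zero_notin_proper_cone[OF D] by blast
    \<comment> \<open>Otherwise a hyperplane through \<open>x\<close> misses \<open>C\<close>, against the covering just proved.\<close>
    have "x \<in> C"
    proof (rule ccontr)
      assume "x \<notin> C"
      then obtain y where y: "y \<noteq> 0" "y \<in> dual_cone C" "y \<bullet> x \<le> 0"
        using separate_point_from_cone[OF C] by blast
      then show False
        using cover[of y] interior_dual_cone_pos[of y "A + B" x] interior_dual_cone_pos[of y D x]
          x x0 closure_subset by (meson in_mono not_le)
    qed
    have "x \<notin> B" using x(2) occultedD(8)[OF BCD] by blast
    then obtain y where y: "y \<noteq> 0" "y \<in> dual_cone B" "y \<bullet> x \<le> 0"
      using separate_point_from_cone[OF B] by blast
    have "y \<notin> interior (dual_cone C)"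
      using interior_dual_cone_pos[of y C x] \<open>x \<in> C\<close> x0 closure_subset y(3) by (meson in_mono not_le)
    then have "y \<in> dual_cone A"
      using occultedD(9)[OF occulted_commute[OF ABC]] y interior_subset by blast
    obtain a b where ab: "x = a + b" "a \<in> A" "b \<in> B" using x(1) by (auto elim: set_plus_elim)
    have "0 < y \<bullet> a" "0 < y \<bullet> b"
      using dual_cone_pos[OF proper_coneD(1)[OF A] \<open>y \<in> dual_cone A\<close> y(1) ab(2)]
        dual_cone_pos[OF proper_coneD(1)[OF B] y(2,1) ab(3)] by auto
    then show False using y(3) ab(1) by (simp add: inner_add_right)
  qed
  then show ?thesis
    unfolding occulted_def
    using occulted_proper_sum[OF ABC] C D cover sub occultedD[OF BCD] by blast
qed

text \<open>If \<open>B\<close> hides \<open>A\<close> from \<open>C\<close>, then every segment from \<open>A\<close> to \<open>C\<close> meets \<open>B\<close>: otherwise a hyperplane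
  separates it from \<open>B\<close>, and the corresponding form is nonnegative on \<open>B\<close> without being positive on
  \<open>A\<close> or on \<open>C\<close>.  Hence the hull of the three cones is the union of the hulls of two neighbours.\<close>

lemma occulted_sum_split:
  assumes occ: "occulted A B C"
  shows "A + B + C \<subseteq> (A + B) \<union> (B + C)"
proof
  note A = occultedD(1)[OF occ] and B = occultedD(2)[OF occ] and C = occultedD(3)[OF occ]
  fix x assume "x \<in> A + B + C"
  then obtain a b c where x: "x = a + b + c" "a \<in> A" "b \<in> B" "c \<in> C"
    by (auto elim!: set_plus_elim)
  have a0: "a \<noteq> 0" and c0: "c \<noteq> 0"
    using zero_notin_proper_cone A C x by blast+
  let ?K = "{s *\<^sub>R a + t *\<^sub>R c | s t. 0 \<le> s \<and> 0 \<le> t \<and> 0 < s + t}"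
  have "?K \<inter> B \<noteq> {}"
  proof
    assume disj: "?K \<inter> B = {}"
    have conv: "convex ?K"
    proof (rule convexI)
      fix p q and u v :: real
      assume p: "p \<in> ?K" and q: "q \<in> ?K" and uv: "0 \<le> u" "0 \<le> v" "u + v = 1"
      from p obtain s t where st: "p = s *\<^sub>R a + t *\<^sub>R c" "0 \<le> s" "0 \<le> t" "0 < s + t" by blast
      from q obtain s' t' where st': "q = s' *\<^sub>R a + t' *\<^sub>R c" "0 \<le> s'" "0 \<le> t'" "0 < s' + t'" by blast
      have "0 < u * (s + t) + v * (s' + t')"
        using st(4) st'(4) uv by (cases "u = 0") (auto intro: add_pos_nonneg)
      then show "u *\<^sub>R p + v *\<^sub>R q \<in> ?K"
        using st st' uv by (intro CollectI exI[of _ "u * s + v * s'"] exI[of _ "u * t + v * t'"])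
          (auto simp: algebra_simps)
    qed
    have "1 *\<^sub>R a + 0 *\<^sub>R c \<in> ?K" "0 *\<^sub>R a + 1 *\<^sub>R c \<in> ?K" by fastforce+
    then have ac: "a \<in> ?K" "c \<in> ?K" by simp_all
    have sc: "d *\<^sub>R z \<in> ?K" if "z \<in> ?K" "d > 0" for z d
    proof -
      from that(1) obtain s t where st: "z = s *\<^sub>R a + t *\<^sub>R c" "0 \<le> s" "0 \<le> t" "0 < s + t" by blast
      have "0 < d * (s + t)" using st(4) that(2) by simp
      then show ?thesis
        using st that(2) by (intro CollectI exI[of _ "d * s"] exI[of _ "d * t"])
          (auto simp: algebra_simps)
    qed
    obtain y where y: "y \<noteq> 0" "y \<in> dual_cone B" "\<And>z. z \<in> ?K \<Longrightarrow> y \<bullet> z \<le> 0"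
    proof (rule separate_from_cone[OF B conv])
      show "?K \<noteq> {}" using ac by blast
      show "B \<inter> ?K = {}" using disj by blast
    qed (use sc in auto)
    have "y \<notin> interior (dual_cone A)" "y \<notin> interior (dual_cone C)"
      using interior_dual_cone_pos[of y A a] interior_dual_cone_pos[of y C c] x a0 c0 y(3) ac
        closure_subset by (meson in_mono not_le)+
    then show False using occultedD(9)[OF occ] y by blast
  qed
  then obtain s t where st: "s *\<^sub>R a + t *\<^sub>R c \<in> B" "0 \<le> s" "0 \<le> t" "0 < s + t" by blast
  note sB = proper_coneD(4)[OF B]
  \<comment> \<open>If \<open>s v + t w\<close> is in \<open>B\<close> and \<open>t\<close> is at most \<open>s\<close>, divide by \<open>s\<close>: this absorbs all of \<open>v\<close>.\<close>
  have *: "x \<in> B + Z"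
    if Z: "proper_cone Z" and w: "w \<in> Z" and x: "x = v + b + w"
      and st: "s *\<^sub>R v + t *\<^sub>R w \<in> B" "0 \<le> t" "t \<le> s" "0 < s" for v w s t Z
  proof -
    have "inverse s *\<^sub>R (s *\<^sub>R v + t *\<^sub>R w) \<in> B" using sB[OF st(1), of "inverse s"] st(4) by simp
    then have vB: "v + (t / s) *\<^sub>R w \<in> B" using st(4) by (simp add: scaleR_add_right field_simps)
    have eq: "x = (v + (t / s) *\<^sub>R w) + b + (1 - t / s) *\<^sub>R w" using x by (simp add: algebra_simps)
    have bb: "(v + (t / s) *\<^sub>R w) + b \<in> B" using proper_cone_add[OF B vB \<open>b \<in> B\<close>] .
    show ?thesis
    proof (cases "t = s")
      case True
      then have "x \<in> B" using eq bb st(4) by simp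
      then show ?thesis using subset_cone_sum[OF B Z] by blast
    next
      case False
      then have "(1 - t / s) *\<^sub>R w \<in> Z" using st by (intro proper_coneD(4)[OF Z w]) auto
      then show ?thesis unfolding eq using bb by (rule set_plus_intro[rotated])
    qed
  qed
  show "x \<in> (A + B) \<union> (B + C)"
  proof (cases "t \<le> s")
    case True
    then have "x \<in> B + C" using *[OF C x(4), of a s t] st x(1) by simp
    then show ?thesis by blast
  next
    case False
    then have "x \<in> B + A" using *[OF A x(2), of c t s] st x(1) by (simp add: add_ac)
    then show ?thesis by (simp add: add.commute)
  qed
qed

section \<open>Forms that are nonnegative on a family of branches\<close>

text \<open>The dual cone of an open set contains no line.\<close>

lemma dual_cone_exit:
  fixes B :: "'a::euclidean_space set"
  assumes B: "proper_cone B" and p: "p \<in> interior (dual_cone B)" and q: "q \<noteq> 0"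
  obtains t where "p + t *\<^sub>R q \<notin> dual_cone B"
proof (rule ccontr)
  assume "\<not> thesis"
  then have all: "p + t *\<^sub>R q \<in> dual_cone B" for t using that by blast
  obtain b where b: "b \<in> B" using proper_coneD(3)[OF B] by blast
  have zero: "q \<bullet> b = 0" if b: "b \<in> B" for b
  proof (rule ccontr)
    assume n: "q \<bullet> b \<noteq> 0"
    have "0 \<le> (p + (- (p \<bullet> b + 1) / (q \<bullet> b)) *\<^sub>R q) \<bullet> b"
      using all b by (rule dual_coneD)
    then show False using n by (simp add: inner_add_left)
  qed
  then have "q \<in> dual_cone B" by (simp add: dual_cone_def)
  then show False using dual_cone_pos[OF proper_coneD(1)[OF B] _ q b] zero[OF b] by simp
qed

lemma open_contains_translate:
  fixes x w :: "'a::real_normed_vector"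
  assumes "open U" "x \<in> U"
  obtains d where "d > 0" "x + d *\<^sub>R w \<in> U"
proof -
  obtain e where e: "e > 0" "cball x e \<subseteq> U" using assms open_contains_cball by blast
  have n: "norm w + 1 > 0" by (simp add: add_nonneg_pos)
  then have "e * norm w / (norm w + 1) \<le> e"
    using e(1) by (simp add: pos_divide_le_eq distrib_left)
  then have "x + (e / (norm w + 1)) *\<^sub>R w \<in> cball x e"
    using e(1) n by (simp add: dist_norm)
  moreover have "e / (norm w + 1) > 0" using e(1) n by simp
  ultimately show ?thesis using that e(2) by blast
qed

text \<open>A boundary point \<open>f\<close> of the dual cone on a hyperplane that cuts its interior is a limit of
  boundary points on either open side of the hyperplane: near \<open>f\<close>, the points on that side form a
  connected set, which contains points inside the dual cone (towards \<open>p\<close>) and outside it (away from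
  \<open>p\<close>).\<close>

lemma dual_frontier_limit:
  fixes B :: "'a::euclidean_space set"
  assumes B: "proper_cone B"
    and f: "f \<in> dual_cone B" "f \<notin> interior (dual_cone B)" "w \<bullet> f = 0"
    and p: "p \<in> interior (dual_cone B)" "w \<bullet> p = 0" and w: "w \<noteq> 0" and U: "open U" "f \<in> U"
  obtains g where "g \<in> U" "g \<in> dual_cone B" "g \<notin> interior (dual_cone B)" "w \<bullet> g > 0"
proof -
  obtain r where r: "r > 0" "ball f r \<subseteq> U" using U open_contains_ball by blast
  let ?S = "ball f r \<inter> {z. w \<bullet> z > 0}"
  define e where "e = r / (2 * (norm p + 1))"
  have n: "norm p + 1 > 0" by (simp add: add_nonneg_pos)
  then have e: "e > 0" using r(1) by (simp add: e_def)
  have "norm p < 2 * (norm p + 1)" using n by (simp add: distrib_left)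
  then have "e * norm p < e * (2 * (norm p + 1))" using e by (rule mult_strict_left_mono)
  moreover have "e * (2 * (norm p + 1)) = r" using n by (simp add: e_def)
  ultimately have "e * norm p < r" by (simp only:)
  then have e: "e > 0" "norm (e *\<^sub>R p) < r" using e by simp_all
  have "f + e *\<^sub>R p \<in> interior (dual_cone B) \<inter> ball f r"
    using interior_dual_cone_add[OF interior_dual_cone_scale[OF p(1) e(1)] f(1)] e(2) by (simp add: dist_norm)
  then obtain d where d: "d > 0" "f + e *\<^sub>R p + d *\<^sub>R w \<in> interior (dual_cone B) \<inter> ball f r"
    using open_contains_translate[of "interior (dual_cone B) \<inter> ball f r"] by blast
  have "f - e *\<^sub>R p \<notin> dual_cone B"
    using interior_dual_cone_add[OF interior_dual_cone_scale[OF p(1) e(1)], of "f - e *\<^sub>R p"] f(2) by auto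
  then have "f - e *\<^sub>R p \<in> ball f r - dual_cone B" using e by (simp add: dist_norm)
  then obtain d' where d': "d' > 0" "f - e *\<^sub>R p + d' *\<^sub>R w \<in> ball f r - dual_cone B"
    using open_contains_translate[of "ball f r - dual_cone B"] by (metis closed_dual_cone open_Diff open_ball)
  have pos: "w \<bullet> (f + e *\<^sub>R p + d *\<^sub>R w) > 0" "w \<bullet> (f - e *\<^sub>R p + d' *\<^sub>R w) > 0"
    using f(3) p(2) d(1) d'(1) w by (simp_all add: inner_add_right inner_diff_right)
  have "connected ?S"
    by (intro convex_connected convex_Int convex_ball convex_halfspace_gt)
  moreover have "?S \<inter> dual_cone B \<noteq> {}"
    using d(2) pos(1) interior_subset[of "dual_cone B"] by blast
  moreover have "?S - dual_cone B \<noteq> {}" using d'(2) pos(2) by blast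
  ultimately obtain g where "g \<in> ?S" "g \<in> frontier (dual_cone B)"
    using connected_Int_frontier by blast
  then show ?thesis
    using that[of g] r(2) by (auto simp: frontier_def closed_dual_cone)
qed

text \<open>Sharpness of a union of branches issuing from \<open>B\<close>.  Here \<open>N1\<close> and \<open>N2\<close> are two branches starting
  at the cones \<open>A1\<close> and \<open>A2\<close>, and \<open>N3\<close> is the union of the others.  A form in \<open>dual_cone B\<close> can be
  negative on one branch only, so the forms that are negative on different branches make up disjoint
  open parts of \<open>dual_cone B\<close>.  If the remaining forms were contained in a hyperplane, then on each
  side of this hyperplane a single part would fill all of \<open>dual_cone B\<close>, and the two sides would
  belong to \<open>N1\<close> and to \<open>N2\<close>.  But on the boundary of \<open>dual_cone B\<close> being negative on \<open>Nk\<close> excludes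
  being positive on the closure of \<open>Ak\<close>, so a boundary point on the hyperplane, being a limit from
  both sides, would contradict the covering by the duals of \<open>A1\<close> and \<open>A2\<close>.\<close>

lemma interior_dual_cone_of_branches:
  fixes B N1 N2 N3 A1 A2 :: "'a::euclidean_space set"
  assumes dim: "DIM('a) \<ge> 3" and B: "proper_cone B"
    and disj: "\<And>y x x'. y \<in> dual_cone B \<Longrightarrow> x \<in> N1 \<Longrightarrow> y \<bullet> x < 0 \<Longrightarrow> x' \<in> N2 \<union> N3 \<Longrightarrow> 0 \<le> y \<bullet> x'"
      "\<And>y x x'. y \<in> dual_cone B \<Longrightarrow> x \<in> N2 \<Longrightarrow> y \<bullet> x < 0 \<Longrightarrow> x' \<in> N1 \<union> N3 \<Longrightarrow> 0 \<le> y \<bullet> x'"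
    and ne: "\<not> dual_cone B \<subseteq> dual_cone N1" "\<not> dual_cone B \<subseteq> dual_cone N2"
    and bd1: "\<And>y. y \<in> dual_cone B \<Longrightarrow> y \<notin> interior (dual_cone B) \<Longrightarrow> y \<notin> dual_cone N1 \<Longrightarrow>
        y \<notin> interior (dual_cone A1)"
    and bd2: "\<And>y. y \<in> dual_cone B \<Longrightarrow> y \<notin> interior (dual_cone B) \<Longrightarrow> y \<notin> dual_cone N2 \<Longrightarrow>
        y \<notin> interior (dual_cone A2)"
    and cover: "\<And>y. y \<in> dual_cone B \<Longrightarrow> y \<noteq> 0 \<Longrightarrow>
        y \<in> interior (dual_cone A1) \<or> y \<in> interior (dual_cone A2)"
  shows "interior (dual_cone (B \<union> N1 \<union> N2 \<union> N3)) \<noteq> {}"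
proof
  let ?F = "dual_cone (B \<union> N1 \<union> N2 \<union> N3)"
  assume empty: "interior ?F = {}"
  obtain v b where v: "v \<noteq> 0" "?F \<subseteq> {y. v \<bullet> y = b}"
    using empty_interior_subset_hyperplane[OF convex_dual_cone empty] by blast
  have "0 \<in> ?F" by (simp add: dual_cone_def)
  then have b: "b = 0" using v(2) by auto
  have Feq: "?F = dual_cone B \<inter> dual_cone N1 \<inter> dual_cone N2 \<inter> dual_cone N3"
    by (auto simp: dual_cone_def)
  have thin: "v \<bullet> y = 0" if "y \<in> dual_cone B" "y \<in> dual_cone N1" "y \<in> dual_cone N2" "y \<in> dual_cone N3" for y
    using that v(2) b unfolding Feq by blast
  \<comment> \<open>The forms of \<open>dual_cone B\<close> on one open side of the hyperplane are a connected set.\<close>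
  have half: "{y \<in> dual_cone B. w \<bullet> y > 0} \<inter> dual_cone M = {}"
    if w: "w = v \<or> w = - v" and y: "y \<in> dual_cone B" "w \<bullet> y > 0" "y \<notin> dual_cone M"
      and M: "(M, M') = (N1, N2 \<union> N3) \<or> (M, M') = (N2, N1 \<union> N3)" for w y M M'
  proof (rule ccontr)
    let ?S = "{y \<in> dual_cone B. w \<bullet> y > 0}"
    assume "?S \<inter> dual_cone M \<noteq> {}"
    then obtain z where z: "z \<in> ?S" "z \<in> dual_cone M" by blast
    have dM: "u \<in> dual_cone M \<or> u \<in> dual_cone M'" if "u \<in> dual_cone B" for u
      using disj[OF that] M by (auto simp: dual_cone_def not_le) (meson not_le UnI1 UnI2)+
    have S: "u \<notin> dual_cone M \<or> u \<notin> dual_cone M'" if "u \<in> ?S" for u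
    proof (rule ccontr)
      assume "\<not> ?thesis"
      then have "u \<in> dual_cone N1" "u \<in> dual_cone N2" "u \<in> dual_cone N3"
        using M by (auto simp: dual_cone_def)
      then have "v \<bullet> u = 0" using thin that by blast
      then show False using that w by auto
    qed
    have "?S = dual_cone B \<inter> {y. w \<bullet> y > 0}" by auto
    then have "connected ?S"
      by (simp add: convex_connected convex_Int convex_dual_cone convex_halfspace_gt)
    moreover have "- dual_cone M \<inter> - dual_cone M' \<inter> ?S = {}" using dM by blast
    moreover have "?S \<subseteq> - dual_cone M \<union> - dual_cone M'" using S by blast
    moreover have "- dual_cone M \<inter> ?S \<noteq> {}" using y by blast
    moreover have "- dual_cone M' \<inter> ?S \<noteq> {}" using z S by blast
    ultimately show False
      using connectedD[of ?S "- dual_cone M" "- dual_cone M'"]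
      by (metis closed_dual_cone open_Compl)
  qed
  \<comment> \<open>An open part of \<open>dual_cone B\<close> meets its interior, and there it leaves the hyperplane.\<close>
  have pt: "\<exists>y w. (w = v \<or> w = - v) \<and> y \<in> interior (dual_cone B) \<and> y \<notin> dual_cone M \<and> w \<bullet> y > 0"
    if nsub: "\<not> dual_cone B \<subseteq> dual_cone M" for M
  proof -
    obtain y where y: "y \<in> dual_cone B" "y \<notin> dual_cone M" using nsub by blast
    obtain p where p: "p \<in> interior (dual_cone B)" using proper_coneD(5)[OF B] by blast
    obtain e where e: "e > 0" "y + e *\<^sub>R p \<in> - dual_cone M"
      using open_contains_translate[of "- dual_cone M" y p] y(2) closed_dual_cone by auto
    let ?U = "interior (dual_cone B) \<inter> - dual_cone M"
    have U: "open ?U" by (intro open_Int open_interior open_Compl closed_dual_cone)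
    have z: "y + e *\<^sub>R p \<in> ?U"
      using e interior_dual_cone_add[OF interior_dual_cone_scale[OF p e(1)] y(1)] by blast
    obtain d where d: "d > 0" "(y + e *\<^sub>R p) + d *\<^sub>R v \<in> ?U" using open_contains_translate[OF U z] .
    have "v \<bullet> (y + e *\<^sub>R p) \<noteq> 0 \<or> v \<bullet> ((y + e *\<^sub>R p) + d *\<^sub>R v) \<noteq> 0"
      using d(1) v(1) by (simp add: inner_add_right)
    then obtain u where u: "u \<in> ?U" "v \<bullet> u \<noteq> 0" using z d(2) by blast
    show ?thesis
    proof (cases "v \<bullet> u > 0")
      case True
      then show ?thesis using u by (intro exI[of _ u] exI[of _ v]) auto
    next
      case False
      then show ?thesis using u by (intro exI[of _ u] exI[of _ "- v"]) auto
    qed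
  qed
  obtain y1 w where y1: "w = v \<or> w = - v" "y1 \<in> interior (dual_cone B)" "y1 \<notin> dual_cone N1" "w \<bullet> y1 > 0"
    using pt[OF ne(1)] by blast
  obtain y2 w2 where y2: "w2 = v \<or> w2 = - v" "y2 \<in> interior (dual_cone B)" "y2 \<notin> dual_cone N2" "w2 \<bullet> y2 > 0"
    using pt[OF ne(2)] by blast
  have U1: "{y \<in> dual_cone B. w \<bullet> y > 0} \<inter> dual_cone N1 = {}"
    using half[OF y1(1) _ y1(4,3), of "N2 \<union> N3"] y1(2) interior_subset by blast
  have U2: "{y \<in> dual_cone B. w2 \<bullet> y > 0} \<inter> dual_cone N2 = {}"
    using half[OF y2(1) _ y2(4,3), of "N1 \<union> N3"] y2(2) interior_subset by blast
  have "w2 \<noteq> w"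
  proof
    assume "w2 = w"
    then have "y1 \<notin> dual_cone N2" "y1 \<in> dual_cone B"
      using U2 y1(2,4) interior_subset by blast+
    moreover obtain x where "x \<in> N1" "y1 \<bullet> x < 0"
      using y1(3) by (auto simp: dual_cone_def not_le)
    ultimately show False
      using disj(1)[of y1 x] by (auto simp: dual_cone_def)
  qed
  then have w2: "w2 = - w" using y1(1) y2(1) by auto
  have w0: "w \<noteq> 0" using y1(4) by auto
  \<comment> \<open>A point of the hyperplane in the interior of \<open>dual_cone B\<close>; moving from it inside the hyperplane leads to a boundary point \<open>f\<close>.\<close>
  define p where "p = (- (w \<bullet> y2)) *\<^sub>R y1 + (w \<bullet> y1) *\<^sub>R y2"
  have "w \<bullet> y2 < 0" using y2(4) w2 by simp
  then have p: "p \<in> interior (dual_cone B)"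
    unfolding p_def using y1(2,4) y2(2) interior_subset
    by (intro interior_dual_cone_add interior_dual_cone_scale dual_cone_scale) auto
  have wp: "w \<bullet> p = 0" by (simp add: p_def inner_add_right inner_diff_right)
  obtain q where q: "q \<noteq> 0" "w \<bullet> q = 0" "p \<bullet> q = 0" using common_orthogonal[OF dim] by blast
  obtain t where t: "p + t *\<^sub>R q \<notin> dual_cone B" using dual_cone_exit[OF B p q(1)] .
  let ?I = "closed_segment p (p + t *\<^sub>R q)"
  have "?I \<inter> frontier (dual_cone B) \<noteq> {}"
    using t p interior_subset[of "dual_cone B"] by (intro connected_Int_frontier connected_segment) auto
  then obtain f where f: "f \<in> ?I" "f \<in> dual_cone B" "f \<notin> interior (dual_cone B)"
    by (auto simp: frontier_def closed_dual_cone)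
  obtain s where "f = (1 - s) *\<^sub>R p + s *\<^sub>R (p + t *\<^sub>R q)" using f(1) by (auto simp: in_segment)
  then have fs: "f = p + (s * t) *\<^sub>R q" by (simp add: algebra_simps)
  then have wf: "w \<bullet> f = 0" using wp q(2) by (simp add: inner_add_right)
  obtain b where b: "b \<in> B" using proper_coneD(3)[OF B] by blast
  then have "b \<noteq> 0" using zero_notin_proper_cone[OF B] by blast
  then have "0 < p \<bullet> b" using interior_dual_cone_pos[OF p] b closure_subset by blast
  then have p0: "p \<noteq> 0" by auto
  have "p \<bullet> f = p \<bullet> p" using fs q(3) by (simp add: inner_add_right)
  then have f0: "f \<noteq> 0" using p0 by auto
  show False
  proof (cases "f \<in> interior (dual_cone A1)")
    case True
    obtain g where g: "g \<in> interior (dual_cone A1)" "g \<in> dual_cone B" "g \<notin> interior (dual_cone B)" "w \<bullet> g > 0"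
      using dual_frontier_limit[OF B f(2,3) wf p wp w0 open_interior True] .
    then show False using bd1[OF g(2,3)] U1 by blast
  next
    case False
    then have "f \<in> interior (dual_cone A2)" using cover[OF f(2) f0] by blast
    then obtain g where g: "g \<in> interior (dual_cone A2)" "g \<in> dual_cone B" "g \<notin> interior (dual_cone B)" "w2 \<bullet> g > 0"
      using dual_frontier_limit[OF B f(2,3), of w2 p] wf p wp w0 w2 open_interior
      by (metis inner_minus_left neg_equal_0_iff_equal)
    then show False using bd2[OF g(2,3)] U2 by blast
  qed
qed

section \<open>Linear images of cones\<close>

lemma linear_image_set_plus:
  assumes "linear f"
  shows "f ` (A + B) = f ` A + f ` B"
  by (force simp: set_plus_def image_iff linear_add[OF assms])

lemma closure_bij_image:
  fixes f :: "'a::euclidean_space \<Rightarrow> 'a"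
  shows "linear f \<Longrightarrow> bij f \<Longrightarrow> closure (f ` X) = f ` closure X"
  by (simp add: bij_is_inj closure_injective_linear_image)

lemma mem_dual_cone_image:
  fixes f :: "'a::euclidean_space \<Rightarrow> 'a"
  assumes "linear f"
  shows "y \<in> dual_cone (f ` X) \<longleftrightarrow> adjoint f y \<in> dual_cone X"
  using adjoint_clauses(2)[OF assms] by (auto simp: dual_cone_def)

lemma mem_interior_dual_cone_image:
  fixes f :: "'a::euclidean_space \<Rightarrow> 'a"
  assumes f: "linear f" "bij f" and X: "\<And>x c. x \<in> X \<Longrightarrow> c > 0 \<Longrightarrow> c *\<^sub>R x \<in> X"
  shows "y \<in> interior (dual_cone (f ` X)) \<longleftrightarrow> adjoint f y \<in> interior (dual_cone X)"
proof -
  have X': "c *\<^sub>R x \<in> f ` X" if "x \<in> f ` X" "c > 0" for x c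
    using that X linear_cmul[OF f(1)] by (metis (no_types, lifting) imageE imageI)
  have 0: "f x = 0 \<longleftrightarrow> x = 0" for x
    using linear_0[OF f(1)] bij_is_inj[OF f(2)] by (metis injD)
  have "y \<in> interior (dual_cone (f ` X)) \<longleftrightarrow> (\<forall>x\<in>closure (f ` X). x \<noteq> 0 \<longrightarrow> 0 < y \<bullet> x)"
    by (rule interior_dual_cone_iff) (rule X')
  also have "\<dots> \<longleftrightarrow> (\<forall>x\<in>closure X. x \<noteq> 0 \<longrightarrow> 0 < adjoint f y \<bullet> x)"
    unfolding closure_bij_image[OF f] using adjoint_clauses(2)[OF f(1)] 0 by auto
  also have "\<dots> \<longleftrightarrow> adjoint f y \<in> interior (dual_cone X)"
    by (rule interior_dual_cone_iff[symmetric]) (rule X)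
  finally show ?thesis .
qed

lemma adjoint_bij:
  fixes f :: "'a::euclidean_space \<Rightarrow> 'a"
  assumes f: "linear f" "bij f"
  shows "adjoint f y = 0 \<longleftrightarrow> y = 0" and "\<exists>y. adjoint f y = p"
proof -
  have linear_blinfun: "linear (inv_into UNIV f)" by (rule inj_linear_imp_inv_linear[OF f(1) bij_is_inj[OF f(2)]])
  show "\<exists>y. adjoint f y = p"
  proof (rule exI[of _ "adjoint (inv_into UNIV f) p"], rule vector_eq_rdot[THEN iffD1], rule allI)
    fix x show "adjoint f (adjoint (inv_into UNIV f) p) \<bullet> x = p \<bullet> x"
      using adjoint_clauses(2)[OF f(1)] adjoint_clauses(2)[OF linear_blinfun] bij_is_inj[OF f(2)] by simp
  qed
  show "adjoint f y = 0 \<longleftrightarrow> y = 0"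
  proof
    assume "adjoint f y = 0"
    then have "y \<bullet> f x = 0" for x using adjoint_clauses(2)[OF f(1), of y x] by simp
    then have "y \<bullet> y = 0" using bij_is_surj[OF f(2)] by (metis surjD)
    then show "y = 0" by simp
  qed (simp add: linear_0 adjoint_linear f)
qed

lemma proper_cone_image:
  fixes f :: "'a::euclidean_space \<Rightarrow> 'a"
  assumes f: "linear f" "bij f" and X: "proper_cone X"
  shows "proper_cone (f ` X)"
  unfolding proper_cone_def
proof (intro conjI ballI allI impI)
  show "open (f ` X)"
    using open_surjective_linear_image[OF proper_coneD(1)[OF X] f(1) bij_is_surj[OF f(2)]] .
  show "convex (f ` X)" by (rule convex_linear_image[OF f(1) proper_coneD(2)[OF X]])
  show "f ` X \<noteq> {}" using proper_coneD(3)[OF X] by blast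
  obtain p y where "p \<in> interior (dual_cone X)" "adjoint f y = p"
    using proper_coneD(5)[OF X] adjoint_bij(2)[OF f] by blast
  then show "interior (dual_cone (f ` X)) \<noteq> {}"
    using mem_interior_dual_cone_image[OF f proper_coneD(4)[OF X]] by blast
  fix x and c :: real assume "x \<in> f ` X" "0 < c"
  then show "c *\<^sub>R x \<in> f ` X"
    using proper_coneD(4)[OF X] linear_cmul[OF f(1)] by (metis (no_types, lifting) imageE imageI)
qed

lemma occulted_image:
  fixes f :: "'a::euclidean_space \<Rightarrow> 'a"
  assumes f: "linear f" "bij f" and occ: "occulted A B C"
  shows "occulted (f ` A) (f ` B) (f ` C)"
proof -
  note D = occultedD[OF occ]
  have inj: "inj f" using f(2) by (rule bij_is_inj)
  have "y \<in> interior (dual_cone (f ` A)) \<or> y \<in> interior (dual_cone (f ` C))"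
    if "y \<in> dual_cone (f ` B)" "y \<noteq> 0" for y
    using that D(9)[of "adjoint f y"] adjoint_bij(1)[OF f]
      mem_interior_dual_cone_image[OF f proper_coneD(4)[OF D(1)]]
      mem_interior_dual_cone_image[OF f proper_coneD(4)[OF D(3)]]
      mem_dual_cone_image[OF f(1)] by blast
  then show ?thesis
    unfolding occulted_def
    using proper_cone_image[OF f] D inj by (simp add: inj_image_subset_iff flip: image_Int)
qed

lemma linear_blinfun: "linear (blinfun_apply g)"
  by (rule bounded_linear.linear[OF blinfun.bounded_linear_right])

lemma image_blinfun_compose: "blinfun_apply (g o\<^sub>L h) ` X = blinfun_apply g ` blinfun_apply h ` X"
  by (simp add: blinfun_compose.rep_eq image_comp)

lemma image_id_blinfun [simp]: "blinfun_apply id_blinfun ` X = X"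
  by (simp add: id_blinfun.rep_eq)

lemma blinfun_compose_assoc: "(f o\<^sub>L g) o\<^sub>L h = f o\<^sub>L (g o\<^sub>L h)"
  by (rule blinfun_eqI) simp

section \<open>Vertex cones and branches of the tree\<close>

text \<open>The lifted situation.  The index \<open>i\<close> ranges over the two groups, and \<open>\<not> i\<close> is the other one;
  \<open>H i\<close> consists of the automorphisms over the \<open>i\<close>-th group that preserve the cone \<open>K i\<close> and not
  only its union with its opposite, so \<open>H i \<inter> H (\<not> i)\<close> lies over the amalgamated subgroup.  The
  translates of \<open>K False\<close> and \<open>K True\<close> are indexed by the vertices of the Bass-Serre tree, the
  translates of \<open>edge_cone\<close> below by its edges.\<close>

locale occultation_system =
  fixes K :: "bool \<Rightarrow> 'a::euclidean_space set" and H :: "bool \<Rightarrow> ('a \<Rightarrow>\<^sub>L 'a) set"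
  assumes dim: "DIM('a) \<ge> 3"
    and bij: "g \<in> H i \<Longrightarrow> bij (blinfun_apply g)"
    and stab: "g \<in> H i \<Longrightarrow> blinfun_apply g ` K i = K i"
    and id_mem: "id_blinfun \<in> H i"
    and comp_mem: "g \<in> H i \<Longrightarrow> h \<in> H i \<Longrightarrow> g o\<^sub>L h \<in> H i"
    and inverse: "g \<in> H i \<Longrightarrow> \<exists>h\<in>H i. g o\<^sub>L h = id_blinfun \<and> h o\<^sub>L g = id_blinfun"
    and occulted: "g \<in> H i - H (\<not> i) \<Longrightarrow> occulted (K (\<not> i)) (K i) (blinfun_apply g ` K (\<not> i))"
    and nontrivial: "\<exists>i. H i - H (\<not> i) \<noteq> {}"
begin

definition edge_cone :: "'a set" where
  "edge_cone = K False + K True"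

lemma edge_cone_eq: "edge_cone = K i + K (\<not> i)"
  by (cases i) (auto simp: edge_cone_def add.commute)

lemma cone: "proper_cone (K i)" and cone_edge: "proper_cone edge_cone"
proof -
  obtain j g where g: "g \<in> H j - H (\<not> j)" using nontrivial by blast
  then have "proper_cone (K j)" "proper_cone (K (\<not> j))"
    using occultedD(1,2)[OF occulted] by blast+
  then show "proper_cone (K i)" by (cases "i = j") auto
  show "proper_cone edge_cone"
    unfolding edge_cone_eq[of "\<not> j"] using occulted_proper_sum[OF occulted[OF g]] by simp
qed

text \<open>Two neighbours of the vertex cone \<open>K i\<close> are either hidden from each other by \<open>K i\<close>, or they are
  equal because \<open>s\<close> and \<open>t\<close> differ by an element of the amalgamated subgroup.\<close>

lemma occulted_or_equal:
  assumes s: "s \<in> H i" and t: "t \<in> H i"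
  shows "occulted (blinfun_apply s ` K (\<not> i)) (K i) (blinfun_apply t ` K (\<not> i)) \<or>
    blinfun_apply s ` K (\<not> i) = blinfun_apply t ` K (\<not> i)"
proof -
  obtain r where r: "r \<in> H i" "s o\<^sub>L r = id_blinfun" using inverse[OF s] by blast
  let ?u = "r o\<^sub>L t"
  have "(s o\<^sub>L r) o\<^sub>L t = t" unfolding r(2) by (rule blinfun_eqI) simp
  then have t_eq: "t = s o\<^sub>L ?u" by (simp add: blinfun_compose_assoc)
  have img: "blinfun_apply t ` K (\<not> i) = blinfun_apply s ` (blinfun_apply ?u ` K (\<not> i))"
    using image_blinfun_compose[of s ?u "K (\<not> i)"] unfolding t_eq[symmetric] .
  show ?thesis
  proof (cases "?u \<in> H (\<not> i)")
    case True
    then show ?thesis unfolding img stab[OF True] by blast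
  next
    case False
    then have "occulted (K (\<not> i)) (K i) (blinfun_apply ?u ` K (\<not> i))"
      using occulted comp_mem[OF r(1) t] by blast
    from occulted_image[OF linear_blinfun bij[OF s] this] show ?thesis
      unfolding stab[OF s] img by blast
  qed
qed

text \<open>\<open>branch i s Y\<close> means that \<open>Y\<close> is the hull of the vertex cones along a path without backtracking that
  starts at the neighbour \<open>s\<close> \<open>K (\<not> i)\<close> of \<open>K i\<close> and moves away from \<open>K i\<close>; the cone \<open>K i\<close> itself is
  left out.\<close>

inductive branch :: "bool \<Rightarrow> ('a \<Rightarrow>\<^sub>L 'a) \<Rightarrow> 'a set \<Rightarrow> bool" where
  leaf: "s \<in> H i \<Longrightarrow> branch i s (blinfun_apply s ` K (\<not> i))"
| extend: "s \<in> H i \<Longrightarrow> t \<in> H (\<not> i) - H i \<Longrightarrow> branch (\<not> i) t Y \<Longrightarrow>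
    branch i s (blinfun_apply s ` (K (\<not> i) + Y))"

lemma branch_mem: "branch i s Y \<Longrightarrow> s \<in> H i"
  by (cases rule: branch.cases) auto

text \<open>By induction along the branch: the rest of the path is hidden from \<open>K i\<close> by the first vertex, so
  \<open>occulted_glue\<close> adds it to the first vertex.\<close>

lemma branch_occulted_neighbour:
  assumes "branch i s Y" "t \<in> H i"
    and "occulted (blinfun_apply s ` K (\<not> i)) (K i) (blinfun_apply t ` K (\<not> i))"
  shows "occulted Y (K i) (blinfun_apply t ` K (\<not> i))"
  using assms
proof (induction arbitrary: t rule: branch.induct)
  case (leaf s i)
  then show ?case by simp
next
  case (extend s i r Y)
  have "occulted (blinfun_apply r ` K i) (K (\<not> i)) (K i)"
    using occulted_commute[OF occulted[of r "\<not> i"]] extend.hyps(2) by simp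
  then have "occulted Y (K (\<not> i)) (K i)"
    using extend.IH[of id_blinfun] id_mem by simp
  from occulted_image[OF linear_blinfun bij[OF extend.hyps(1)] this]
  have "occulted (blinfun_apply s ` Y) (blinfun_apply s ` K (\<not> i)) (K i)"
    using stab[OF extend.hyps(1)] by simp
  from occulted_glue[OF dim this extend.prems(2)] show ?case
    by (simp add: linear_image_set_plus[OF linear_blinfun] add.commute)
qed

lemma branch_occulted_opposite:
  assumes "branch i s Y" "s \<notin> H (\<not> i)"
  shows "occulted Y (K i) (K (\<not> i))"
  using branch_occulted_neighbour[OF assms(1) id_mem] occulted_commute[OF occulted[of s i]]
    branch_mem[OF assms(1)] assms(2) by simp

text \<open>Gluing on the other side as well: \<open>K i\<close> hides from each other any two branches that start at
  neighbours hidden from each other.\<close>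

lemma branch_occulted:
  assumes Y: "branch i s Y" and Z: "branch i t Z"
    and occ: "occulted (blinfun_apply s ` K (\<not> i)) (K i) (blinfun_apply t ` K (\<not> i))"
  shows "occulted Y (K i) Z"
  using Z
proof (cases rule: branch.cases)
  case leaf
  then show ?thesis using branch_occulted_neighbour[OF Y _ occ] by simp
next
  case (extend r Z')
  have "occulted Z' (K (\<not> i)) (K i)"
    using branch_occulted_opposite[OF extend(4)] extend(3) by simp
  from occulted_image[OF linear_blinfun bij[OF extend(2)] this]
  have "occulted (blinfun_apply t ` Z') (blinfun_apply t ` K (\<not> i)) (K i)"
    using stab[OF extend(2)] by simp
  from occulted_glue[OF dim this occulted_commute[OF branch_occulted_neighbour[OF Y extend(2) occ]]]
  show ?thesis unfolding extend(1)
    by (simp add: linear_image_set_plus[OF linear_blinfun] add.commute occulted_commute)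
qed

text \<open>The rest of the branch is hidden from \<open>K i\<close> by the first vertex, so a form that is nonnegative on
  the first vertex but not positive on the closure of \<open>K i\<close> is positive on the rest.\<close>

lemma branch_frontier:
  assumes Y: "branch i s Y" and y: "y \<noteq> 0" "y \<notin> interior (dual_cone (K i))"
    "y \<in> dual_cone (blinfun_apply s ` K (\<not> i))"
  shows "y \<in> dual_cone Y"
  using Y
proof (cases rule: branch.cases)
  case leaf
  then show ?thesis using y by simp
next
  case (extend r Z)
  have "occulted Z (K (\<not> i)) (K i)"
    using branch_occulted_opposite[OF extend(4)] extend(3) by simp
  from occulted_image[OF linear_blinfun bij[OF extend(2)] this]
  have occ: "occulted (blinfun_apply s ` Z) (blinfun_apply s ` K (\<not> i)) (K i)"
    using stab[OF extend(2)] by simp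
  have "y \<in> dual_cone (blinfun_apply s ` Z)"
    using occultedD(9)[OF occulted_commute[OF occ] y(3)] y occultedD(9)[OF occ y(3)] interior_subset by blast
  then show ?thesis
    unfolding extend(1) linear_image_set_plus[OF linear_blinfun]
    using dual_cone_sum[OF occultedD(2,1)[OF occ]] y(3) by simp
qed

section \<open>Reduced words\<close>

definition words :: "(bool \<times> ('a \<Rightarrow>\<^sub>L 'a)) list set" where
  "words = lists (Sigma UNIV H)"

definition word_prod :: "(bool \<times> ('a \<Rightarrow>\<^sub>L 'a)) list \<Rightarrow> 'a \<Rightarrow>\<^sub>L 'a" where
  "word_prod w = foldr (\<lambda>x h. snd x o\<^sub>L h) w id_blinfun"

lemma words_simps [simp]:
  "[] \<in> words" "(i, g) # w \<in> words \<longleftrightarrow> g \<in> H i \<and> w \<in> words"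
  "v @ w \<in> words \<longleftrightarrow> v \<in> words \<and> w \<in> words"
  by (auto simp: words_def)

lemma word_prod_simps [simp]:
  "word_prod [] = id_blinfun" "word_prod (x # w) = snd x o\<^sub>L word_prod w"
  by (auto simp: word_prod_def)

lemma word_prod_append: "word_prod (v @ w) = word_prod v o\<^sub>L word_prod w"
  by (induction v) (auto simp: blinfun_compose_assoc intro: blinfun_eqI)

inductive alternating :: "bool \<Rightarrow> (bool \<times> ('a \<Rightarrow>\<^sub>L 'a)) list \<Rightarrow> bool" where
  single: "g \<in> H i - H (\<not> i) \<Longrightarrow> alternating i [(i, g)]"
| cons: "g \<in> H i - H (\<not> i) \<Longrightarrow> alternating (\<not> i) w \<Longrightarrow> alternating i ((i, g) # w)"

lemma alternating_words: "alternating i w \<Longrightarrow> w \<in> words"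
  by (induction rule: alternating.induct) auto

text \<open>An element of the amalgamated subgroup can be absorbed into the next letter without leaving the
  set of admissible letters.\<close>

lemma comp_notin:
  assumes g: "g \<in> H i" "g \<in> H (\<not> i)" and h: "h \<in> H i - H (\<not> i)"
  shows "g o\<^sub>L h \<in> H i - H (\<not> i)"
proof -
  obtain r where r: "r \<in> H (\<not> i)" "r o\<^sub>L g = id_blinfun" using inverse[OF g(2)] by blast
  have "(r o\<^sub>L g) o\<^sub>L h = h" unfolding r(2) by (rule blinfun_eqI) simp
  then have "g o\<^sub>L h \<in> H (\<not> i) \<Longrightarrow> h \<in> H (\<not> i)"
    using comp_mem[OF r(1), of "g o\<^sub>L h"] by (simp add: blinfun_compose_assoc)
  then show ?thesis using comp_mem[OF g(1), of h] h by blast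
qed

text \<open>No coset representatives are chosen, so a group element may have several reduced words; this is
  harmless, since below only the number of letters matters.\<close>

definition reduced :: "(bool \<times> ('a \<Rightarrow>\<^sub>L 'a)) list \<Rightarrow> bool" where
  "reduced w \<longleftrightarrow> w = [] \<or> (\<exists>i g. w = [(i, g)] \<and> g \<in> H i \<inter> H (\<not> i)) \<or> (\<exists>i. alternating i w)"

lemma reduced_letter: "g \<in> H i \<Longrightarrow> reduced [(i, g)]"
  unfolding reduced_def using alternating.single[of g i] by blast

lemma reduced_words: "reduced w \<Longrightarrow> w \<in> words"
  unfolding reduced_def using alternating_words by auto

lemma alternatingE:
  assumes "alternating i w"
  obtains g v where "w = (i, g) # v" "g \<in> H i - H (\<not> i)" "v = [] \<or> alternating (\<not> i) v"
    "\<And>h. h \<in> H i - H (\<not> i) \<Longrightarrow> alternating i ((i, h) # v)"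
  using assms by (cases rule: alternating.cases) (auto intro: alternating.intros)

text \<open>The reduction is carried out for an arbitrary relation \<open>Q\<close> that is compatible with the defining
  relations of the amalgam, as it is needed both for equality of products in the linear group and for
  equality in the abstract amalgam.\<close>

context
  fixes Q :: "(bool \<times> ('a \<Rightarrow>\<^sub>L 'a)) list \<Rightarrow> (bool \<times> ('a \<Rightarrow>\<^sub>L 'a)) list \<Rightarrow> bool"
  assumes refl: "\<And>w. w \<in> words \<Longrightarrow> Q w w"
    and trans: "\<And>u v w. Q u v \<Longrightarrow> Q v w \<Longrightarrow> Q u w"
    and cons: "\<And>i g v w. g \<in> H i \<Longrightarrow> Q v w \<Longrightarrow> Q ((i, g) # v) ((i, g) # w)"
    and merge: "\<And>i g h w. g \<in> H i \<Longrightarrow> h \<in> H i \<Longrightarrow> w \<in> words \<Longrightarrow>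
      Q ((i, g) # (i, h) # w) ((i, g o\<^sub>L h) # w)"
    and glue: "\<And>i g w. g \<in> H i \<Longrightarrow> g \<in> H (\<not> i) \<Longrightarrow> w \<in> words \<Longrightarrow>
      Q ((i, g) # w) ((\<not> i, g) # w)"
begin

lemma reduce_cons:
  assumes g: "g \<in> H i" and w: "reduced w"
  shows "\<exists>v. Q ((i, g) # w) v \<and> reduced v"
proof -
  consider (nil) "w = []" | (amalg) j d where "w = [(j, d)]" "d \<in> H j \<inter> H (\<not> j)"
    | (alt) j where "alternating j w" using w unfolding reduced_def by blast
  then show ?thesis
  proof cases
    case nil
    then show ?thesis using refl[of "[(i, g)]"] reduced_letter[OF g] g by auto
  next
    case amalg
    then have d: "d \<in> H i" "d \<in> H (\<not> i)" by (cases "i = j"; auto)+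
    have "Q [(j, d)] [(i, d)]"
      using refl[of "[(i, d)]"] glue[of d j "[]"] d by (cases "i = j") auto
    then have "Q ((i, g) # w) [(i, g), (i, d)]" using cons[OF g] amalg(1) by simp
    then have "Q ((i, g) # w) [(i, g o\<^sub>L d)]" using merge[OF g d(1), of "[]"] trans by auto
    then show ?thesis using reduced_letter[OF comp_mem[OF g d(1)]] by blast
  next
    case alt
    obtain h v where w: "w = (j, h) # v" "h \<in> H j - H (\<not> j)" "v = [] \<or> alternating (\<not> j) v"
      "\<And>h. h \<in> H j - H (\<not> j) \<Longrightarrow> alternating j ((j, h) # v)"
      using alternatingE[OF alt] by blast
    have v: "v \<in> words" using w(3) alternating_words by auto
    show ?thesis
    proof (cases "i = j")
      case True
      have m: "Q ((i, g) # w) ((i, g o\<^sub>L h) # v)"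
        using merge[OF g, of h v] w(1,2) v True by simp
      show ?thesis
      proof (cases "g o\<^sub>L h \<in> H (\<not> i)")
        case False
        then have "alternating i ((i, g o\<^sub>L h) # v)"
          using w(4)[of "g o\<^sub>L h"] comp_mem[OF g] w(2) True by blast
        then show ?thesis using m unfolding reduced_def by blast
      next
        case gh: True
        have gh': "g o\<^sub>L h \<in> H i" using comp_mem[OF g] w(2) True by blast
        show ?thesis
        proof (cases "v = []")
          case True
          then show ?thesis using m reduced_letter[OF gh'] by blast
        next
          case False
          then have alt_v: "alternating (\<not> i) v" using w(3) \<open>i = j\<close> by blast
          obtain k u where u: "v = (\<not> i, k) # u" "k \<in> H (\<not> i) - H (\<not> \<not> i)"
            "\<And>h. h \<in> H (\<not> i) - H (\<not> \<not> i) \<Longrightarrow> alternating (\<not> i) ((\<not> i, h) # u)"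
            using alternatingE[OF alt_v] by blast
          have "u \<in> words" using v u(1) by simp
          then have "Q ((\<not> i, g o\<^sub>L h) # v) ((\<not> i, (g o\<^sub>L h) o\<^sub>L k) # u)"
            using merge[OF gh] u(1,2) by blast
          then have "Q ((i, g) # w) ((\<not> i, (g o\<^sub>L h) o\<^sub>L k) # u)"
            using m glue[OF gh' gh v] trans by blast
          moreover have "alternating (\<not> i) ((\<not> i, (g o\<^sub>L h) o\<^sub>L k) # u)"
            using u(3) comp_notin[OF gh _ u(2)] gh' by simp
          ultimately show ?thesis unfolding reduced_def by blast
        qed
      qed
    next
      case False
      then have j: "j = (\<not> i)" by auto
      show ?thesis
      proof (cases "g \<in> H (\<not> i)")
        case True
        have hj: "h \<in> H (\<not> i)" using w(2) j by simp
        have "w \<in> words" using hj v w(1) j by simp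
        then have "Q ((i, g) # w) ((\<not> i, g) # w)" by (rule glue[OF g True])
        then have "Q ((i, g) # w) ((\<not> i, g) # (\<not> i, h) # v)" unfolding w(1) j .
        then have "Q ((i, g) # w) ((\<not> i, g o\<^sub>L h) # v)"
          using merge[OF True hj v] by (rule trans)
        moreover have "alternating (\<not> i) ((\<not> i, g o\<^sub>L h) # v)"
          using w(4) comp_notin[OF True] g w(2) j by simp
        ultimately show ?thesis unfolding reduced_def by blast
      next
        case False
        then have "alternating i ((i, g) # w)" using alternating.cons[of g i w] g alt j by blast
        then show ?thesis using refl[of "(i, g) # w"] alternating_words unfolding reduced_def by blast
      qed
    qed
  qed
qed

lemma reduce_word: "w \<in> words \<Longrightarrow> \<exists>v. Q w v \<and> reduced v"
proof (induction w)
  case Nil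
  then show ?case using refl[of "[]"] by (auto simp: reduced_def)
next
  case (Cons x w)
  obtain i g where x: "x = (i, g)" by (cases x)
  then have g: "g \<in> H i" and w: "w \<in> words" using Cons.prems by auto
  obtain v where v: "Q w v" "reduced v" using Cons.IH[OF w] by blast
  then show ?case using reduce_cons[OF g v(2)] cons[OF g v(1)] trans x by blast
qed

end

end

section \<open>The union of the translates of the edge\<close>

context occultation_system
begin

definition products :: "('a \<Rightarrow>\<^sub>L 'a) set" where
  "products = word_prod ` words"

definition domain_cone :: "'a set" where
  "domain_cone = (\<Union>g\<in>products. blinfun_apply g ` edge_cone)"

text \<open>The path from the edge to its image under a reduced word: it leaves through \<open>K i\<close>, and once the
  word has two letters the image of the edge lies entirely in the branch.\<close>

lemma alternating_branch:
  assumes "alternating i w"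
  shows "\<exists>s v Y. w = (i, s) # v \<and> s \<in> H i - H (\<not> i) \<and> branch i s Y \<and>
    blinfun_apply (word_prod w) ` edge_cone \<subseteq> K i + Y \<and>
    (v \<noteq> [] \<longrightarrow> blinfun_apply (word_prod w) ` edge_cone \<subseteq> Y)"
  using assms
proof (induction rule: alternating.induct)
  case (single g i)
  have "blinfun_apply (word_prod [(i, g)]) ` edge_cone = K i + blinfun_apply g ` K (\<not> i)"
    using single stab[of g i]
    by (simp add: image_blinfun_compose edge_cone_eq[of i] linear_image_set_plus[OF linear_blinfun])
  then show ?case using single branch.leaf[of g i] by auto
next
  case (cons g i w)
  then obtain Y s where Y: "branch (\<not> i) s Y" "s \<in> H (\<not> i) - H i"
    "blinfun_apply (word_prod w) ` edge_cone \<subseteq> K (\<not> i) + Y" by auto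
  have br: "branch i g (blinfun_apply g ` (K (\<not> i) + Y))"
    using branch.extend[OF _ Y(2,1)] cons.hyps(1) by blast
  have sub: "blinfun_apply (word_prod ((i, g) # w)) ` edge_cone \<subseteq> blinfun_apply g ` (K (\<not> i) + Y)"
    using Y(3) by (auto simp: image_blinfun_compose)
  moreover have "blinfun_apply g ` (K (\<not> i) + Y) \<subseteq> K i + blinfun_apply g ` (K (\<not> i) + Y)"
    using occultedD(1)[OF branch_occulted_opposite[OF br]] cons.hyps(1) cone by (intro subset_cone_sum') auto
  ultimately show ?case using br cons.hyps(1) by blast
qed

lemma products_mem: "g \<in> H i \<Longrightarrow> g \<in> products"
  unfolding products_def by (rule image_eqI[of _ _ "[(i, g)]"]) (auto intro: blinfun_eqI)

lemma products_comp: "g \<in> products \<Longrightarrow> h \<in> products \<Longrightarrow> g o\<^sub>L h \<in> products"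
  unfolding products_def by (metis (no_types, lifting) imageE imageI word_prod_append words_simps(3))

lemma products_inverse: "g \<in> products \<Longrightarrow> \<exists>h\<in>products. g o\<^sub>L h = id_blinfun \<and> h o\<^sub>L g = id_blinfun"
proof -
  have "\<exists>h\<in>products. word_prod w o\<^sub>L h = id_blinfun \<and> h o\<^sub>L word_prod w = id_blinfun"
    if "w \<in> words" for w
    using that
  proof (induction w)
    case Nil
    then show ?case
      using products_mem[OF id_mem] by (intro bexI[of _ id_blinfun]) (auto intro: blinfun_eqI)
  next
    case (Cons x w)
    obtain i g where x: "x = (i, g)" by (cases x)
    then have g: "g \<in> H i" and w: "w \<in> words" using Cons.prems by auto
    obtain h where h: "h \<in> products" "word_prod w o\<^sub>L h = id_blinfun" "h o\<^sub>L word_prod w = id_blinfun"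
      using Cons.IH[OF w] by blast
    obtain r where r: "r \<in> H i" "g o\<^sub>L r = id_blinfun" "r o\<^sub>L g = id_blinfun"
      using inverse[OF g] by blast
    have ap: "blinfun_apply (word_prod w) (blinfun_apply h z) = z"
      "blinfun_apply h (blinfun_apply (word_prod w) z) = z"
      "blinfun_apply g (blinfun_apply r z) = z" "blinfun_apply r (blinfun_apply g z) = z" for z
      using h(2,3) r(2,3) by (metis blinfun_apply_blinfun_compose id_blinfun.rep_eq)+
    show ?case
      by (rule bexI[OF _ products_comp[OF h(1) products_mem[OF r(1)]]])
        (auto simp: x ap intro!: blinfun_eqI)
  qed
  then show "g \<in> products \<Longrightarrow> ?thesis" unfolding products_def by blast
qed

lemma products_bij:
  assumes "g \<in> products"
  shows "bij (blinfun_apply g)"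
proof -
  obtain h where h: "g o\<^sub>L h = id_blinfun" "h o\<^sub>L g = id_blinfun"
    using products_inverse[OF assms] by blast
  then show ?thesis
    by (intro o_bij[of "blinfun_apply h"]) (simp_all flip: blinfun_compose.rep_eq add: id_blinfun.rep_eq id_def)
qed

lemma products_cases:
  assumes "g \<in> products"
  obtains "g \<in> H False \<inter> H True" | i w where "alternating i w" "g = word_prod w"
proof -
  obtain w where w: "w \<in> words" "g = word_prod w" using assms unfolding products_def by blast
  have "\<exists>v. word_prod w = word_prod v \<and> reduced v"
    by (rule reduce_word[OF _ _ _ _ _ w(1)])
      (auto simp: blinfun_compose_assoc)
  then obtain v where v: "g = word_prod v" "reduced v" using w(2) by auto
  have [simp]: "f o\<^sub>L id_blinfun = f" for f :: "'a \<Rightarrow>\<^sub>L 'a" by (rule blinfun_eqI) simp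
  from v(2) consider "v = []" | i h where "v = [(i, h)]" "h \<in> H i \<inter> H (\<not> i)" | i where "alternating i v"
    unfolding reduced_def by blast
  then show ?thesis
  proof cases
    case 1
    then show ?thesis using that(1) v(1) id_mem by simp
  next
    case (2 i h)
    then have "h \<in> H False \<inter> H True" by (cases i) auto
    then show ?thesis using that(1) v(1) 2 by simp
  next
    case (3 i)
    then show ?thesis using that(2) v(1) by blast
  qed
qed

lemma edge_cone_stab: "g \<in> H False \<inter> H True \<Longrightarrow> blinfun_apply g ` edge_cone = edge_cone"
  using stab[of g False] stab[of g True] by (simp add: edge_cone_def linear_image_set_plus[OF linear_blinfun])

lemma domain_cone_image:
  assumes g: "g \<in> products"
  shows "blinfun_apply g ` domain_cone = domain_cone"
proof -
  have sub: "blinfun_apply h ` domain_cone \<subseteq> domain_cone" if "h \<in> products" for h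
  proof -
    have "blinfun_apply h ` domain_cone = (\<Union>k\<in>products. blinfun_apply (h o\<^sub>L k) ` edge_cone)"
      by (simp only: domain_cone_def image_UN image_blinfun_compose)
    also have "\<dots> \<subseteq> domain_cone" using products_comp[OF that] unfolding domain_cone_def by blast
    finally show ?thesis .
  qed
  obtain h where h: "h \<in> products" "g o\<^sub>L h = id_blinfun" using products_inverse[OF g] by blast
  have "domain_cone = blinfun_apply g ` (blinfun_apply h ` domain_cone)"
    by (simp only: h(2) image_id_blinfun flip: image_blinfun_compose)
  also have "\<dots> \<subseteq> blinfun_apply g ` domain_cone" using sub[OF h(1)] by blast
  finally show ?thesis using sub[OF g] by blast
qed

lemma edge_subset_domain: "edge_cone \<subseteq> domain_cone"
  using UN_upper[OF products_mem[OF id_mem], of "\<lambda>g. blinfun_apply g ` edge_cone"]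
  unfolding domain_cone_def image_id_blinfun .

text \<open>Splitting the hull of a path at each vertex with \<open>occulted_sum_split\<close> shows that it is the union of
  the edge cones along the path, so it adds nothing to the union of the translates.\<close>

lemma branch_subset_domain: "branch i s Y \<Longrightarrow> K i + Y \<subseteq> domain_cone"
proof (induction rule: branch.induct)
  case (leaf s i)
  have "K i + blinfun_apply s ` K (\<not> i) = blinfun_apply s ` edge_cone"
    using leaf stab[of s i] by (simp add: edge_cone_eq[of i] linear_image_set_plus[OF linear_blinfun])
  then show ?case using products_mem[OF leaf] unfolding domain_cone_def by blast
next
  case (extend s i t Y)
  have "occulted (K i) (K (\<not> i)) Y"
    using occulted_commute[OF branch_occulted_opposite[OF extend.hyps(3)]] extend.hyps(2) by simp
  then have "K i + K (\<not> i) + Y \<subseteq> edge_cone \<union> (K (\<not> i) + Y)"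
    unfolding edge_cone_eq[of i] by (rule occulted_sum_split)
  also have "\<dots> \<subseteq> domain_cone" using edge_subset_domain extend.IH by blast
  finally have "blinfun_apply s ` (K i + K (\<not> i) + Y) \<subseteq> domain_cone"
    using domain_cone_image[OF products_mem[OF extend.hyps(1)]] by blast
  then show ?case
    using stab[OF extend.hyps(1)] by (simp add: linear_image_set_plus[OF linear_blinfun] add.assoc)
qed

text \<open>All translates can be seen from one chosen vertex \<open>K i\<close>.  A path that leaves the edge through the
  other end is a branch starting at the neighbour \<open>K (\<not> i)\<close> itself, which corresponds to the identity
  of \<open>H i\<close>.\<close>

lemma translate_subset_branch:
  assumes "g \<in> products"
  shows "\<exists>s Y. branch i s Y \<and> blinfun_apply g ` edge_cone \<subseteq> K i + Y"
  using assms
proof (cases rule: products_cases)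
  case 1
  then show ?thesis
    using edge_cone_stab branch.leaf[OF id_mem, of i] edge_cone_eq[of i] by auto
next
  case (2 j w)
  then obtain s Y where Y: "s \<in> H j - H (\<not> j)" "branch j s Y" "blinfun_apply g ` edge_cone \<subseteq> K j + Y"
    using alternating_branch by blast
  show ?thesis
  proof (cases "j = i")
    case True
    then show ?thesis using Y by blast
  next
    case False
    then have j: "j = (\<not> i)" by auto
    have "branch i id_blinfun (blinfun_apply id_blinfun ` (K (\<not> i) + Y))"
      using branch.extend[OF id_mem[of i], of s Y] Y(1,2) j by simp
    then have b: "branch i id_blinfun (K (\<not> i) + Y)" by simp
    have "proper_cone (Y + K j)"
      using occulted_proper_sum[OF branch_occulted_opposite[OF Y(2)]] Y(1) by blast
    then have "proper_cone (K (\<not> i) + Y)" unfolding j by (simp only: add.commute)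
    then have "K (\<not> i) + Y \<subseteq> K i + (K (\<not> i) + Y)" by (rule subset_cone_sum'[OF cone])
    with Y(3) have "blinfun_apply g ` edge_cone \<subseteq> K i + (K (\<not> i) + Y)"
      unfolding j by (rule subset_trans)
    with b show ?thesis by (intro exI conjI)
  qed
qed

lemma edge_sum_subset_domain:
  assumes "g \<in> products"
  shows "edge_cone + blinfun_apply g ` edge_cone \<subseteq> domain_cone"
  using assms
proof (cases rule: products_cases)
  case 1
  then show ?thesis
    using edge_cone_stab proper_cone_sum_self[OF cone_edge] edge_subset_domain by simp
next
  case (2 i w)
  then obtain s Y where Y: "s \<in> H i - H (\<not> i)" "branch i s Y" "blinfun_apply g ` edge_cone \<subseteq> K i + Y"
    using alternating_branch by blast
  have "edge_cone + blinfun_apply g ` edge_cone \<subseteq> (K (\<not> i) + K i) + (K i + Y)"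
    using Y(3) edge_cone_eq[of i] by (intro set_plus_mono2) (auto simp: add.commute)
  also have "\<dots> = K (\<not> i) + K i + Y"
    using proper_cone_sum_self[OF cone[of i]] by (metis add.assoc)
  also have "\<dots> \<subseteq> (K (\<not> i) + K i) \<union> (K i + Y)"
    using occulted_sum_split occulted_commute[OF branch_occulted_opposite[OF Y(2)]] Y(1) by blast
  also have "\<dots> \<subseteq> domain_cone"
    using edge_subset_domain edge_cone_eq[of i] branch_subset_domain[OF Y(2)] by (simp add: add.commute)
  finally show ?thesis .
qed

text \<open>Convexity of the union: move the first point into the edge cone by a group element; the second
  one then lies in the hull of a path starting at this edge.\<close>

lemma domain_cone_add:
  assumes "x \<in> domain_cone" "y \<in> domain_cone"
  shows "x + y \<in> domain_cone"
proof -
  obtain g p where x: "g \<in> products" "p \<in> edge_cone" "x = blinfun_apply g p"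
    using assms(1) by (auto simp: domain_cone_def)
  obtain g' q where y: "g' \<in> products" "q \<in> edge_cone" "y = blinfun_apply g' q"
    using assms(2) by (auto simp: domain_cone_def)
  obtain h where h: "h \<in> products" "g o\<^sub>L h = id_blinfun" using products_inverse[OF x(1)] by blast
  have "p + blinfun_apply (h o\<^sub>L g') q \<in> domain_cone"
    using edge_sum_subset_domain[OF products_comp[OF h(1) y(1)]] x(2) y(2) by blast
  then have "blinfun_apply g (p + blinfun_apply (h o\<^sub>L g') q) \<in> domain_cone"
    using domain_cone_image[OF x(1)] by blast
  moreover have "blinfun_apply g (blinfun_apply h z) = z" for z
    using h(2) by (metis blinfun_apply_blinfun_compose id_blinfun.rep_eq)
  ultimately show ?thesis by (simp add: x(3) y(3) blinfun.add_right)
qed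

text \<open>Sharpness: apply \<open>interior_dual_cone_of_branches\<close> at a vertex \<open>K i\<close> with at least two neighbours,
  namely \<open>K (\<not> i)\<close> and its image under an element outside the amalgamated subgroup.  Branches are
  grouped by their first vertex.\<close>

lemma interior_dual_domain_cone: "interior (dual_cone domain_cone) \<noteq> {}"
proof -
  obtain i s0 where s0: "s0 \<in> H i - H (\<not> i)" using nontrivial by blast
  let ?A1 = "blinfun_apply s0 ` K (\<not> i)" and ?A2 = "K (\<not> i)"
  define N where "N Q = \<Union>{Y. \<exists>s. branch i s Y \<and> blinfun_apply s ` K (\<not> i) = Q}" for Q
  let ?N3 = "\<Union>Q\<in>- {?A1, ?A2}. N Q"
  note occ = occulted[OF s0]
  have ne12: "?A1 \<noteq> ?A2" using occultedD(3,8)[OF occ] proper_coneD(3) by force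
  have disj: "0 \<le> y \<bullet> x'"
    if y: "y \<in> dual_cone (K i)" and x: "x \<in> N Q" "y \<bullet> x < 0" and x': "x' \<in> N Q'" and neq: "Q \<noteq> Q'"
    for y x x' Q Q'
  proof -
    obtain s Y where Y: "branch i s Y" "blinfun_apply s ` K (\<not> i) = Q" "x \<in> Y"
      using x(1) by (auto simp: N_def)
    obtain t Z where Z: "branch i t Z" "blinfun_apply t ` K (\<not> i) = Q'" "x' \<in> Z"
      using x' by (auto simp: N_def)
    have "occulted Y (K i) Z"
      using occulted_or_equal[OF branch_mem[OF Y(1)] branch_mem[OF Z(1)]] branch_occulted[OF Y(1) Z(1)]
        Y(2) Z(2) neq by blast
    moreover have "y \<noteq> 0" using x(2) by auto
    moreover have "y \<notin> interior (dual_cone Y)"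
      using x(2) Y(3) interior_subset dual_coneD by fastforce
    ultimately have "y \<in> interior (dual_cone Z)" using occultedD(9) y by blast
    then show ?thesis using Z(3) interior_subset dual_coneD by blast
  qed
  have frontier: "y \<notin> interior (dual_cone Q)"
    if y: "y \<notin> interior (dual_cone (K i))" "y \<notin> dual_cone (N Q)" for y Q
  proof
    assume int: "y \<in> interior (dual_cone Q)"
    obtain x where x: "x \<in> N Q" "y \<bullet> x < 0" using y(2) by (auto simp: dual_cone_def not_le)
    then obtain s Y where Y: "branch i s Y" "blinfun_apply s ` K (\<not> i) = Q" "x \<in> Y"
      by (auto simp: N_def)
    have "y \<noteq> 0" using x(2) by auto
    then have "y \<in> dual_cone Y"
      using branch_frontier[OF Y(1) _ y(1)] int interior_subset Y(2) by blast
    then show False using dual_coneD[OF _ Y(3)] x(2) by force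
  qed
  have sub: "?A1 \<subseteq> N ?A1" "?A2 \<subseteq> N ?A2"
    using branch.leaf[of s0 i] branch.leaf[OF id_mem, of i] s0 unfolding N_def by fastforce+
  have nsub: "\<not> dual_cone (K i) \<subseteq> dual_cone (N Q)" if Q: "Q \<subseteq> N Q" "proper_cone Q" "\<not> Q \<subseteq> K i" for Q
  proof -
    obtain y x where "y \<in> dual_cone (K i)" "x \<in> Q" "y \<bullet> x < 0"
      using not_subset_cone_dual[OF Q(2) cone Q(3)] by blast
    moreover then have "y \<notin> dual_cone (N Q)" using Q(1) dual_coneD[of y "N Q" x] by force
    ultimately show ?thesis by blast
  qed
  have "interior (dual_cone (K i \<union> N ?A1 \<union> N ?A2 \<union> ?N3)) \<noteq> {}"
  proof (rule interior_dual_cone_of_branches[OF dim cone, where ?A1.0 = ?A1 and ?A2.0 = ?A2])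
    show "0 \<le> y \<bullet> x'" if "y \<in> dual_cone (K i)" "x \<in> N ?A1" "y \<bullet> x < 0" "x' \<in> N ?A2 \<union> ?N3" for y x x'
      using that(4) disj[OF that(1-3)] ne12 by blast
    show "0 \<le> y \<bullet> x'" if "y \<in> dual_cone (K i)" "x \<in> N ?A2" "y \<bullet> x < 0" "x' \<in> N ?A1 \<union> ?N3" for y x x'
      using that(4) disj[OF that(1-3)] ne12 by blast
    show "\<not> dual_cone (K i) \<subseteq> dual_cone (N ?A1)" by (rule nsub[OF sub(1) occultedD(3,5)[OF occ]])
    show "\<not> dual_cone (K i) \<subseteq> dual_cone (N ?A2)" by (rule nsub[OF sub(2) occultedD(1,4)[OF occ]])
    show "y \<in> interior (dual_cone ?A1) \<or> y \<in> interior (dual_cone ?A2)"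
      if "y \<in> dual_cone (K i)" "y \<noteq> 0" for y
      using occultedD(9)[OF occ that] by blast
  qed (use frontier in blast)+
  moreover have "dual_cone (K i \<union> N ?A1 \<union> N ?A2 \<union> ?N3) \<subseteq> dual_cone domain_cone"
  proof (intro subsetI dual_coneI)
    fix y x assume y: "y \<in> dual_cone (K i \<union> N ?A1 \<union> N ?A2 \<union> ?N3)" and "x \<in> domain_cone"
    then obtain g where "g \<in> products" "x \<in> blinfun_apply g ` edge_cone" by (auto simp: domain_cone_def)
    then obtain s Y where Y: "branch i s Y" "x \<in> K i + Y" using translate_subset_branch[of g i] by blast
    define Q where "Q = blinfun_apply s ` K (\<not> i)"
    have "Y \<subseteq> N Q" unfolding N_def Q_def by (rule Union_upper) (use Y(1) in blast)
    moreover have "N Q \<subseteq> N ?A1 \<union> N ?A2 \<union> ?N3"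
      by (cases "Q = ?A1 \<or> Q = ?A2") auto
    ultimately have "Y \<subseteq> N ?A1 \<union> N ?A2 \<union> ?N3" by (rule subset_trans)
    then have cover: "K i \<union> Y \<subseteq> K i \<union> N ?A1 \<union> N ?A2 \<union> ?N3" by blast
    obtain a b where ab: "x = a + b" "a \<in> K i \<union> Y" "b \<in> K i \<union> Y" using Y(2) by (auto elim: set_plus_elim)
    show "0 \<le> y \<bullet> x"
      using dual_coneD[OF y subsetD[OF cover ab(2)]] dual_coneD[OF y subsetD[OF cover ab(3)]]
      by (simp add: ab(1) inner_add_right)
  qed
  ultimately show ?thesis using interior_mono by blast
qed

lemma proper_cone_domain: "proper_cone domain_cone"
  unfolding proper_cone_def
proof (intro conjI ballI allI impI)
  show "open domain_cone"
    unfolding domain_cone_def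
    using proper_coneD(1)[OF proper_cone_image[OF linear_blinfun products_bij cone_edge]] by blast
  show scale: "c *\<^sub>R x \<in> domain_cone" if "x \<in> domain_cone" "c > 0" for x c
    using that proper_coneD(4)[OF cone_edge] unfolding domain_cone_def
    by (auto simp: image_iff) (metis blinfun.scaleR_right)
  show "convex domain_cone"
  proof (rule convexI)
    fix x y and u v :: real
    assume xy: "x \<in> domain_cone" "y \<in> domain_cone" and uv: "0 \<le> u" "0 \<le> v" "u + v = 1"
    show "u *\<^sub>R x + v *\<^sub>R y \<in> domain_cone"
    proof (cases "u = 0 \<or> v = 0")
      case True
      then show ?thesis using xy uv by auto
    next
      case False
      then show ?thesis using xy uv by (intro domain_cone_add scale) auto
    qed
  qed
  show "domain_cone \<noteq> {}" using edge_subset_domain proper_coneD(3)[OF cone_edge] by blast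
qed (rule interior_dual_domain_cone)

text \<open>A word with at least two letters moves the edge into a branch that is hidden by \<open>K i\<close> from the
  other end of the edge.  This carries both faithfulness and discreteness.\<close>

lemma alternating_moves:
  assumes w: "alternating i w" "2 \<le> length w" and x: "x \<in> edge_cone"
  shows "blinfun_apply (word_prod w) x \<notin> K (\<not> i)" "- blinfun_apply (word_prod w) x \<notin> K (\<not> i)"
proof -
  obtain s v Y where Y: "w = (i, s) # v" "s \<in> H i - H (\<not> i)" "branch i s Y"
    "v \<noteq> [] \<longrightarrow> blinfun_apply (word_prod w) ` edge_cone \<subseteq> Y"
    using alternating_branch[OF w(1)] by blast
  have "v \<noteq> []" using w(2) Y(1) by auto
  then have mem: "blinfun_apply (word_prod w) x \<in> Y" using Y(4) x by blast
  have occ: "occulted Y (K i) (K (\<not> i))" using branch_occulted_opposite[OF Y(3)] Y(2) by blast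
  show "blinfun_apply (word_prod w) x \<notin> K (\<not> i)" using occultedD(8)[OF occ] mem by blast
  have "interior (dual_cone Y) \<inter> interior (dual_cone (K (\<not> i))) \<noteq> {}"
    using occulted_common_dual[OF occ] by blast
  from uminus_notin_common_dual[OF occultedD(1)[OF occ] this mem]
  show "- blinfun_apply (word_prod w) x \<notin> K (\<not> i)" .
qed

end

section \<open>Cones and subsets of projective space\<close>

lemma pclass_scale:
  fixes x :: "'a::{real_normed_vector,perfect_space}"
  shows "x \<noteq> 0 \<Longrightarrow> c \<noteq> 0 \<Longrightarrow> pclass (c *\<^sub>R x) = pclass x"
  by (metis pclass_eq_iff scaleR_eq_0_iff)

lemma pclass_uminus:
  fixes x :: "'a::{real_normed_vector,perfect_space}"
  shows "x \<noteq> 0 \<Longrightarrow> pclass (- x) = pclass x"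
  using pclass_scale[of x "-1"] by simp

lemma pclass_eqE:
  assumes "x \<noteq> 0" "y \<noteq> 0" "pclass x = pclass y"
  obtains c where "c \<noteq> 0" "y = c *\<^sub>R x"
  using assms pclass_eq_iff[OF assms(1,2)] by blast

lemma pclass_cases:
  obtains x where "x \<noteq> 0" "p = pclass x"
  using prep_nonzero pclass_prep by metis

lemma open_proj_iff: "open U \<longleftrightarrow> open {x. x \<noteq> 0 \<and> pclass x \<in> U}"
  by (rule open_proj_space_def)

lemma mem_pclass_image_scaling:
  fixes W :: "'a::{real_normed_vector,perfect_space} set"
  assumes W: "0 \<notin> W" "\<And>k c. k \<in> W \<Longrightarrow> c \<noteq> 0 \<Longrightarrow> c *\<^sub>R k \<in> W" and g: "g \<noteq> 0"
  shows "pclass g \<in> pclass ` W \<longleftrightarrow> g \<in> W"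
proof
  assume "pclass g \<in> pclass ` W"
  then obtain k where k: "k \<in> W" "pclass k = pclass g" by (metis imageE)
  have "k \<noteq> 0" using k(1) W(1) by auto
  from pclass_eqE[OF this g k(2)] obtain c where "c \<noteq> 0" "g = c *\<^sub>R k" .
  then show "g \<in> W" using W(2)[OF k(1)] by simp
qed (rule imageI)

lemma open_pclass_image:
  fixes W :: "'a::{real_normed_vector,perfect_space} set"
  assumes "open W" and W: "0 \<notin> W" "\<And>k c. k \<in> W \<Longrightarrow> c \<noteq> 0 \<Longrightarrow> c *\<^sub>R k \<in> W"
  shows "open (pclass ` W)"
proof -
  have "{g. g \<noteq> 0 \<and> pclass g \<in> pclass ` W} = W"
    using mem_pclass_image_scaling[OF W] W(1) by (intro Set.set_eqI) auto
  then show ?thesis unfolding open_proj_iff using assms(1) by simp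
qed

lemma mem_pclass_image_cone:
  assumes K: "proper_cone K" and x: "x \<noteq> 0"
  shows "pclass x \<in> pclass ` K \<longleftrightarrow> x \<in> K \<or> - x \<in> K"
proof
  assume "pclass x \<in> pclass ` K"
  then obtain k where k: "k \<in> K" "pclass k = pclass x" by auto
  then have "k \<noteq> 0" using zero_notin_proper_cone[OF K] by blast
  then obtain c where c: "c \<noteq> 0" "x = c *\<^sub>R k" using k(2) pclass_eqE[of k x] x by blast
  then show "x \<in> K \<or> - x \<in> K"
    using proper_coneD(4)[OF K k(1), of c] proper_coneD(4)[OF K k(1), of "- c"] by (cases "c > 0") auto
next
  assume "x \<in> K \<or> - x \<in> K"
  then show "pclass x \<in> pclass ` K" using pclass_uminus[OF x] by (metis imageI)
qed

lemma mem_uminus_image: "x \<in> uminus ` X \<longleftrightarrow> - x \<in> (X :: 'a::group_add set)"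
proof
  assume "- x \<in> X"
  then have "- (- x) \<in> uminus ` X" by (rule imageI)
  then show "x \<in> uminus ` X" by simp
qed auto

lemma open_pclass_cone:
  assumes K: "proper_cone K"
  shows "open (pclass ` K)"
proof -
  have "{x. x \<noteq> 0 \<and> pclass x \<in> pclass ` K} = K \<union> uminus ` K"
  proof (rule Set.set_eqI)
    fix x
    have "0 \<notin> K \<union> uminus ` K"
      using zero_notin_proper_cone[OF K] by (simp add: mem_uminus_image)
    then show "x \<in> {x. x \<noteq> 0 \<and> pclass x \<in> pclass ` K} \<longleftrightarrow> x \<in> K \<union> uminus ` K"
      using mem_pclass_image_cone[OF K, of x] by (cases "x = 0") (auto simp: mem_uminus_image)
  qed
  then show ?thesis
    unfolding open_proj_iff using proper_coneD(1)[OF K] by (auto intro: open_negations)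
qed

lemma properly_convex_pclass_cone:
  assumes K: "proper_cone K"
  shows "properly_convex (pclass ` K)"
proof -
  obtain y where y: "y \<in> interior (dual_cone K)" "y \<noteq> 0" by (rule obtain_interior_dual[OF K])
  obtain e where e: "e > 0" "\<And>x. x \<in> closure K \<Longrightarrow> e * norm x \<le> y \<bullet> x"
    using interior_dual_cone_bound[OF y(1)] by blast
  let ?f = "blinfun_inner_right y"
  have f0: "?f \<noteq> 0" using y(2) by (metis blinfun.zero_left blinfun_inner_right.rep_eq inner_eq_zero_iff)
  obtain c where c: "c \<noteq> 0" "prep (pclass ?f) = c *\<^sub>R ?f" using prep_pclass[OF f0] .
  have pos: "0 < y \<bullet> x" "x \<noteq> 0" if "x \<in> K" for x
    using interior_dual_cone_pos[OF y(1)] zero_notin_proper_cone[OF K] closure_subset that by blast+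
  have "pclass ` K \<subseteq> affine_chart (pclass ?f)"
    using pclass_mem_hyperplane[OF f0] pos by (force simp: affine_chart_def)
  let ?S = "K \<inter> {x. y \<bullet> x = 1 / \<bar>c\<bar>}"
  have "chart_set (pclass ?f) (pclass ` K) = (\<lambda>x. sgn c *\<^sub>R x) ` ?S"
  proof (intro Set.set_eqI iffI)
    fix x assume "x \<in> chart_set (pclass ?f) (pclass ` K)"
    then have x: "c * (y \<bullet> x) = 1" "pclass x \<in> pclass ` K"
      by (auto simp: chart_set_def c(2) blinfun.scaleR_left)
    then have "x \<noteq> 0" by auto
    then have "x \<in> K \<or> - x \<in> K" using x(2) mem_pclass_image_cone[OF K] by blast
    moreover have "0 < c * (y \<bullet> x)" using x(1) by simp
    then have "0 < c \<and> 0 < y \<bullet> x \<or> c < 0 \<and> y \<bullet> x < 0" by (simp only: zero_less_mult_iff)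
    then have "x \<in> K \<Longrightarrow> c > 0" "- x \<in> K \<Longrightarrow> c < 0"
      using pos(1)[of x] pos(1)[of "- x"] by auto
    ultimately consider "x \<in> K" "c > 0" | "- x \<in> K" "c < 0" by blast
    then show "x \<in> (\<lambda>x. sgn c *\<^sub>R x) ` ?S"
    proof cases
      case 1
      then have "x \<in> ?S" "x = sgn c *\<^sub>R x" using x(1) by (auto simp: field_simps)
      then show ?thesis by (rule rev_image_eqI)
    next
      case 2
      then have "- x \<in> ?S" "x = sgn c *\<^sub>R (- x)" using x(1) by (auto simp: field_simps)
      then show ?thesis by (rule rev_image_eqI)
    qed
  next
    fix x assume "x \<in> (\<lambda>x. sgn c *\<^sub>R x) ` ?S"
    then obtain z where z: "z \<in> K" "y \<bullet> z = 1 / \<bar>c\<bar>" "x = sgn c *\<^sub>R z" by auto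
    have "c * (y \<bullet> x) = 1"
      using c(1) z(2,3) by (simp add: sgn_if)
    moreover have "pclass x = pclass z"
      using z(3) pclass_scale[OF pos(2)[OF z(1)], of "sgn c"] c(1) by (simp add: sgn_zero_iff)
    ultimately show "x \<in> chart_set (pclass ?f) (pclass ` K)"
      using z(1) by (auto simp: chart_set_def c(2) blinfun.scaleR_left)
  qed
  moreover have "convex ?S"
    using proper_coneD(2)[OF K] by (intro convex_Int convex_hyperplane)
  moreover have "bounded ?S"
  proof -
    have "norm x \<le> 1 / \<bar>c\<bar> / e" if x: "x \<in> ?S" for x
    proof -
      have "x \<in> closure K" using x closure_subset[of K] by blast
      then have "e * norm x \<le> 1 / \<bar>c\<bar>" using e(2)[of x] x by simp
      then show ?thesis using e(1) by (simp only: pos_le_divide_eq mult.commute)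
    qed
    then show ?thesis unfolding bounded_iff by blast
  qed
  ultimately have "convex (chart_set (pclass ?f) (pclass ` K))" "bounded (chart_set (pclass ?f) (pclass ` K))"
    by (auto intro: bounded_scaling convex_scaling)
  then show ?thesis
    unfolding properly_convex_def using open_pclass_cone[OF K] \<open>pclass ` K \<subseteq> _\<close> by blast
qed

lemma linear_functional_inner:
  fixes f :: "'a::euclidean_space \<Rightarrow>\<^sub>L real"
  obtains y where "\<And>x. blinfun_apply f x = y \<bullet> x"
proof
  fix x show "blinfun_apply f x = adjoint (blinfun_apply f) 1 \<bullet> x"
    using adjoint_clauses(2)[OF bounded_linear.linear[OF blinfun.bounded_linear_right], of f 1 x] by simp
qed

text \<open>A lift of \<open>X\<close> is obtained from a chart by keeping the representatives on which the form of the chart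
  is positive; boundedness in the chart becomes sharpness of the cone.\<close>

lemma properly_convex_lift:
  assumes X: "properly_convex X" "X \<noteq> {}"
  obtains K where "proper_cone K" "pclass ` K = X"
proof -
  obtain H where H: "open X" "X \<subseteq> affine_chart H" "convex (chart_set H X)" "bounded (chart_set H X)"
    using X(1) unfolding properly_convex_def by blast
  let ?f = "prep H"
  obtain y where y: "\<And>x. blinfun_apply ?f x = y \<bullet> x" using linear_functional_inner[of "prep H"] by blast
  have nz: "y \<bullet> x \<noteq> 0" if "x \<noteq> 0" "pclass x \<in> X" for x
    using that H(2) pclass_mem_hyperplane[of ?f x] y by (auto simp: affine_chart_def)
  let ?K = "{x. x \<noteq> 0 \<and> pclass x \<in> X} \<inter> {x. y \<bullet> x > 0}"
  have "open ?K" using H(1) by (auto simp: open_proj_iff intro: open_halfspace_gt)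
  have scale: "c *\<^sub>R x \<in> ?K" if "x \<in> ?K" "c > 0" for x c
    using that by (auto simp: pclass_scale)
  have chart: "(1 / (y \<bullet> x)) *\<^sub>R x \<in> chart_set H X" if "x \<in> ?K" for x
    using that by (auto simp: chart_set_def y pclass_scale)
  have add: "x + z \<in> ?K" if x: "x \<in> ?K" and z: "z \<in> ?K" for x z
  proof -
    let ?s = "y \<bullet> x + y \<bullet> z"
    have s: "?s > 0" using x z by auto
    have "(y \<bullet> x / ?s) *\<^sub>R ((1 / (y \<bullet> x)) *\<^sub>R x) + (y \<bullet> z / ?s) *\<^sub>R ((1 / (y \<bullet> z)) *\<^sub>R z) \<in> chart_set H X"
      using x z s by (intro convexD[OF H(3) chart[OF x] chart[OF z]]) (auto simp: add_divide_distrib[symmetric])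
    moreover have "(y \<bullet> x / ?s) *\<^sub>R ((1 / (y \<bullet> x)) *\<^sub>R x) + (y \<bullet> z / ?s) *\<^sub>R ((1 / (y \<bullet> z)) *\<^sub>R z)
        = (1 / ?s) *\<^sub>R (x + z)"
      using x z by (simp add: scaleR_add_right)
    ultimately have "pclass ((1 / ?s) *\<^sub>R (x + z)) \<in> X" by (simp add: chart_set_def)
    moreover have "x + z \<noteq> 0" using s by (metis inner_add_right inner_zero_right less_irrefl)
    ultimately show ?thesis using s by (simp add: pclass_scale inner_add_right)
  qed
  have "convex ?K"
  proof (rule convexI)
    fix x z and u v :: real
    assume xz: "x \<in> ?K" "z \<in> ?K" and uv: "0 \<le> u" "0 \<le> v" "u + v = 1"
    show "u *\<^sub>R x + v *\<^sub>R z \<in> ?K"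
    proof (cases "u = 0 \<or> v = 0")
      case True
      then show ?thesis using xz uv by auto
    next
      case False
      then show ?thesis using xz uv by (intro add scale) auto
    qed
  qed
  have image: "pclass ` ?K = X"
  proof
    show "X \<subseteq> pclass ` ?K"
    proof
      fix p assume p: "p \<in> X"
      obtain x where x: "x \<noteq> 0" "p = pclass x" by (rule pclass_cases)
      show "p \<in> pclass ` ?K"
      proof (cases "y \<bullet> x > 0")
        case True
        then show ?thesis using x p by blast
      next
        case False
        then have "- x \<in> ?K" using nz[OF x(1)] x p by (auto simp: pclass_uminus)
        moreover have "p = pclass (- x)" using x by (simp add: pclass_uminus)
        ultimately show ?thesis by blast
      qed
    qed
  qed auto
  then have "?K \<noteq> {}" using X(2) by blast
  obtain M where M: "M > 0" "\<And>x. x \<in> chart_set H X \<Longrightarrow> norm x \<le> M"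
    using H(4) by (auto simp: bounded_pos)
  have bd: "norm x \<le> M * (y \<bullet> x)" if "x \<in> ?K" for x
    using M(2)[OF chart[OF that]] that by (simp add: field_simps)
  have "ball y (1 / M) \<subseteq> dual_cone ?K"
  proof (intro subsetI dual_coneI)
    fix z x assume z: "z \<in> ball y (1 / M)" and x: "x \<in> ?K"
    have "(y - z) \<bullet> x \<le> norm (y - z) * norm x" by (rule norm_cauchy_schwarz)
    also have "\<dots> \<le> (1 / M) * (M * (y \<bullet> x))"
      using z bd[OF x] M(1) by (intro mult_mono) (auto simp: dist_norm)
    finally show "0 \<le> z \<bullet> x" using M(1) by (simp add: inner_diff_left)
  qed
  then have "y \<in> interior (dual_cone ?K)" 
    unfolding mem_interior using M(1) by (intro exI[of _ "1 / M"]) simp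
  then have "proper_cone ?K"
    unfolding proper_cone_def using \<open>open ?K\<close> \<open>convex ?K\<close> \<open>?K \<noteq> {}\<close> scale by blast
  then show ?thesis using that image by blast
qed

lemma pclass_image_subset_cases:
  assumes A: "proper_cone A" and B: "proper_cone B" and sub: "pclass ` A \<subseteq> pclass ` B"
  shows "A \<subseteq> B \<or> A \<subseteq> uminus ` B"
proof (rule ccontr)
  assume n: "\<not> ?thesis"
  have cover: "A \<subseteq> B \<union> uminus ` B"
  proof
    fix x assume x: "x \<in> A"
    then have "x \<noteq> 0" using zero_notin_proper_cone[OF A] by blast
    then have "x \<in> B \<or> - x \<in> B" using mem_pclass_image_cone[OF B] sub x by blast
    then show "x \<in> B \<union> uminus ` B" by (simp add: mem_uminus_image)
  qed
  have "B \<inter> uminus ` B \<inter> A = {}" using uminus_notin_proper_cone[OF B] by auto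
  then show False
    using connectedD[OF convex_connected[OF proper_coneD(2)[OF A]] proper_coneD(1)[OF B]
        open_negations[OF proper_coneD(1)[OF B]] _ cover] n cover by blast
qed

text \<open>A properly convex set has exactly two lifts, because a connected lift cannot be spread over
  the two opposite ones.\<close>

lemma pclass_image_eq_cases:
  assumes A: "proper_cone A" and B: "proper_cone B" and eq: "pclass ` A = pclass ` B"
  shows "A = B \<or> A = uminus ` B"
proof -
  have *: "A \<subseteq> B \<or> A \<subseteq> uminus ` B" "B \<subseteq> A \<or> B \<subseteq> uminus ` A"
    using pclass_image_subset_cases[OF A B] pclass_image_subset_cases[OF B A] eq by blast+
  have nA: "\<not> A \<subseteq> uminus ` A" and nB: "\<not> B \<subseteq> uminus ` B"
    using uminus_notin_proper_cone[OF A] uminus_notin_proper_cone[OF B]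
      proper_coneD(3)[OF A] proper_coneD(3)[OF B] by (auto simp: mem_uminus_image subset_iff)
  have mm: "uminus ` uminus ` Z = Z" for Z :: "'a set" by (simp add: image_image)
  show ?thesis
    using * nA nB image_mono[of A "uminus ` B" uminus] image_mono[of B "uminus ` A" uminus]
      image_mono[of A B uminus] image_mono[of B A uminus] unfolding mm by blast
qed

lemma closure_cone_scale:
  assumes K: "proper_cone K" and "x \<in> closure K" "c > 0"
  shows "c *\<^sub>R x \<in> closure K"
proof -
  have "(*\<^sub>R) c ` K \<subseteq> K" using proper_coneD(4)[OF K] assms(3) by blast
  then have "closure ((*\<^sub>R) c ` K) \<subseteq> closure K" by (rule closure_mono)
  then show ?thesis using assms(2) unfolding closure_scaleR[symmetric] by blast
qed

lemma pclass_mem_closure_iff: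
  assumes K: "proper_cone K" and x: "x \<noteq> 0"
  shows "pclass x \<in> closure (pclass ` K) \<longleftrightarrow> x \<in> closure K \<or> - x \<in> closure K"
proof
  have cl: "pclass z \<in> closure (pclass ` K)" if z: "z \<in> closure K" "z \<noteq> 0" for z
  proof (rule ccontr)
    assume n: "pclass z \<notin> closure (pclass ` K)"
    let ?U = "{x. x \<noteq> 0 \<and> pclass x \<in> - closure (pclass ` K)}"
    have U: "open ?U" using open_proj_iff[of "- closure (pclass ` K)"] by auto
    have "z \<in> ?U \<inter> closure K" using n z by simp
    then have "?U \<inter> closure K \<noteq> {}" by (rule ex_in_conv[THEN iffD1, OF exI])
    then have "?U \<inter> K \<noteq> {}" by (simp only: open_Int_closure_eq_empty[OF U] not_False_eq_True)
    then show False using closure_subset[of "pclass ` K"] by blast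
  qed
  show "x \<in> closure K \<or> - x \<in> closure K \<Longrightarrow> pclass x \<in> closure (pclass ` K)"
    using cl[of x] cl[of "- x"] x pclass_uminus[OF x] by auto
  assume mem: "pclass x \<in> closure (pclass ` K)"
  show "x \<in> closure K \<or> - x \<in> closure K"
  proof (rule ccontr)
    assume n: "\<not> ?thesis"
    let ?W = "{z. z \<noteq> 0 \<and> z \<notin> closure K \<and> - z \<notin> closure K}"
    have W: "c *\<^sub>R z \<in> ?W" if z: "z \<in> ?W" and c: "c \<noteq> 0" for z c
    proof -
      have *: "d *\<^sub>R v \<in> closure K \<Longrightarrow> d > 0 \<Longrightarrow> v \<in> closure K" for d v
        using closure_cone_scale[OF K, of "d *\<^sub>R v" "inverse d"] by simp
      show ?thesis
        using z c *[of c z] *[of c "- z"] *[of "- c" z] *[of "- c" "- z"] by (cases "c > 0") auto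
    qed
    have W0: "0 \<notin> ?W" by simp
    have "?W = - {0} \<inter> - closure K \<inter> - uminus ` closure K"
      unfolding Set.set_eq_iff Int_iff Compl_iff mem_uminus_image by simp
    moreover have "open \<dots>"
      by (auto intro!: open_Int open_Compl closed_negations)
    ultimately have "open ?W" by (simp only:)
    then have "closed (- pclass ` ?W)"
      unfolding closed_def double_complement using W0 W by (rule open_pclass_image)
    moreover have "pclass ` K \<subseteq> - pclass ` ?W"
    proof -
      have "pclass k \<notin> pclass ` ?W" if k: "k \<in> K" for k
      proof -
        have "k \<noteq> 0" using zero_notin_proper_cone[OF K] k by auto
        with W0 W have "pclass k \<in> pclass ` ?W \<longleftrightarrow> k \<in> ?W" by (rule mem_pclass_image_scaling)
        moreover have "k \<notin> ?W" using k closure_subset[of K] by auto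
        ultimately show ?thesis by (simp only: simp_thms)
      qed
      then show ?thesis by auto
    qed
    ultimately have "closure (pclass ` K) \<subseteq> - pclass ` ?W" by (rule closure_minimal[rotated])
    then show False using mem n x by blast
  qed
qed

lemma inner_sign_on_connected:
  fixes y :: "'a::euclidean_space"
  assumes S: "connected S" and nz: "\<And>x. x \<in> S \<Longrightarrow> y \<bullet> x \<noteq> 0"
  shows "(\<forall>x\<in>S. 0 < y \<bullet> x) \<or> (\<forall>x\<in>S. y \<bullet> x < 0)"
proof (rule ccontr)
  assume "\<not> ?thesis"
  then obtain a b where ab: "a \<in> S" "\<not> 0 < y \<bullet> a" "b \<in> S" "\<not> y \<bullet> b < 0" by blast
  have "a \<in> {x. y \<bullet> x < 0} \<inter> S" "b \<in> {x. y \<bullet> x > 0} \<inter> S"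
    using ab nz[of a] nz[of b] by auto
  moreover have "{x. y \<bullet> x > 0} \<inter> {x. y \<bullet> x < 0} \<inter> S = {}" by auto
  moreover have "S \<subseteq> {x. y \<bullet> x > 0} \<union> {x. y \<bullet> x < 0}" using nz by force
  ultimately show False
    using connectedD[OF S open_halfspace_gt[of 0 y] open_halfspace_lt[of y 0]] by blast
qed

lemma blinfun_inner_right_nonzero: "y \<noteq> 0 \<Longrightarrow> blinfun_inner_right y \<noteq> 0"
  by (metis blinfun.zero_left blinfun_inner_right.rep_eq inner_eq_zero_iff)

lemma mem_dual_set_iff:
  assumes K: "proper_cone K" and y: "y \<noteq> 0"
  shows "pclass (blinfun_inner_right y) \<in> dual_set (pclass ` K) \<longleftrightarrow>
    y \<in> interior (dual_cone K) \<or> - y \<in> interior (dual_cone K)"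
proof -
  note f0 = blinfun_inner_right_nonzero[OF y]
  let ?h = "hyperplane (pclass (blinfun_inner_right y))"
  have "pclass (blinfun_inner_right y) \<in> dual_set (pclass ` K) \<longleftrightarrow>
      (\<forall>p. p \<in> closure (pclass ` K) \<longrightarrow> p \<notin> ?h)"
    by (auto simp: dual_set_def)
  also have "\<dots> \<longleftrightarrow> (\<forall>x. x \<noteq> 0 \<longrightarrow> pclass x \<in> closure (pclass ` K) \<longrightarrow> pclass x \<notin> ?h)"
    by (metis pclass_cases)
  also have "\<dots> \<longleftrightarrow> (\<forall>x. x \<noteq> 0 \<longrightarrow> x \<in> closure K \<or> - x \<in> closure K \<longrightarrow> y \<bullet> x \<noteq> 0)"
    using pclass_mem_closure_iff[OF K] pclass_mem_hyperplane[OF f0] by simp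
  also have "\<dots> \<longleftrightarrow> (\<forall>x\<in>closure K. x \<noteq> 0 \<longrightarrow> y \<bullet> x \<noteq> 0)"
    by (metis inner_minus_right neg_equal_0_iff_equal)
  also have "\<dots> \<longleftrightarrow> y \<in> interior (dual_cone K) \<or> - y \<in> interior (dual_cone K)"
  proof
    assume int: "y \<in> interior (dual_cone K) \<or> - y \<in> interior (dual_cone K)"
    show "\<forall>x\<in>closure K. x \<noteq> 0 \<longrightarrow> y \<bullet> x \<noteq> 0"
    proof (intro ballI impI)
      fix x assume "x \<in> closure K" "x \<noteq> 0"
      then show "y \<bullet> x \<noteq> 0"
        using int interior_dual_cone_pos[of y K x] interior_dual_cone_pos[of "- y" K x] by auto
    qed
  next
    assume nz: "\<forall>x\<in>closure K. x \<noteq> 0 \<longrightarrow> y \<bullet> x \<noteq> 0"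
    have nzK: "y \<bullet> x \<noteq> 0" if x: "x \<in> K" for x
    proof -
      have "x \<noteq> 0" using x zero_notin_proper_cone[OF K] by auto
      then show ?thesis using nz subsetD[OF closure_subset x] by simp
    qed
    have sign: "z \<in> interior (dual_cone K)" if z: "z = y \<or> z = - y" "\<forall>x\<in>K. 0 \<le> z \<bullet> x" for z
    proof -
      have "z \<in> dual_cone (closure K)" using z(2) by (simp add: dual_cone_closure dual_coneI)
      then have "0 < z \<bullet> x" if x: "x \<in> closure K" "x \<noteq> 0" for x
        using bspec[OF nz x(1)] x z(1) dual_coneD[of z "closure K" x] by auto
      then show ?thesis
        using interior_dual_cone_iff[of K z, OF proper_coneD(4)[OF K]] by simp
    qed
    have "(\<forall>x\<in>K. 0 \<le> y \<bullet> x) \<or> (\<forall>x\<in>K. 0 \<le> - y \<bullet> x)"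
      using inner_sign_on_connected[OF convex_connected[OF proper_coneD(2)[OF K]] nzK]
      by (auto simp: less_imp_le)
    then show "y \<in> interior (dual_cone K) \<or> - y \<in> interior (dual_cone K)"
      using sign by blast
  qed
  finally show ?thesis .
qed

text \<open>A form that is nonnegative on \<open>K\<close> becomes positive on its closure when a small interior
  point of the dual cone is added.\<close>

lemma mem_closure_dual_set:
  assumes K: "proper_cone K" and y: "y \<noteq> 0" "y \<in> dual_cone K"
  shows "pclass (blinfun_inner_right y) \<in> closure (dual_set (pclass ` K))"
proof (rule ccontr)
  assume n: "\<not> ?thesis"
  let ?U = "{f. f \<noteq> 0 \<and> pclass f \<in> - closure (dual_set (pclass ` K))}"
  obtain p where p: "p \<in> interior (dual_cone K)" using proper_coneD(5)[OF K] by blast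
  have "open ?U" using open_proj_iff[of "- closure (dual_set (pclass ` K))"] by auto
  moreover have "blinfun_inner_right y \<in> ?U" using n y blinfun_inner_right_nonzero by blast
  ultimately obtain d where d: "d > 0" "blinfun_inner_right y + d *\<^sub>R blinfun_inner_right p \<in> ?U"
    by (rule open_contains_translate)
  have eq: "blinfun_inner_right y + d *\<^sub>R blinfun_inner_right p = blinfun_inner_right (y + d *\<^sub>R p)"
    by (rule blinfun_eqI) (simp add: blinfun.add_left blinfun.scaleR_left inner_add_left)
  have int: "y + d *\<^sub>R p \<in> interior (dual_cone K)"
    by (intro interior_dual_cone_add interior_dual_cone_scale p y d)
  have "y + d *\<^sub>R p \<noteq> 0"
    using d(2) unfolding eq by (metis (mono_tags, lifting) blinfun_eqI blinfun_inner_right.rep_eq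
      blinfun.zero_left inner_zero_left mem_Collect_eq)
  then have "pclass (blinfun_inner_right (y + d *\<^sub>R p)) \<in> dual_set (pclass ` K)"
    using mem_dual_set_iff[OF K] int by blast
  then show False using d(2) closure_subset[of "dual_set (pclass ` K)"] unfolding eq by blast
qed

lemma occulted_of_occultation_position:
  assumes A: "proper_cone A" and B: "proper_cone B" and C: "proper_cone C"
    and AB: "A \<inter> B \<noteq> {}" and BC: "B \<inter> C \<noteq> {}"
    and occ: "occultation_position (pclass ` A) (pclass ` B) (pclass ` C)"
  shows "occulted A B C"
proof -
  have sign: "y \<in> interior (dual_cone Z)"
    if y: "y \<in> dual_cone B" "y \<noteq> 0" and Z: "proper_cone Z" "Z \<inter> B \<noteq> {}"
      and mem: "pclass (blinfun_inner_right y) \<in> dual_set (pclass ` Z)" for y Z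
  proof -
    obtain z where z: "z \<in> Z" "z \<in> B" using Z(2) by blast
    have "0 < y \<bullet> z" using dual_cone_pos[OF proper_coneD(1)[OF B] y z(2)] .
    moreover have "z \<noteq> 0" using zero_notin_proper_cone[OF B] z(2) by blast
    ultimately have "- y \<notin> interior (dual_cone Z)"
      using interior_dual_cone_pos[of "- y" Z z] z(1) closure_subset[of Z] by auto
    then show ?thesis using mem mem_dual_set_iff[OF Z(1) y(2)] by blast
  qed
  have "y \<in> interior (dual_cone A) \<or> y \<in> interior (dual_cone C)"
    if y: "y \<in> dual_cone B" "y \<noteq> 0" for y
  proof -
    have "pclass (blinfun_inner_right y) \<in> dual_set (pclass ` A) \<union> dual_set (pclass ` C)"
      using occ mem_closure_dual_set[OF B y(2,1)] unfolding occultation_position_def by blast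
    then show ?thesis using sign[OF y A AB] sign[OF y C] BC by blast
  qed
  moreover have "\<not> A \<subseteq> B" "\<not> C \<subseteq> B" "A \<inter> C = {}"
    using occ unfolding occultation_position_def by blast+
  ultimately show ?thesis unfolding occulted_def using A B C AB BC by blast
qed

lemma connected_pclass_image:
  assumes "connected S" "0 \<notin> S"
  shows "connected (pclass ` S)"
proof (rule connectedI)
  fix U V assume UV: "open U" "open V" "U \<inter> pclass ` S \<noteq> {}" "V \<inter> pclass ` S \<noteq> {}"
    "U \<inter> V \<inter> pclass ` S = {}" "pclass ` S \<subseteq> U \<union> V"
  let ?U = "{x. x \<noteq> 0 \<and> pclass x \<in> U}" and ?V = "{x. x \<noteq> 0 \<and> pclass x \<in> V}"
  have "open ?U" "open ?V" using UV(1,2) by (simp_all add: open_proj_iff)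
  moreover have "?U \<inter> ?V \<inter> S = {}" using UV(5) by auto
  moreover have "S \<subseteq> ?U \<union> ?V" using UV(6) assms(2) by auto
  moreover have "{x. x \<noteq> 0 \<and> pclass x \<in> T} \<inter> S \<noteq> {}" if T: "T \<inter> pclass ` S \<noteq> {}" for T
  proof -
    obtain a where a: "a \<in> S" "pclass a \<in> T" using T by blast
    then have "a \<in> {x. x \<noteq> 0 \<and> pclass x \<in> T} \<inter> S" using assms(2) by auto
    then show ?thesis by blast
  qed
  note this[OF UV(3)] this[OF UV(4)]
  ultimately show False using connectedD[OF assms(1)] by blast
qed

text \<open>The form of a chart containing both sets has constant sign on the connected union \<open>A \<union> B\<close>.  If it
  is positive, then points of the sum \<open>A + B\<close> are, up to scaling, convex combinations of points of \<open>A\<close>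
  and \<open>B\<close> in the chart; the opposite sign only replaces these cones by their opposites.  So the hull
  does not depend on the chart.\<close>

lemma chart_hull_cones:
  assumes A: "proper_cone A" and B: "proper_cone B" and meet: "A \<inter> B \<noteq> {}"
    and H: "pclass ` A \<union> pclass ` B \<subseteq> affine_chart H"
  shows "chart_hull H (pclass ` A \<union> pclass ` B) = pclass ` (A + B)"
proof -
  let ?X = "pclass ` A \<union> pclass ` B"
  obtain y where y: "\<And>x. blinfun_apply (prep H) x = y \<bullet> x" using linear_functional_inner[of "prep H"] by blast
  have zero: "x \<noteq> 0" if "x \<in> A \<union> B" for x
    using that zero_notin_proper_cone A B by blast
  have nz: "y \<bullet> x \<noteq> 0" if "x \<in> A \<union> B" for x
    using H that zero[OF that] pclass_mem_hyperplane[of "prep H" x] y by (auto simp: affine_chart_def)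
  have conn: "connected (A \<union> B)"
    using convex_connected[OF proper_coneD(2)[OF A]] convex_connected[OF proper_coneD(2)[OF B]] meet
    by (rule connected_Un)
  have "\<exists>s::real. (s = 1 \<or> s = -1) \<and> (\<forall>x\<in>A \<union> B. 0 < s * (y \<bullet> x))"
    using inner_sign_on_connected[OF conn nz]
  proof
    assume "\<forall>x\<in>A \<union> B. 0 < y \<bullet> x"
    then show ?thesis by (intro exI[of _ 1]) simp
  next
    assume "\<forall>x\<in>A \<union> B. y \<bullet> x < 0"
    then show ?thesis by (intro exI[of _ "-1"]) simp
  qed
  then obtain s :: real where s: "s = 1 \<or> s = -1" "\<And>x. x \<in> A \<union> B \<Longrightarrow> 0 < s * (y \<bullet> x)" by blast
  have AB: "A \<union> B \<subseteq> A + B" using subset_cone_sum[OF A B] subset_cone_sum'[OF A B] by blast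
  have pos: "0 < s * (y \<bullet> x)" if "x \<in> A + B" for x
    using that s(2) by (auto elim!: set_plus_elim simp: inner_add_right distrib_left add_pos_pos)
  have scale: "c *\<^sub>R x \<in> A + B" if "x \<in> A + B" "c > 0" for x c
    using that proper_coneD(4)[OF A] proper_coneD(4)[OF B]
    by (auto elim!: set_plus_elim simp: scaleR_add_right intro!: set_plus_intro)
  have chart: "chart_set H ?X = (\<lambda>x. (1 / (y \<bullet> x)) *\<^sub>R x) ` (A \<union> B)"
  proof (intro Set.set_eqI iffI)
    fix x assume "x \<in> chart_set H ?X"
    then have x: "y \<bullet> x = 1" "pclass x \<in> pclass ` (A \<union> B)" by (auto simp: chart_set_def y)
    then obtain a where a: "a \<in> A \<union> B" "pclass a = pclass x" by (metis imageE)
    have "x \<noteq> 0" using x(1) by auto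
    then obtain c where c: "c \<noteq> 0" "x = c *\<^sub>R a" using pclass_eqE[OF zero[OF a(1)] _ a(2)] by blast
    then have "c = 1 / (y \<bullet> a)" using x(1) nz[OF a(1)] by (simp add: field_simps)
    then show "x \<in> (\<lambda>x. (1 / (y \<bullet> x)) *\<^sub>R x) ` (A \<union> B)" using c(2) a(1) by blast
  next
    fix x assume "x \<in> (\<lambda>x. (1 / (y \<bullet> x)) *\<^sub>R x) ` (A \<union> B)"
    then obtain a where a: "a \<in> A \<union> B" "x = (1 / (y \<bullet> a)) *\<^sub>R a" by blast
    then show "x \<in> chart_set H ?X"
      using nz[OF a(1)] zero[OF a(1)] by (auto simp: chart_set_def y pclass_scale)
  qed
  have zs: "z \<noteq> 0" if "z \<in> A + B" for z using pos[OF that] by auto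
  show ?thesis
  proof
    have conv: "convex ((*\<^sub>R) s ` (A + B))"
      using A B by (intro convex_scaling convex_set_plus proper_coneD)
    have "(1 / (y \<bullet> a)) *\<^sub>R a \<in> (*\<^sub>R) s ` (A + B)" if "a \<in> A \<union> B" for a :: 'a
    proof -
      have "(1 / (s * (y \<bullet> a))) *\<^sub>R a \<in> A + B"
        using s(2)[OF that] by (intro scale subsetD[OF AB that]) simp
      moreover have "(1 / (y \<bullet> a)) *\<^sub>R a = s *\<^sub>R ((1 / (s * (y \<bullet> a))) *\<^sub>R a)" using s(1) by auto
      ultimately show ?thesis by blast
    qed
    then have "chart_set H ?X \<subseteq> (*\<^sub>R) s ` (A + B)" unfolding chart by blast
    then have "convex hull chart_set H ?X \<subseteq> (*\<^sub>R) s ` (A + B)" using conv by (rule hull_minimal)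
    then have "chart_hull H ?X \<subseteq> pclass ` (*\<^sub>R) s ` (A + B)" unfolding chart_hull_def by blast
    also have "\<dots> = pclass ` (A + B)"
      unfolding image_image using s(1) zs by (intro image_cong refl pclass_scale) auto
    finally show "chart_hull H ?X \<subseteq> pclass ` (A + B)" .
    show "pclass ` (A + B) \<subseteq> chart_hull H ?X"
    proof
      fix p assume "p \<in> pclass ` (A + B)"
      then obtain a b where ab: "a \<in> A" "b \<in> B" "p = pclass (a + b)" by (auto elim!: set_plus_elim)
      have sp: "0 < s * (y \<bullet> a)" "0 < s * (y \<bullet> b)" using s(2) ab by auto
      let ?t = "y \<bullet> a + y \<bullet> b"
      have st: "0 < s * ?t" using sp by (simp add: distrib_left)
      then have t0: "?t \<noteq> 0" by auto
      have nab: "y \<bullet> a \<noteq> 0" "y \<bullet> b \<noteq> 0" using nz ab by auto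
      have w: "0 \<le> (y \<bullet> a) / ?t" "0 \<le> (y \<bullet> b) / ?t"
        using s(1) sp st by (auto simp: zero_le_divide_iff)
      have in_chart: "(1 / (y \<bullet> a)) *\<^sub>R a \<in> convex hull chart_set H ?X" "(1 / (y \<bullet> b)) *\<^sub>R b \<in> convex hull chart_set H ?X"
        unfolding chart using ab by (auto intro!: hull_inc)
      have "((y \<bullet> a) / ?t) *\<^sub>R ((1 / (y \<bullet> a)) *\<^sub>R a) + ((y \<bullet> b) / ?t) *\<^sub>R ((1 / (y \<bullet> b)) *\<^sub>R b)
          \<in> convex hull chart_set H ?X"
        using w t0 by (intro convexD[OF convex_convex_hull in_chart]) (auto simp: add_divide_distrib[symmetric])
      also have "((y \<bullet> a) / ?t) *\<^sub>R ((1 / (y \<bullet> a)) *\<^sub>R a) + ((y \<bullet> b) / ?t) *\<^sub>R ((1 / (y \<bullet> b)) *\<^sub>R b)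
          = (1 / ?t) *\<^sub>R (a + b)"
        using nab by (simp add: scaleR_add_right)
      finally have "pclass ((1 / ?t) *\<^sub>R (a + b)) \<in> chart_hull H ?X" unfolding chart_hull_def by blast
      moreover have "a + b \<noteq> 0" using zs ab by blast
      ultimately show "p \<in> chart_hull H ?X" using t0 ab(3) by (simp add: pclass_scale)
    qed
  qed
qed

lemma proj_hull_cones:
  assumes A: "proper_cone A" and B: "proper_cone B" and meet: "A \<inter> B \<noteq> {}"
    and dual: "interior (dual_cone A) \<inter> interior (dual_cone B) \<noteq> {}"
  shows "proj_hull_defined (pclass ` A \<union> pclass ` B)"
    and "proj_hull (pclass ` A \<union> pclass ` B) = pclass ` (A + B)"
proof -
  let ?X = "pclass ` A \<union> pclass ` B"
  obtain y where y: "y \<in> interior (dual_cone A)" "y \<in> interior (dual_cone B)" using dual by blast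
  have zero: "x \<noteq> 0" if "x \<in> A \<union> B" for x
    using that zero_notin_proper_cone A B by blast
  have pos: "0 < y \<bullet> x" if "x \<in> A \<union> B" for x
    using that zero[OF that] interior_dual_cone_pos[OF y(1), of x] interior_dual_cone_pos[OF y(2), of x]
      closure_subset[of A] closure_subset[of B] by blast
  obtain a where "a \<in> A" using proper_coneD(3)[OF A] by blast
  then have y0: "y \<noteq> 0" using pos[of a] by auto
  let ?H = "pclass (blinfun_inner_right y)"
  have H: "?X \<subseteq> affine_chart ?H"
    using pclass_mem_hyperplane[OF blinfun_inner_right_nonzero[OF y0]] pos zero
    by (force simp: affine_chart_def)
  have unique: "Y = pclass ` (A + B)" if "\<exists>H. ?X \<subseteq> affine_chart H \<and> Y = chart_hull H ?X" for Y
    using that chart_hull_cones[OF A B meet] by blast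
  have exist: "\<exists>H. ?X \<subseteq> affine_chart H \<and> pclass ` (A + B) = chart_hull H ?X"
    using H chart_hull_cones[OF A B meet H] by blast
  have "connected (A \<union> B)"
    using convex_connected[OF proper_coneD(2)[OF A]] convex_connected[OF proper_coneD(2)[OF B]] meet
    by (rule connected_Un)
  then have "connected ?X"
    unfolding image_Un[symmetric] using zero by (intro connected_pclass_image) auto
  then show "proj_hull_defined ?X"
    unfolding proj_hull_defined_def
    by (intro conjI ex1I[where a = "pclass ` (A + B)"] exist unique) assumption+
  show "proj_hull ?X = pclass ` (A + B)"
    unfolding proj_hull_def by (rule the_equality, rule exist) (rule unique)
qed

lemma pgl_act_image:
  assumes "bij (blinfun_apply g)" "0 \<notin> X"
  shows "pgl_act (pclass g) ` pclass ` X = pclass ` blinfun_apply g ` X"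
  unfolding image_image using assms by (intro image_cong refl pgl_act_pclass) auto

section \<open>Lifting the groups\<close>

lemma proper_cone_uminus:
  assumes K: "proper_cone K"
  shows "proper_cone (uminus ` K)"
proof -
  have "linear (uminus :: 'a \<Rightarrow> 'a)" by (auto intro: linearI)
  moreover have "bij (uminus :: 'a \<Rightarrow> 'a)" by (rule o_bij[of uminus]) auto
  ultimately show ?thesis using K by (rule proper_cone_image)
qed

lemma pclass_image_uminus:
  assumes K: "proper_cone K"
  shows "pclass ` uminus ` K = pclass ` K"
  unfolding image_image using zero_notin_proper_cone[OF K]
  by (intro image_cong refl pclass_uminus) auto

lemma proper_cones_lift:
  assumes X: "properly_convex X" and Y: "properly_convex Y" and meet: "X \<inter> Y \<noteq> {}"
  obtains A B where "proper_cone A" "proper_cone B" "pclass ` A = X" "pclass ` B = Y" "A \<inter> B \<noteq> {}"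
proof -
  obtain A where A: "proper_cone A" "pclass ` A = X" using properly_convex_lift[OF X] meet by blast
  obtain B where B: "proper_cone B" "pclass ` B = Y" using properly_convex_lift[OF Y] meet by blast
  obtain a where a: "a \<in> A" "pclass a \<in> pclass ` B" using meet A(2) B(2) by blast
  have "a \<noteq> 0" using a(1) zero_notin_proper_cone[OF A(1)] by auto
  then have "a \<in> B \<or> - a \<in> B" using a(2) mem_pclass_image_cone[OF B(1)] by blast
  then show ?thesis
  proof
    assume "a \<in> B"
    then show ?thesis using that[OF A(1) B(1) A(2) B(2)] a(1) by blast
  next
    assume "- a \<in> B"
    then have "a \<in> uminus ` B" by (simp add: mem_uminus_image)
    then have "A \<inter> uminus ` B \<noteq> {}" using a(1) by blast
    then show ?thesis
      using that[OF A(1) proper_cone_uminus[OF B(1)] A(2)] pclass_image_uminus[OF B(1)] B(2) by simp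
  qed
qed

lemma blinfun_inverse:
  fixes g :: "'a::euclidean_space \<Rightarrow>\<^sub>L 'a"
  assumes g: "bij (blinfun_apply g)"
  obtains h where "bij (blinfun_apply h)" "g o\<^sub>L h = id_blinfun" "h o\<^sub>L g = id_blinfun"
proof -
  have "linear (inv_into UNIV (blinfun_apply g))"
    using g by (intro inj_linear_imp_inv_linear linear_blinfun bij_is_inj)
  then have bl: "bounded_linear (inv_into UNIV (blinfun_apply g))"
    by (simp add: linear_conv_bounded_linear)
  define h where "h = Blinfun (inv_into UNIV (blinfun_apply g))"
  have h: "blinfun_apply h = inv_into UNIV (blinfun_apply g)"
    using bl by (simp add: h_def bounded_linear_Blinfun_apply)
  have "bij (blinfun_apply h)" unfolding h using g by (rule bij_imp_bij_inv)
  moreover have "g o\<^sub>L h = id_blinfun"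
    using g by (intro blinfun_eqI) (simp add: h bij_is_surj surj_f_inv_f)
  moreover have "h o\<^sub>L g = id_blinfun"
    using g by (intro blinfun_eqI) (simp add: h bij_is_inj)
  ultimately show ?thesis using that by blast
qed

text \<open>A representative of \<open>\<gamma>\<close> maps \<open>K\<close> to \<open>K\<close> or to its opposite, and changing the sign of the
  representative exchanges these cases.\<close>

lemma stabilizer_lift:
  assumes K: "proper_cone K" and \<gamma>: "\<gamma> \<in> carrier PGL" "pgl_act \<gamma> ` pclass ` K = pclass ` K"
  obtains g where "bij (blinfun_apply g)" "pclass g = \<gamma>" "blinfun_apply g ` K = K"
proof -
  obtain g where g: "\<gamma> = pclass g" "bij (blinfun_apply g)" using \<gamma>(1) by (rule PGL_cases)
  have eq: "pclass ` blinfun_apply g ` K = pclass ` K"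
    using \<gamma>(2) pgl_act_image[OF g(2) zero_notin_proper_cone[OF K]] g(1) by simp
  have gK: "proper_cone (blinfun_apply g ` K)" by (rule proper_cone_image[OF linear_blinfun g(2) K])
  from pclass_image_eq_cases[OF gK K eq] show ?thesis
  proof
    assume "blinfun_apply g ` K = K"
    then show ?thesis using that g by metis
  next
    assume neg: "blinfun_apply g ` K = uminus ` K"
    have app: "blinfun_apply (- g) = uminus \<circ> blinfun_apply g"
      by (auto simp: blinfun.minus_left)
    have "bij (uminus :: 'a \<Rightarrow> 'a)" by (rule o_bij[of uminus]) auto
    then have "bij (blinfun_apply (- g))" unfolding app using g(2) bij_comp by blast
    moreover have "pclass (- g) = \<gamma>" using pclass_uminus[OF bij_blinfun_nonzero(1)[OF g(2)]] g(1) by simp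
    moreover have "blinfun_apply (- g) ` K = K"
      unfolding app image_comp[symmetric] neg by (simp add: image_image)
    ultimately show ?thesis using that by blast
  qed
qed

text \<open>Compatible lifts \<open>K False\<close> and \<open>K True\<close> of the two convex sets, whose lifted stabilizers in the two
  groups will be shown to form an \<open>occultation_system\<close>.\<close>

locale projective_occultation =
  fixes \<Gamma> :: "bool \<Rightarrow> ('a::euclidean_space \<Rightarrow>\<^sub>L 'a) proj_space set" and K :: "bool \<Rightarrow> 'a set"
  assumes dim3: "DIM('a) \<ge> 3"
    and subgroup: "subgroup (\<Gamma> i) PGL"
    and proper: "proper_cone (K i)"
    and meet: "K i \<inter> K (\<not> i) \<noteq> {}"
    and invariant: "\<gamma> \<in> \<Gamma> i \<Longrightarrow> pgl_act \<gamma> ` pclass ` K i = pclass ` K i"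
    and occultation: "\<gamma> \<in> \<Gamma> i - \<Gamma> (\<not> i) \<Longrightarrow>
      occultation_position (pclass ` K (\<not> i)) (pclass ` K i) (pgl_act \<gamma> ` pclass ` K (\<not> i))"
    and different: "\<exists>i. \<Gamma> i - \<Gamma> (\<not> i) \<noteq> {}"
begin

definition H :: "bool \<Rightarrow> ('a \<Rightarrow>\<^sub>L 'a) set" where
  "H i = {g. bij (blinfun_apply g) \<and> pclass g \<in> \<Gamma> i \<and> blinfun_apply g ` K i = K i}"

lemma lift:
  assumes "\<gamma> \<in> \<Gamma> i"
  obtains g where "g \<in> H i" "pclass g = \<gamma>"
  using stabilizer_lift[OF proper subgroup.mem_carrier[OF subgroup assms] invariant[OF assms]] assms
  unfolding H_def by blast

lemma occulted_lift:
  assumes g: "g \<in> H i" and n: "pclass g \<notin> \<Gamma> (\<not> i)"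
  shows "occulted (K (\<not> i)) (K i) (blinfun_apply g ` K (\<not> i))"
proof (rule occulted_of_occultation_position[OF proper proper])
  have b: "bij (blinfun_apply g)" and gK: "blinfun_apply g ` K i = K i" and "pclass g \<in> \<Gamma> i"
    using g unfolding H_def by auto
  show "proper_cone (blinfun_apply g ` K (\<not> i))" by (rule proper_cone_image[OF linear_blinfun b proper])
  show "K (\<not> i) \<inter> K i \<noteq> {}" using meet[of i] by blast
  have "blinfun_apply g ` (K i \<inter> K (\<not> i)) \<subseteq> K i \<inter> blinfun_apply g ` K (\<not> i)"
    using gK by blast
  then show "K i \<inter> blinfun_apply g ` K (\<not> i) \<noteq> {}" using meet[of i] by blast
  have "occultation_position (pclass ` K (\<not> i)) (pclass ` K i) (pgl_act (pclass g) ` pclass ` K (\<not> i))"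
    using occultation \<open>pclass g \<in> \<Gamma> i\<close> n by blast
  then show "occultation_position (pclass ` K (\<not> i)) (pclass ` K i) (pclass ` blinfun_apply g ` K (\<not> i))"
    using pgl_act_image[OF b zero_notin_proper_cone[OF proper[of "\<not> i"]]] by simp
qed

lemma common_dual: "interior (dual_cone (K i)) \<inter> interior (dual_cone (K (\<not> i))) \<noteq> {}"
proof -
  obtain j \<gamma> where j: "\<gamma> \<in> \<Gamma> j" "\<gamma> \<notin> \<Gamma> (\<not> j)" using different by blast
  obtain g where g: "g \<in> H j" "pclass g = \<gamma>" using lift[OF j(1)] .
  have "interior (dual_cone (K j)) \<inter> interior (dual_cone (K (\<not> j))) \<noteq> {}"
    using occulted_common_dual[OF occulted_lift[OF g(1)]] g(2) j(2) by blast
  then show ?thesis by (cases "i = j") (auto simp: Int_commute)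
qed

lemma uminus_disjoint: "x \<in> K i \<Longrightarrow> - x \<notin> K (\<not> i)"
  by (rule uminus_notin_common_dual[OF proper common_dual])

text \<open>An element of the amalgamated subgroup has the same positive lift for both cones, since these meet
  while neither meets the opposite of the other.\<close>

lemma H_swap:
  assumes g: "g \<in> H i" and m: "pclass g \<in> \<Gamma> (\<not> i)"
  shows "g \<in> H (\<not> i)"
proof -
  have b: "bij (blinfun_apply g)" and gK: "blinfun_apply g ` K i = K i"
    using g unfolding H_def by auto
  have "pclass ` blinfun_apply g ` K (\<not> i) = pclass ` K (\<not> i)"
    using invariant[OF m] pgl_act_image[OF b zero_notin_proper_cone[OF proper[of "\<not> i"]]] by simp
  then consider "blinfun_apply g ` K (\<not> i) = K (\<not> i)" | "blinfun_apply g ` K (\<not> i) = uminus ` K (\<not> i)"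
    using pclass_image_eq_cases[OF proper_cone_image[OF linear_blinfun b proper] proper] by blast
  then show ?thesis
  proof cases
    case 1
    then show ?thesis unfolding H_def using b m by blast
  next
    case 2
    obtain x where "x \<in> K i" "x \<in> K (\<not> i)" using meet[of i] by blast
    then have "blinfun_apply g x \<in> K i" "- blinfun_apply g x \<in> K (\<not> i)"
      using gK 2 by (auto simp flip: mem_uminus_image)
    then show ?thesis using uminus_disjoint by blast
  qed
qed

sublocale occultation_system K H
proof
  show "DIM('a) \<ge> 3" by (rule dim3)
  show "bij (blinfun_apply g)" "blinfun_apply g ` K i = K i" if "g \<in> H i" for g i
    using that unfolding H_def by auto
  show "id_blinfun \<in> H i" for i
    unfolding H_def using bij_id_blinfun subgroup.one_closed[OF subgroup[of i]]
    by (simp add: PGL_one id_blinfun.rep_eq)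
  show "g o\<^sub>L h \<in> H i" if g: "g \<in> H i" and h: "h \<in> H i" for g h i
  proof -
    have b: "bij (blinfun_apply g)" "bij (blinfun_apply h)" using g h unfolding H_def by auto
    have "pclass (g o\<^sub>L h) \<in> \<Gamma> i"
      using subgroup.m_closed[OF subgroup, of "pclass g" i "pclass h"] g h PGL_mult[OF b]
      unfolding H_def by simp
    moreover have "blinfun_apply (g o\<^sub>L h) ` K i = K i"
      using g h unfolding H_def image_blinfun_compose by simp
    ultimately show ?thesis unfolding H_def using bij_blinfun_compose[OF b] by blast
  qed
  show "\<exists>h\<in>H i. g o\<^sub>L h = id_blinfun \<and> h o\<^sub>L g = id_blinfun" if g: "g \<in> H i" for g i
  proof -
    have b: "bij (blinfun_apply g)" and gK: "blinfun_apply g ` K i = K i" and mem: "pclass g \<in> \<Gamma> i"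
      using g unfolding H_def by auto
    obtain h where h: "bij (blinfun_apply h)" "g o\<^sub>L h = id_blinfun" "h o\<^sub>L g = id_blinfun"
      using blinfun_inverse[OF b] .
    have "pclass h \<otimes>\<^bsub>PGL\<^esub> pclass g = \<one>\<^bsub>PGL\<^esub>" using PGL_mult[OF h(1) b] h(3) by (simp add: PGL_one)
    then have "inv\<^bsub>PGL\<^esub> (pclass g) = pclass h"
      by (rule group.inv_equality[OF group_PGL _ PGL_carrier[OF b] PGL_carrier[OF h(1)]])
    then have "pclass h \<in> \<Gamma> i" using subgroup.m_inv_closed[OF subgroup mem] by simp
    moreover have "blinfun_apply h ` K i = K i"
      using image_blinfun_compose[of h g "K i"] unfolding gK h(3) by (simp add: id_blinfun.rep_eq)
    ultimately have "h \<in> H i" unfolding H_def using h(1) by blast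
    then show ?thesis using h by blast
  qed
  show "occulted (K (\<not> i)) (K i) (blinfun_apply g ` K (\<not> i))" if g: "g \<in> H i - H (\<not> i)" for g i
    using occulted_lift[of g i] H_swap[of g i] g by blast
  obtain i \<gamma> where i: "\<gamma> \<in> \<Gamma> i" "\<gamma> \<notin> \<Gamma> (\<not> i)" using different by blast
  obtain g where g: "g \<in> H i" "pclass g = \<gamma>" using lift[OF i(1)] .
  have "g \<notin> H (\<not> i)" using g(2) i(2) unfolding H_def by blast
  then show "\<exists>i. H i - H (\<not> i) \<noteq> {}" using g(1) by blast
qed

lemma pclass_H: "g \<in> H i \<Longrightarrow> pclass g \<in> \<Gamma> i"
  unfolding H_def by blast

text \<open>A word with at least two letters is not a scalar, since it moves points of \<open>K (\<not> i)\<close> out of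
  \<open>K (\<not> i)\<close> and of its opposite.\<close>

lemma reduced_trivial:
  assumes w: "reduced w" and one: "pclass (word_prod w) = \<one>\<^bsub>PGL\<^esub>"
  shows "w = [] \<or> (\<exists>i g. w = [(i, g)] \<and> pclass g = \<one>\<^bsub>PGL\<^esub>)"
proof -
  consider "w = []" | i g where "w = [(i, g)]" | i where "alternating i w" "2 \<le> length w"
  proof (cases w)
    case (Cons x v)
    then show ?thesis using that w unfolding reduced_def by (cases x; cases v) auto
  qed (use that in blast)
  then show ?thesis
  proof cases
    case (2 i g)
    have "g o\<^sub>L id_blinfun = g" by (rule blinfun_eqI) simp
    then show ?thesis using 2 one by simp
  next
    case (3 i)
    have b: "bij (blinfun_apply (word_prod w))"
      using products_bij alternating_words[OF 3(1)] unfolding products_def by blast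
    obtain x where x: "x \<in> K (\<not> i)" using proper_coneD(3)[OF proper] by blast
    have "K (\<not> i) \<subseteq> edge_cone" unfolding edge_cone_eq[of i] by (rule subset_cone_sum'[OF proper proper])
    then have move: "blinfun_apply (word_prod w) x \<notin> K (\<not> i)" "- blinfun_apply (word_prod w) x \<notin> K (\<not> i)"
      using alternating_moves[OF 3] x by blast+
    have "pclass id_blinfun = pclass (word_prod w)" using one by (simp add: PGL_one)
    then obtain c where c: "c \<noteq> 0" "word_prod w = c *\<^sub>R id_blinfun"
      using pclass_eqE[OF bij_blinfun_nonzero(1)[OF bij_id_blinfun] bij_blinfun_nonzero(1)[OF b]] by blast
    have "blinfun_apply (word_prod w) x = c *\<^sub>R x" unfolding c(2) by (simp add: blinfun.scaleR_left)
    then show ?thesis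
      using move proper_coneD(4)[OF proper x, of c] proper_coneD(4)[OF proper x, of "- c"] c(1)
      by (cases "c > 0") auto
  qed blast
qed

end

section \<open>The representation of the amalgam\<close>

context projective_occultation
begin

sublocale am: amalgam_data "PGL\<lparr>carrier := \<Gamma> False\<rparr>" "PGL\<lparr>carrier := \<Gamma> True\<rparr>"
  "PGL\<lparr>carrier := \<Gamma> False \<inter> \<Gamma> True\<rparr>" "\<lambda>\<delta>. \<delta>" "\<lambda>\<delta>. \<delta>"
  by (intro amalgam_data.intro amalgam_data_axioms.intro
      subgroup.subgroup_is_group[OF subgroup group_PGL]) auto

definition letter where
  "letter x = (if fst x then Inr (pclass (snd x)) else Inl (pclass (snd x)))"

lemma letter_word: "g \<in> H i \<Longrightarrow> [letter (i, g)] \<in> am.W"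
  using pclass_H[of g i] by (cases i) (auto simp: letter_def)

lemma map_letter_words: "w \<in> words \<Longrightarrow> map letter w \<in> am.W"
proof (induction w)
  case (Cons x w)
  obtain i g where x: "x = (i, g)" by (cases x)
  have "[letter (i, g)] @ map letter w \<in> am.W"
    using Cons x letter_word[of g i] by (subst am.words_simps(4)) simp
  then show ?case by (simp add: x)
qed simp

lemma ex_map_letter: "v \<in> am.W \<Longrightarrow> \<exists>w\<in>words. map letter w = v"
proof (induction v)
  case Nil
  then show ?case by (intro bexI[of _ "[]"]) simp_all
next
  case (Cons s v)
  have "s \<in> \<Gamma> False <+> \<Gamma> True" "v \<in> am.W" using Cons.prems by (auto simp: amalgam_words_def)
  then obtain w where w: "w \<in> words" "map letter w = v" using Cons.IH by blast
  obtain i g where g: "g \<in> H i" "letter (i, g) = s"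
  proof (cases s)
    case (Inl a)
    then have "a \<in> \<Gamma> False" using \<open>s \<in> _\<close> by auto
    then obtain g where "g \<in> H False" "pclass g = a" by (rule lift)
    then show ?thesis using that[of g False] Inl by (simp add: letter_def)
  next
    case (Inr a)
    then have "a \<in> \<Gamma> True" using \<open>s \<in> _\<close> by auto
    then obtain g where "g \<in> H True" "pclass g = a" by (rule lift)
    then show ?thesis using that[of g True] Inr by (simp add: letter_def)
  qed
  show ?case using w g by (intro bexI[of _ "(i, g) # w"]) simp_all
qed

lemma reduce_amalgam_word:
  assumes "w \<in> words"
  shows "\<exists>v. (am.R (map letter w) (map letter v) \<and> word_prod w = word_prod v) \<and> reduced v"
proof (rule reduce_word[OF _ _ _ _ _ assms])
  have app: "am.R (u @ map letter w) (v @ map letter w)" if "am.R u v" "w \<in> words" for u v w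
    using that by (intro amalgam_rel.append amalgam_rel.refl map_letter_words)
  show "am.R (map letter w) (map letter w) \<and> word_prod w = word_prod w" if "w \<in> words" for w
    using that by (simp add: amalgam_rel.refl map_letter_words)
  show "am.R (map letter u) (map letter w) \<and> word_prod u = word_prod w"
    if "am.R (map letter u) (map letter v) \<and> word_prod u = word_prod v"
      "am.R (map letter v) (map letter w) \<and> word_prod v = word_prod w" for u v w
    using amalgam_rel.trans[OF conjunct1[OF that(1)] conjunct1[OF that(2)]] that by simp
  show "am.R (map letter ((i, g) # v)) (map letter ((i, g) # w)) \<and>
      word_prod ((i, g) # v) = word_prod ((i, g) # w)"
    if "g \<in> H i" "am.R (map letter v) (map letter w) \<and> word_prod v = word_prod w" for i g v w
    using amalgam_rel.append[OF amalgam_rel.refl[OF letter_word[OF that(1)]] conjunct1[OF that(2)]] that(2)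
    by simp
  show "am.R (map letter ((i, g) # (i, h) # w)) (map letter ((i, g o\<^sub>L h) # w)) \<and>
      word_prod ((i, g) # (i, h) # w) = word_prod ((i, g o\<^sub>L h) # w)"
    if g: "g \<in> H i" and h: "h \<in> H i" and w: "w \<in> words" for i g h w
  proof
    have m: "pclass (g o\<^sub>L h) = pclass g \<otimes>\<^bsub>PGL\<^esub> pclass h"
      using PGL_mult[OF bij[OF g] bij[OF h]] by simp
    have "am.R [letter (i, g), letter (i, h)] [letter (i, g o\<^sub>L h)]"
    proof (cases i)
      case True
      then show ?thesis
        using amalgam_rel.mult_right[of "pclass g" "PGL\<lparr>carrier := \<Gamma> True\<rparr>" "pclass h"]
          pclass_H[OF g] pclass_H[OF h] by (simp add: letter_def m)
    next
      case False
      then show ?thesis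
        using amalgam_rel.mult_left[of "pclass g" "PGL\<lparr>carrier := \<Gamma> False\<rparr>" "pclass h"]
          pclass_H[OF g] pclass_H[OF h] by (simp add: letter_def m)
    qed
    from app[OF this w]
    show "am.R (map letter ((i, g) # (i, h) # w)) (map letter ((i, g o\<^sub>L h) # w))" by simp
  qed (simp add: blinfun_compose_assoc)
  show "am.R (map letter ((i, g) # w)) (map letter ((\<not> i, g) # w)) \<and>
      word_prod ((i, g) # w) = word_prod ((\<not> i, g) # w)"
    if g: "g \<in> H i" "g \<in> H (\<not> i)" and w: "w \<in> words" for i g w
  proof
    have c: "pclass g \<in> \<Gamma> False \<inter> \<Gamma> True"
      using pclass_H[OF g(1)] pclass_H[OF g(2)] by (cases i) auto
    have "am.R [Inl (pclass g)] [Inr (pclass g)]"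
      using amalgam_rel.glue[of "pclass g" "PGL\<lparr>carrier := \<Gamma> False \<inter> \<Gamma> True\<rparr>"] c by simp
    then have "am.R [letter (i, g)] [letter (\<not> i, g)]"
      using amalgam_rel.sym by (cases i) (auto simp: letter_def)
    from app[OF this w]
    show "am.R (map letter ((i, g) # w)) (map letter ((\<not> i, g) # w))" by simp
  qed simp
qed

abbreviation rep where "rep \<equiv> amalgam_lift PGL (\<lambda>\<gamma>. \<gamma>) (\<lambda>\<gamma>. \<gamma>)"

lemma hom_inclusion: "(\<lambda>\<gamma>. \<gamma>) \<in> hom (PGL\<lparr>carrier := \<Gamma> i\<rparr>) PGL"
  using subgroup.mem_carrier[OF subgroup] by (auto simp: hom_def)

lemmas rep_class = am.amalgam_lift_class[OF group_PGL hom_inclusion hom_inclusion HOL.refl]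
lemmas rep_hom = am.amalgam_lift_hom[OF group_PGL hom_inclusion hom_inclusion HOL.refl]

lemma word_value_map_letter:
  "w \<in> words \<Longrightarrow> word_value PGL (\<lambda>\<gamma>. \<gamma>) (\<lambda>\<gamma>. \<gamma>) (map letter w) = pclass (word_prod w)"
proof (induction w)
  case Nil
  then show ?case by (simp add: word_value_def PGL_one)
next
  case (Cons x w)
  obtain i g where x: "x = (i, g)" by (cases x)
  then have g: "g \<in> H i" and w: "w \<in> words" using Cons.prems by auto
  have b: "bij (blinfun_apply (word_prod w))" using products_bij w unfolding products_def by blast
  have "word_value PGL (\<lambda>\<gamma>. \<gamma>) (\<lambda>\<gamma>. \<gamma>) (map letter (x # w)) =
      pclass g \<otimes>\<^bsub>PGL\<^esub> word_value PGL (\<lambda>\<gamma>. \<gamma>) (\<lambda>\<gamma>. \<gamma>) (map letter w)"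
    by (simp add: word_value_def letter_def x)
  then show ?case using Cons.IH[OF w] PGL_mult[OF bij[OF g] b] by (simp add: x)
qed

lemma rep_map_letter: "w \<in> words \<Longrightarrow> rep (am.K (map letter w)) = pclass (word_prod w)"
  using rep_class[OF map_letter_words] word_value_map_letter by simp

lemma carrier_cases:
  assumes "X \<in> carrier am.P"
  obtains w where "reduced w" "X = am.K (map letter w)" "rep X = pclass (word_prod w)"
proof -
  obtain v where "v \<in> am.W" "X = am.K v" using assms unfolding am.carrier_amalgam by blast
  then obtain u where u: "u \<in> words" "X = am.K (map letter u)" using ex_map_letter by blast
  obtain w where w: "am.R (map letter u) (map letter w)" "reduced w"
    using reduce_amalgam_word[OF u(1)] by blast
  have "X = am.K (map letter w)" using am.class_eqI[OF w(1)] u(2) by simp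
  then show ?thesis using that[OF w(2)] rep_map_letter[OF reduced_words[OF w(2)]] by simp
qed

lemma rep_image: "rep ` carrier am.P = pclass ` products"
proof
  show "rep ` carrier am.P \<subseteq> pclass ` products"
  proof (rule image_subsetI)
    fix X assume "X \<in> carrier am.P"
    then obtain w where w: "reduced w" "rep X = pclass (word_prod w)" by (rule carrier_cases)
    then show "rep X \<in> pclass ` products" unfolding products_def using reduced_words by blast
  qed
  show "pclass ` products \<subseteq> rep ` carrier am.P"
  proof
    fix S assume "S \<in> pclass ` products"
    then obtain w where w: "w \<in> words" "S = pclass (word_prod w)" unfolding products_def by blast
    have "am.K (map letter w) \<in> carrier am.P"
      unfolding am.carrier_amalgam using map_letter_words[OF w(1)] by blast
    then show "S \<in> rep ` carrier am.P" using rep_map_letter[OF w(1)] w(2) by (metis imageI)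
  qed
qed

lemma rep_inj: "inj_on rep (carrier am.P)"
proof -
  interpret group_hom am.P PGL rep
    by (intro group_hom.intro group_hom_axioms.intro am.group_amalgam group_PGL rep_hom)
  have "X = \<one>\<^bsub>am.P\<^esub>" if X: "X \<in> carrier am.P" and one: "rep X = \<one>\<^bsub>PGL\<^esub>" for X
  proof -
    obtain w where w: "reduced w" "X = am.K (map letter w)" "rep X = pclass (word_prod w)"
      using carrier_cases[OF X] .
    from reduced_trivial[OF w(1)] w(3) one
    have "w = [] \<or> (\<exists>i g. w = [(i, g)] \<and> pclass g = \<one>\<^bsub>PGL\<^esub>)" by simp
    then have "am.R (map letter w) []"
    proof
      assume "w = []"
      then show ?thesis by (simp add: amalgam_rel.refl)
    next
      assume "\<exists>i g. w = [(i, g)] \<and> pclass g = \<one>\<^bsub>PGL\<^esub>"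
      then obtain i g where ig: "w = [(i, g)]" "pclass g = \<one>\<^bsub>PGL\<^esub>" by blast
      show ?thesis
        using amalgam_rel.one_left[of "PGL\<lparr>carrier := \<Gamma> False\<rparr>"] amalgam_rel.one_right[where B = "PGL\<lparr>carrier := \<Gamma> True\<rparr>"]
        by (cases i) (simp_all add: ig letter_def)
    qed
    then show ?thesis using am.class_eqI w(2) by (simp add: am.one_class)
  qed
  then have "kernel am.P PGL rep = {\<one>\<^bsub>am.P\<^esub>}"
    unfolding kernel_def using hom_one by auto
  then show ?thesis by (rule trivial_ker_imp_inj)
qed

text \<open>An element that brings a point of the overlap of the two cones back to the overlap comes from a
  word with at most one letter.\<close>

lemma products_near_one:
  assumes g: "g \<in> products" and x: "x \<in> K False \<inter> K True"
    and near: "blinfun_apply g x \<in> K False \<inter> K True \<or> - blinfun_apply g x \<in> K False \<inter> K True"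
  shows "\<exists>i. pclass g \<in> \<Gamma> i"
  using g
proof (cases rule: products_cases)
  case 1
  then show ?thesis using pclass_H by blast
next
  case (2 i w)
  have "x \<in> K i" using x by (cases i) auto
  then have "x \<in> edge_cone" unfolding edge_cone_eq[of i] using subset_cone_sum[OF proper proper] by blast
  have "\<not> 2 \<le> length w"
  proof
    assume "2 \<le> length w"
    from alternating_moves[OF 2(1) this \<open>x \<in> edge_cone\<close>] near show False
      unfolding 2(2)[symmetric] by (cases i) auto
  qed
  moreover obtain h v where "w = (i, h) # v" "h \<in> H i" using alternatingE[OF 2(1)] by blast
  ultimately have h: "w = [(i, h)]" "h \<in> H i" by (cases v; simp)+
  have "g = h" unfolding 2(2) h(1) by (rule blinfun_eqI) simp
  then show ?thesis using pclass_H[OF h(2)] by blast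
qed

text \<open>Near the identity, every element maps a fixed point of the overlap of the two sets into this open
  overlap, so the group coincides there with the union of the two given groups, which are discrete.
  Left translation carries this to the other elements.\<close>

lemma discrete_products:
  assumes discrete: "\<And>i. discrete (\<Gamma> i)"
  shows "discrete (pclass ` products)"
proof -
  let ?I = "K False \<inter> K True"
  obtain x where x: "x \<in> ?I" using meet[of False] by auto
  let ?W = "{g :: 'a \<Rightarrow>\<^sub>L 'a. g \<noteq> 0 \<and> (blinfun_apply g x \<in> ?I \<or> - blinfun_apply g x \<in> ?I)}"
  have x0: "0 \<notin> ?I" using zero_notin_proper_cone[OF proper] by blast
  have W0: "0 \<notin> ?W" by simp
  have Wscale: "c *\<^sub>R k \<in> ?W" if k: "k \<in> ?W" "c \<noteq> 0" for k c
  proof -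
    have s: "d *\<^sub>R v \<in> ?I" if "v \<in> ?I" "d > 0" for d v
      using that proper_coneD(4)[OF proper] by blast
    show ?thesis
      using k s[of "blinfun_apply k x" c] s[of "- blinfun_apply k x" c]
        s[of "blinfun_apply k x" "- c"] s[of "- blinfun_apply k x" "- c"]
      by (cases "c > 0") (auto simp: blinfun.scaleR_left)
  qed
  have openI: "open {g :: 'a \<Rightarrow>\<^sub>L 'a. blinfun_apply g x \<in> S}" if "open S" for S
    using continuous_open_vimage[OF that linear_continuous_at[OF blinfun.bounded_linear_left[of x]]]
    by (simp add: vimage_def)
  have "?W = - {0} \<inter> ({g. blinfun_apply g x \<in> ?I} \<union> {g. blinfun_apply g x \<in> uminus ` ?I})"
    by (simp only: Set.set_eq_iff Int_iff Un_iff Compl_iff mem_Collect_eq mem_uminus_image singleton_iff) blast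
  moreover have "open \<dots>"
    by (intro open_Int open_Un openI open_negations proper_coneD(1)[OF proper]) auto
  ultimately have "open ?W" by (simp only:)
  then have U: "open (pclass ` ?W)" using W0 Wscale by (rule open_pclass_image)
  have "\<exists>T. open T \<and> T \<inter> \<Gamma> i = {\<one>\<^bsub>PGL\<^esub>}" for i
    using discrete[of i] subgroup.one_closed[OF subgroup[of i]]
    unfolding discrete_def isolated_in_def by blast
  then obtain T where T: "\<And>i. open (T i)" "\<And>i. T i \<inter> \<Gamma> i = {\<one>\<^bsub>PGL\<^esub>}" by metis
  define N where "N = pclass ` ?W \<inter> T False \<inter> T True"
  have openN: "open N" unfolding N_def using U T(1) by blast
  have one_N: "\<one>\<^bsub>PGL\<^esub> \<in> N"
  proof -
    have "id_blinfun \<in> ?W" using x bij_blinfun_nonzero(1)[OF bij_id_blinfun] by simp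
    then have "\<one>\<^bsub>PGL\<^esub> \<in> pclass ` ?W" unfolding PGL_one by blast
    then show ?thesis unfolding N_def using T(2) by blast
  qed
  have N: "pclass g = \<one>\<^bsub>PGL\<^esub>" if g: "g \<in> products" "pclass g \<in> N" for g
  proof -
    have "pclass g \<in> pclass ` ?W" using g(2) unfolding N_def by blast
    then have "g \<in> ?W"
      using mem_pclass_image_scaling[OF W0 Wscale bij_blinfun_nonzero(1)[OF products_bij[OF g(1)]]] by blast
    then obtain i where "pclass g \<in> \<Gamma> i" using products_near_one[OF g(1) x] by blast
    moreover have "pclass g \<in> T i" using g(2) unfolding N_def by (cases i) auto
    ultimately show ?thesis using T(2)[of i] by blast
  qed
  show ?thesis
  proof (rule discreteI)
    fix S assume "S \<in> pclass ` products"
    then obtain s where s: "s \<in> products" "S = pclass s" by blast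
    obtain h where h: "h \<in> products" "s o\<^sub>L h = id_blinfun" "h o\<^sub>L s = id_blinfun"
      using products_inverse[OF s(1)] by blast
    have ap: "blinfun_apply s (blinfun_apply h z) = z" for z
      using h(2) by (metis blinfun_apply_blinfun_compose id_blinfun.rep_eq)
    have shg: "s o\<^sub>L (h o\<^sub>L g) = g" for g :: "'a \<Rightarrow>\<^sub>L 'a" by (rule blinfun_eqI) (simp add: ap)
    have s0: "s \<noteq> 0" using bij_blinfun_nonzero(1)[OF products_bij[OF s(1)]] .
    \<comment> \<open>The left translate of \<open>N\<close> by \<open>S\<close>, described by its representatives.\<close>
    let ?M = "{g. g \<noteq> 0 \<and> pclass (h o\<^sub>L g) \<in> N}"
    have hg0: "h o\<^sub>L g \<noteq> 0" if "g \<noteq> 0" for g :: "'a \<Rightarrow>\<^sub>L 'a"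
    proof
      assume "h o\<^sub>L g = 0"
      then have "g = 0" using shg[of g] by simp
      then show False using that by simp
    qed
    have M0: "0 \<notin> ?M" by simp
    have Mscale: "c *\<^sub>R k \<in> ?M" if k: "k \<in> ?M" "c \<noteq> 0" for k c
    proof -
      have "h o\<^sub>L (c *\<^sub>R k) = c *\<^sub>R (h o\<^sub>L k)"
        by (rule blinfun_eqI) (simp add: blinfun.scaleR_left blinfun.scaleR_right)
      then show ?thesis using k pclass_scale[OF hg0[of k] k(2)] by simp
    qed
    have bl: "bounded_linear (\<lambda>g. h o\<^sub>L g)"
      by (rule bounded_bilinear.bounded_linear_right[OF bounded_bilinear_blinfun_compose])
    have "open {k. k \<noteq> 0 \<and> pclass k \<in> N}" using openN unfolding open_proj_iff .
    then have "open ((\<lambda>g. h o\<^sub>L g) -` {k. k \<noteq> 0 \<and> pclass k \<in> N})"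
      by (rule continuous_open_vimage[OF _ linear_continuous_at[OF bl]])
    moreover have "(\<lambda>g. h o\<^sub>L g) -` {k. k \<noteq> 0 \<and> pclass k \<in> N} = ?M"
    proof -
      have "h o\<^sub>L g \<noteq> 0 \<longleftrightarrow> g \<noteq> 0" for g :: "'a \<Rightarrow>\<^sub>L 'a"
      proof
        assume "h o\<^sub>L g \<noteq> 0"
        then show "g \<noteq> 0" by (rule contrapos_nn) simp
      qed (rule hg0)
      then show ?thesis by (simp only: vimage_def mem_Collect_eq)
    qed
    ultimately have "open ?M" by (simp only:)
    then have "open (pclass ` ?M)" using M0 Mscale by (rule open_pclass_image)
    moreover have "pclass ` ?M \<inter> pclass ` products = {S}"
    proof
      have "s \<in> ?M" using s0 one_N h(3) by (simp add: PGL_one)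
      then show "{S} \<subseteq> pclass ` ?M \<inter> pclass ` products" using s by blast
      show "pclass ` ?M \<inter> pclass ` products \<subseteq> {S}"
      proof
        fix R assume R: "R \<in> pclass ` ?M \<inter> pclass ` products"
        then obtain g where g: "g \<in> products" "R = pclass g" by blast
        have g0: "g \<noteq> 0" using bij_blinfun_nonzero(1)[OF products_bij[OF g(1)]] .
        have "pclass g \<in> pclass ` ?M" using R unfolding g(2) by (rule IntD1)
        moreover have "pclass g \<in> pclass ` ?M \<longleftrightarrow> g \<in> ?M"
          using M0 Mscale g0 by (rule mem_pclass_image_scaling)
        ultimately have "g \<in> ?M" by (simp only:)
        then have "pclass (h o\<^sub>L g) \<in> N" by simp
        then have "pclass (h o\<^sub>L g) = pclass id_blinfun"
          using N[OF products_comp[OF h(1) g(1)]] by (simp add: PGL_one)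
        then obtain c where c: "c \<noteq> 0" "id_blinfun = c *\<^sub>R (h o\<^sub>L g)"
          using pclass_eqE[OF hg0[OF g0] bij_blinfun_nonzero(1)[OF bij_id_blinfun]] by blast
        have "s = s o\<^sub>L id_blinfun" by (rule blinfun_eqI) simp
        also have "\<dots> = s o\<^sub>L (c *\<^sub>R (h o\<^sub>L g))" using c(2) by simp
        also have "\<dots> = c *\<^sub>R (s o\<^sub>L (h o\<^sub>L g))"
          by (rule blinfun_eqI) (simp add: blinfun.scaleR_left blinfun.scaleR_right)
        finally have "s = c *\<^sub>R g" unfolding shg .
        then show "R \<in> {S}" using pclass_scale[OF g0 c(1)] s(2) g(2) by simp
      qed
    qed
    ultimately show "S isolated_in pclass ` products"
      unfolding isolated_in_def using s by blast
  qed
qed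

lemma rep_domain:
  "(\<Union>X\<in>carrier am.P. pgl_act (rep X) ` pclass ` edge_cone) = pclass ` domain_cone"
proof -
  have "(\<Union>X\<in>carrier am.P. pgl_act (rep X) ` pclass ` edge_cone) =
      (\<Union>S\<in>rep ` carrier am.P. pgl_act S ` pclass ` edge_cone)"
    by (simp only: image_image[of _ rep] UN_simps)
  also have "\<dots> = (\<Union>g\<in>products. pgl_act (pclass g) ` pclass ` edge_cone)"
    unfolding rep_image by blast
  also have "\<dots> = (\<Union>g\<in>products. pclass ` blinfun_apply g ` edge_cone)"
    by (intro SUP_cong HOL.refl pgl_act_image products_bij zero_notin_proper_cone cone_edge)
  also have "\<dots> = pclass ` domain_cone" unfolding domain_cone_def by blast
  finally show ?thesis .
qed

lemma rep_domain_invariant: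
  assumes "X \<in> carrier am.P"
  shows "pgl_act (rep X) ` pclass ` domain_cone = pclass ` domain_cone"
proof -
  have "rep X \<in> pclass ` products" unfolding rep_image[symmetric] using assms by (rule imageI)
  then obtain g where g: "g \<in> products" "rep X = pclass g" by blast
  show ?thesis
    unfolding g(2) pgl_act_image[OF products_bij[OF g(1)] zero_notin_proper_cone[OF proper_cone_domain]]
      domain_cone_image[OF g(1)] ..
qed

lemma proj_hull_edge:
  "proj_hull_defined (pclass ` K False \<union> pclass ` K True)"
  "proj_hull (pclass ` K False \<union> pclass ` K True) = pclass ` edge_cone"
  using proj_hull_cones[OF proper proper, of False True] meet[of False] common_dual[of False]
  by (simp_all add: edge_cone_def)

end

section \<open>Combination theorem\<close>

theorem theorem1p3:
  fixes \<Gamma>0 \<Gamma>1 \<Delta> :: "('a::euclidean_space \<Rightarrow>\<^sub>L 'a) proj_space set"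
    and \<Omega>0 \<Omega>1 \<Omega> :: "'a proj_space set"
  assumes dim: "DIM('a) \<ge> 3"
    and \<Gamma>0: "subgroup \<Gamma>0 PGL" "discrete \<Gamma>0" "\<Gamma>0 \<noteq> {\<one>\<^bsub>PGL\<^esub>}"
    and \<Gamma>1: "subgroup \<Gamma>1 PGL" "discrete \<Gamma>1" "\<Gamma>1 \<noteq> {\<one>\<^bsub>PGL\<^esub>}"
    and \<Omega>0: "properly_convex \<Omega>0" "\<And>\<gamma>. \<gamma> \<in> \<Gamma>0 \<Longrightarrow> pgl_act \<gamma> ` \<Omega>0 = \<Omega>0"
    and \<Omega>1: "properly_convex \<Omega>1" "\<And>\<gamma>. \<gamma> \<in> \<Gamma>1 \<Longrightarrow> pgl_act \<gamma> ` \<Omega>1 = \<Omega>1"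
    and \<Delta>: "\<Delta> = \<Gamma>0 \<inter> \<Gamma>1"
    and \<Gamma>: "\<Gamma> = amalgam (PGL\<lparr>carrier := \<Gamma>0\<rparr>) (PGL\<lparr>carrier := \<Gamma>1\<rparr>)
                 (PGL\<lparr>carrier := \<Delta>\<rparr>) (\<lambda>\<delta>. \<delta>) (\<lambda>\<delta>. \<delta>)"
    and occultation0: "\<And>\<gamma>. \<gamma> \<in> \<Gamma>0 - \<Delta> \<Longrightarrow> occultation_position \<Omega>1 \<Omega>0 (pgl_act \<gamma> ` \<Omega>1)"
    and occultation1: "\<And>\<gamma>. \<gamma> \<in> \<Gamma>1 - \<Delta> \<Longrightarrow> occultation_position \<Omega>0 \<Omega>1 (pgl_act \<gamma> ` \<Omega>0)"
    and distinct: "\<Gamma>0 \<noteq> \<Gamma>1"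
    and \<rho>: "\<rho> = amalgam_lift PGL (\<lambda>\<gamma>. \<gamma>) (\<lambda>\<gamma>. \<gamma>)"
    and \<Omega>: "\<Omega> = (\<Union>\<gamma>\<in>carrier \<Gamma>. pgl_act (\<rho> \<gamma>) ` proj_hull (\<Omega>0 \<union> \<Omega>1))"
  shows "discrete_faithful \<Gamma> \<rho> \<and>
    proj_hull_defined (\<Omega>0 \<union> \<Omega>1) \<and>
    (\<forall>\<gamma>\<in>carrier \<Gamma>. pgl_act (\<rho> \<gamma>) ` \<Omega> = \<Omega>) \<and>
    open \<Omega> \<and>
    properly_convex \<Omega>"
proof -
  have "\<Omega>0 \<inter> \<Omega>1 \<noteq> {}"
  proof -
    from distinct obtain \<gamma> where "\<gamma> \<in> \<Gamma>0 - \<Delta> \<or> \<gamma> \<in> \<Gamma>1 - \<Delta>" unfolding \<Delta> by blast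
    then show ?thesis
      using occultation0[of \<gamma>] occultation1[of \<gamma>] unfolding occultation_position_def by blast
  qed
  then obtain A B where AB: "proper_cone A" "proper_cone B" "pclass ` A = \<Omega>0" "pclass ` B = \<Omega>1" "A \<inter> B \<noteq> {}"
    by (rule proper_cones_lift[OF \<Omega>0(1) \<Omega>1(1)])
  define K where "K i = (if i then B else A)" for i
  define G where "G i = (if i then \<Gamma>1 else \<Gamma>0)" for i
  interpret projective_occultation G K
  proof (rule projective_occultation.intro)
    show "DIM('a) \<ge> 3" by (rule dim)
    show "subgroup (G i) PGL" "proper_cone (K i)" for i
      using \<Gamma>0(1) \<Gamma>1(1) AB(1,2) by (auto simp: G_def K_def)
    show "K i \<inter> K (\<not> i) \<noteq> {}" for i using AB(5) by (auto simp: K_def Int_commute)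
    show "pgl_act \<gamma> ` pclass ` K i = pclass ` K i" if "\<gamma> \<in> G i" for i \<gamma>
      using that \<Omega>0(2) \<Omega>1(2) AB(3,4) by (auto simp: G_def K_def split: if_splits)
    show "occultation_position (pclass ` K (\<not> i)) (pclass ` K i) (pgl_act \<gamma> ` pclass ` K (\<not> i))"
      if "\<gamma> \<in> G i - G (\<not> i)" for i \<gamma>
      using that occultation0[of \<gamma>] occultation1[of \<gamma>] AB(3,4)
      by (auto simp: G_def K_def \<Delta> split: if_splits)
    have "G True - G False \<noteq> {} \<or> G False - G True \<noteq> {}" using distinct by (auto simp: G_def)
    then show "\<exists>i. G i - G (\<not> i) \<noteq> {}" by (metis (full_types))
  qed
  have [simp]: "G False = \<Gamma>0" "G True = \<Gamma>1" "pclass ` K False = \<Omega>0" "pclass ` K True = \<Omega>1"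
    using AB by (simp_all add: G_def K_def)
  have P: "am.P = \<Gamma>" unfolding \<Gamma> \<Delta> by simp
  have dom: "\<Omega> = pclass ` domain_cone"
    using rep_domain proj_hull_edge(2) unfolding \<Omega> P \<rho> by simp
  have "discrete_faithful \<Gamma> \<rho>"
  proof -
    have "discrete (G i)" for i using \<Gamma>0(2) \<Gamma>1(2) by (simp add: G_def)
    then show ?thesis
      unfolding discrete_faithful_def \<rho> P[symmetric] rep_image using rep_inj discrete_products by blast
  qed
  moreover have "proj_hull_defined (\<Omega>0 \<union> \<Omega>1)" using proj_hull_edge(1) by simp
  moreover have "\<forall>\<gamma>\<in>carrier \<Gamma>. pgl_act (\<rho> \<gamma>) ` \<Omega> = \<Omega>"
    unfolding dom \<rho> P[symmetric] using rep_domain_invariant by blast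
  moreover have "properly_convex \<Omega>"
    unfolding dom by (rule properly_convex_pclass_cone[OF proper_cone_domain])
  ultimately show ?thesis unfolding properly_convex_def by blast
qed

end
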